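(* Let $(T^*SU(3))_{\mathrm{impl}}$ be the universal imploded cross-section of $SU(3)$, and let $m$ be the lower middle perversity. Then $$\widetilde{H}I^{m}_j\big((T^*SU(3))_{\mathrm{impl}}\big)\cong\begin{cases}\mathbb{R} & \text{if } j=5,9,\\ 0 & \text{otherwise.}\end{cases}$$
   Context: Universal imploded cross-section: let $K$ be a compact connected Lie group with Lie algebra $\mathbf{k}$, maximal torus $T$ with Lie algebra $\mathbf{t}$, and closed fundamental Weyl chamber $\mathbf{t}^*_+\subset\mathbf{t}^*$. For a Hamiltonian $K$-manifold $M$ with equivariant moment map $\Phi:M\to\mathbf{k}^*$, the imploded cross-section is $M_{\mathrm{impl}}=\Phi^{-1}(\mathbf{t}^*_+)/\!\sim$ with the quotient topology, where $m_1\sim m_2$ if $k\cdot m_1=m_2$ for some $k$ in the commutator subgroup $[K_{\Phi(m_1)},K_{\Phi(m_1)}]$ of the stabilizer $K_{\Phi(m_1)}$ of $\Phi(m_1)$ under the coadjoint action. The universal imploded cross-section of $K$ is $(T^*K)_{\mathrm{impl}}$, for the Hamiltonian $K$-action on $T^*K$ lifting the left action of $K$ on itself. Known identification: for $K=SU(3)$, $(T^*SU(3))_{\mathrm{impl}}$ is identified with the affine variety $\{(z,w)\in\mathbb{C}^3\times\mathbb{C}^3: z\cdot w=0\}$ with isolated singularity $(0,0)$, where $z\cdot w=\sum_i z_iw_i$, and this is homeomorphic to the open cone $c^{\circ}(Y)=\big((0,1]\times Y\big)/\big((1,y)\sim(1,y')\big)$ on the compact connected $9$-dimensional manifold $$Y=\{(z,w)\in\mathbb{C}^3\times\mathbb{C}^3: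 z\cdot w=0,\ |z|^2+|w|^2=1\}.$$ The intersection space below is formed with respect to this identification, with link $L=Y$. Homology of the intersection space: homology is singular homology with real coefficients; $\widetilde{H}_*$ is reduced homology. The lower middle perversity is $m(n)=\lfloor (n-2)/2\rfloor$, so $m(10)=4$. For $L$ a simply connected smooth manifold of dimension $l$ and $\overline{p}$ a perversity, put $k=l-\overline{p}(l+1)$ (here $l=9$ and $k=5$). A stage $k$ Moore approximation of $L$ is a continuous map $f:L_{<k}\to L$ from a (CW) space $L_{<k}$ with $H_i(L_{<k})=0$ for $i\ge k$ and $f_*:H_i(L_{<k})\to H_i(L)$ an isomorphism for $i<k$. With $c(Z)=(Z\times[0,1])/\big((z,1)\sim(z',1)\big)$ the closed cone on $Z$, the perversity $\overline{p}$ intersection space of $X=c^{\circ}(L)$ is $$I^{\overline{p}}X=\frac{\big(L\times[0,1)\big)\sqcup c(L_{<k})}{(f(x),0)\sim(x,0),\ x\in L_{<k}},$$ where $(x,0)$ is in the base of the cone, and $\widetilde{H}I^{\overline{p}}_j(X)=\widetilde{H}_j(I^{\overline{p}}X;\mathbb{R})$. *)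

theory Defs
  imports "HOL-Analysis.Analysis" "HOL-Analysis.Finite_Function_Topology" "HOL-Homology.Homology"
begin

section \<open>Quotient spaces and disjoint unions\<close>

definition generated_equiv :: "'a topology \<Rightarrow> ('a \<times> 'a) set \<Rightarrow> ('a \<times> 'a) set" where
  "generated_equiv X r =
     (let s = r \<inter> (topspace X \<times> topspace X)
      in (s \<union> s\<inverse>)\<^sup>* \<inter> (topspace X \<times> topspace X))"

definition quotient_point :: "'a topology \<Rightarrow> ('a \<times> 'a) set \<Rightarrow> 'a \<Rightarrow> 'a set" where
  "quotient_point X r x = generated_equiv X r `` {x}"

definition quotient_topology :: "'a topology \<Rightarrow> ('a \<times> 'a) set \<Rightarrow> 'a set topology" where
  "quotient_topology X r =
     topology (\<lambda>U. U \<subseteq> topspace X // generated_equiv X r \<and> openin X (\<Union>U))"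

definition disjoint_union_topology :: "'a topology \<Rightarrow> 'b topology \<Rightarrow> ('a + 'b) topology" where
  "disjoint_union_topology X Y =
     topology (\<lambda>U. openin X (Inl -` U) \<and> openin Y (Inr -` U))"

lemma equiv_generated_equiv: "equiv (topspace X) (generated_equiv X r)"
proof (rule equivI)
  define s where "s = r \<inter> (topspace X \<times> topspace X)"
  have e: "generated_equiv X r = (s \<union> s\<inverse>)\<^sup>* \<inter> (topspace X \<times> topspace X)"
    by (simp add: generated_equiv_def s_def Let_def)
  show "generated_equiv X r \<subseteq> topspace X \<times> topspace X"
    by (simp add: e)
  show "refl_on (topspace X) (generated_equiv X r)"
    by (auto simp: refl_on_def e)
  have "sym ((s \<union> s\<inverse>)\<^sup>*)"
    by (simp add: sym_Un_converse sym_rtrancl)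
  then show "sym (generated_equiv X r)"
    unfolding e sym_def by blast
  show "trans (generated_equiv X r)"
    unfolding e trans_def by (blast intro: rtrancl_trans)
qed

lemma istopology_quotient:
  "istopology (\<lambda>U. U \<subseteq> topspace X // generated_equiv X r \<and> openin X (\<Union>U))"
proof -
  let ?E = "generated_equiv X r"
  have "\<Union>(U \<inter> V) = \<Union>U \<inter> \<Union>V"
    if "U \<subseteq> topspace X // ?E" "V \<subseteq> topspace X // ?E" for U V
  proof
    show "\<Union>U \<inter> \<Union>V \<subseteq> \<Union>(U \<inter> V)"
    proof
      fix x assume "x \<in> \<Union>U \<inter> \<Union>V"
      then obtain A B where AB: "A \<in> U" "x \<in> A" "B \<in> V" "x \<in> B" by blast
      then have "A = B"
        using quotient_disj[OF equiv_generated_equiv, of A X r B] that by blast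
      then show "x \<in> \<Union>(U \<inter> V)" using AB by blast
    qed
  qed blast
  moreover have "openin X (\<Union>(\<Union>\<K>))" if "\<forall>U\<in>\<K>. openin X (\<Union>U)" for \<K>
  proof -
    have "openin X (\<Union>(Union ` \<K>))" using that by (intro openin_Union) blast
    moreover have "\<Union>(\<Union>\<K>) = \<Union>(Union ` \<K>)" by blast
    ultimately show ?thesis by (simp only:)
  qed
  ultimately show ?thesis
    unfolding istopology_def by (intro conjI allI impI) (simp_all add: le_infI1 Sup_le_iff openin_Int)
qed

lemma openin_quotient_topology:
  "openin (quotient_topology X r) U \<longleftrightarrow>
     U \<subseteq> topspace X // generated_equiv X r \<and> openin X (\<Union>U)"
  by (simp add: quotient_topology_def topology_inverse'[OF istopology_quotient])

lemma istopology_disjoint_union: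
  "istopology (\<lambda>U. openin X (Inl -` U) \<and> openin Y (Inr -` U))"
  unfolding istopology_def by (auto simp: vimage_Union vimage_Int)

lemma openin_disjoint_union_topology:
  "openin (disjoint_union_topology X Y) U \<longleftrightarrow> openin X (Inl -` U) \<and> openin Y (Inr -` U)"
  by (simp add: disjoint_union_topology_def topology_inverse'[OF istopology_disjoint_union])


section \<open>Cones\<close>

definition open_cone :: "'a topology \<Rightarrow> (real \<times> 'a) set topology" where
  "open_cone Y =
     quotient_topology (prod_topology (top_of_set {0<..1}) Y) {((1, y), (1, y')) |y y'. True}"

definition closed_cone_rel :: "(('a \<times> real) \<times> ('a \<times> real)) set" where
  "closed_cone_rel = {((z, 1), (z', 1)) |z z'. True}"

definition closed_cone :: "'a topology \<Rightarrow> ('a \<times> real) set topology" where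
  "closed_cone Z = quotient_topology (prod_topology Z (top_of_set {0..1})) closed_cone_rel"

definition closed_cone_point :: "'a topology \<Rightarrow> 'a \<Rightarrow> real \<Rightarrow> ('a \<times> real) set" where
  "closed_cone_point Z z t =
     quotient_point (prod_topology Z (top_of_set {0..1})) closed_cone_rel (z, t)"


section \<open>Real vector spaces as modules\<close>

text \<open>The ring multiplication and unit that the record type \<^type>\<open>module_scheme\<close> inherits play no
  role for modules and are left unspecified.\<close>

definition quotient_space :: "'v::real_vector set \<Rightarrow> 'v set \<Rightarrow> (real, 'v set) module" where
  "quotient_space Z B =
     \<lparr>carrier = (\<lambda>z. (+) z ` B) ` Z, mult = undefined, one = undefined,
      zero = B, add = (\<lambda>S T. {s + t |s t. s \<in> S \<and> t \<in> T}),
      smult = (\<lambda>r S. {r *\<^sub>R s + b |s b. s \<in> S \<and> b \<in> B})\<rparr>"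

definition vector_space_of :: "'v::real_vector set \<Rightarrow> (real, 'v) module" where
  "vector_space_of V =
     \<lparr>carrier = V, mult = undefined, one = undefined,
      zero = 0, add = (+), smult = (*\<^sub>R)\<rparr>"

definition linear_iso ::
  "('a \<Rightarrow> 'b) \<Rightarrow> (real, 'a, 'c) module_scheme \<Rightarrow> (real, 'b, 'd) module_scheme \<Rightarrow> bool" where
  "linear_iso h M N \<longleftrightarrow>
     bij_betw h (carrier M) (carrier N) \<and>
     (\<forall>x\<in>carrier M. \<forall>y\<in>carrier M. h (x \<oplus>\<^bsub>M\<^esub> y) = h x \<oplus>\<^bsub>N\<^esub> h y) \<and>
     (\<forall>r. \<forall>x\<in>carrier M. h (r \<odot>\<^bsub>M\<^esub> x) = r \<odot>\<^bsub>N\<^esub> h x)"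

definition linearly_isomorphic ::
  "(real, 'a, 'c) module_scheme \<Rightarrow> (real, 'b, 'd) module_scheme \<Rightarrow> bool" where
  "linearly_isomorphic M N \<longleftrightarrow> (\<exists>h. linear_iso h M N)"


section \<open>Singular homology with real coefficients\<close>

type_synonym 'a real_chain = "((nat \<Rightarrow> real) \<Rightarrow> 'a) \<Rightarrow>\<^sub>0 real"

definition real_chains :: "nat \<Rightarrow> 'a topology \<Rightarrow> 'a real_chain set" where
  "real_chains p X = {c. Poly_Mapping.keys c \<subseteq> {s. singular_simplex p X s}}"

definition real_boundary :: "nat \<Rightarrow> 'a real_chain \<Rightarrow> 'a real_chain" where
  "real_boundary p c =
     (if p = 0 then 0
      else \<Sum>s\<in>Poly_Mapping.keys c. \<Sum>k\<le>p.
             Poly_Mapping.single (singular_face p k s) ((-1) ^ k * Poly_Mapping.lookup c s))"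

definition real_cycles :: "nat \<Rightarrow> 'a topology \<Rightarrow> 'a real_chain set" where
  "real_cycles p X = {c \<in> real_chains p X. real_boundary p c = 0}"

definition real_boundaries :: "nat \<Rightarrow> 'a topology \<Rightarrow> 'a real_chain set" where
  "real_boundaries p X = real_boundary (Suc p) ` real_chains (Suc p) X"

definition real_homology :: "nat \<Rightarrow> 'a topology \<Rightarrow> (real, 'a real_chain set) module" where
  "real_homology p X = quotient_space (real_cycles p X) (real_boundaries p X)"

text \<open>Reduced homology is the homology of the chain complex augmented by the coefficient sum
  in degree 0.\<close>

definition reduced_real_cycles :: "nat \<Rightarrow> 'a topology \<Rightarrow> 'a real_chain set" where
  "reduced_real_cycles p X =
     {c \<in> real_cycles p X. p = 0 \<longrightarrow> (\<Sum>s\<in>Poly_Mapping.keys c. Poly_Mapping.lookup c s) = 0}"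

definition reduced_real_homology :: "nat \<Rightarrow> 'a topology \<Rightarrow> (real, 'a real_chain set) module" where
  "reduced_real_homology p X = quotient_space (reduced_real_cycles p X) (real_boundaries p X)"

definition real_chain_map :: "nat \<Rightarrow> ('a \<Rightarrow> 'b) \<Rightarrow> 'a real_chain \<Rightarrow> 'b real_chain" where
  "real_chain_map p f c =
     (\<Sum>s\<in>Poly_Mapping.keys c. Poly_Mapping.single (simplex_map p f s) (Poly_Mapping.lookup c s))"

definition real_homology_induced ::
  "nat \<Rightarrow> 'b topology \<Rightarrow> ('a \<Rightarrow> 'b) \<Rightarrow> 'a real_chain set \<Rightarrow> 'b real_chain set" where
  "real_homology_induced p Y f S =
     {real_chain_map p f c + b |c b. c \<in> S \<and> b \<in> real_boundaries p Y}"


section \<open>Moore approximations and intersection spaces\<close>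

definition lower_middle_perversity :: "nat \<Rightarrow> nat" where
  "lower_middle_perversity n = (n - 2) div 2"

definition moore_approximation ::
  "nat \<Rightarrow> 'l topology \<Rightarrow> 'z topology \<Rightarrow> ('z \<Rightarrow> 'l) \<Rightarrow> bool" where
  "moore_approximation k L Z f \<longleftrightarrow>
     continuous_map Z L f \<and>
     (\<forall>i\<ge>k. linearly_isomorphic (real_homology i Z) (vector_space_of {0::real})) \<and>
     (\<forall>i<k. linear_iso (real_homology_induced i L f) (real_homology i Z) (real_homology i L))"

definition intersection_space ::
  "'l topology \<Rightarrow> 'z topology \<Rightarrow> ('z \<Rightarrow> 'l) \<Rightarrow> ('l \<times> real + ('z \<times> real) set) set topology" where
  "intersection_space L Z f =
     quotient_topology
       (disjoint_union_topology (prod_topology L (top_of_set {0..<1})) (closed_cone Z))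
       {(Inr (closed_cone_point Z z 0), Inl (f z, 0)) |z. z \<in> topspace Z}"

text \<open>\<open>I\<close> is a perversity \<open>p\<close> intersection space of \<open>X\<close>, formed with respect to an identification
  of \<open>X\<close> with the open cone on a link \<open>L\<close> of dimension \<open>l\<close>. The space \<open>I\<close> depends on the choice
  of a Moore approximation of \<open>L\<close>, whose domain may be any topological space (in particular
  any CW complex).\<close>

definition is_intersection_space ::
  "(nat \<Rightarrow> nat) \<Rightarrow> nat \<Rightarrow> 'l topology \<Rightarrow> 'x topology \<Rightarrow>
   ('l \<times> real + ('z \<times> real) set) set topology \<Rightarrow> bool" where
  "is_intersection_space p l L X I \<longleftrightarrow>
     X homeomorphic_space open_cone L \<and>
     (\<exists>(Z :: 'z topology) f.
        moore_approximation (l - p (l + 1)) L Z f \<and> I = intersection_space L Z f)"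


section \<open>Symplectic implosion\<close>

text \<open>The imploded cross-section of a space \<open>M\<close> with an action \<open>act\<close> of \<open>K\<close> and moment map \<open>\<Phi>\<close>,
  for the coadjoint action \<open>coad\<close> and the closed Weyl chamber \<open>C\<close>.\<close>

definition coadjoint_stabilizer ::
  "('g, 'c) monoid_scheme \<Rightarrow> ('g \<Rightarrow> 'v \<Rightarrow> 'v) \<Rightarrow> 'v \<Rightarrow> 'g set" where
  "coadjoint_stabilizer K coad v = {k \<in> carrier K. coad k v = v}"

definition imploded_cross_section ::
  "('g, 'c) monoid_scheme \<Rightarrow> ('g \<Rightarrow> 'v \<Rightarrow> 'v) \<Rightarrow> 'v set \<Rightarrow>
   'm topology \<Rightarrow> ('g \<Rightarrow> 'm \<Rightarrow> 'm) \<Rightarrow> ('m \<Rightarrow> 'v) \<Rightarrow> 'm set topology" where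
  "imploded_cross_section K coad C M act \<Phi> =
     quotient_topology (subtopology M (\<Phi> -` C))
       {(m, act k m) |m k. k \<in> derived K (coadjoint_stabilizer K coad (\<Phi> m))}"


section \<open>The universal imploded cross-section of SU(3)\<close>

definition ctranspose :: "complex^'n^'m \<Rightarrow> complex^'m^'n" where
  "ctranspose A = (\<chi> i j. cnj (A $ j $ i))"

definition SU3 :: "(complex^3^3) monoid" where
  "SU3 = \<lparr>carrier = {A. A ** ctranspose A = mat 1 \<and> det A = 1}, mult = (**), one = mat 1\<rparr>"

text \<open>The Lie algebra consists of the traceless skew-Hermitian matrices. The inner product
  \<open>A \<bullet> B = Re (tr (A B\<^sup>*))\<close> of the ambient matrix space is invariant under conjugation by unitary
  matrices; it is used to identify the dual of the Lie algebra with the Lie algebra, and hence the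
  coadjoint action with conjugation. The maximal torus is the diagonal one.\<close>

definition su3 :: "(complex^3^3) set" where
  "su3 = {A. ctranspose A = - A \<and> trace A = 0}"

definition su3_coadjoint :: "complex^3^3 \<Rightarrow> complex^3^3 \<Rightarrow> complex^3^3" where
  "su3_coadjoint g A = g ** A ** ctranspose g"

definition su3_chamber :: "(complex^3^3) set" where
  "su3_chamber =
     {A. \<exists>a :: real^3. a $ 1 \<ge> a $ 2 \<and> a $ 2 \<ge> a $ 3 \<and> a $ 1 + a $ 2 + a $ 3 = 0 \<and>
           A = (\<chi> i j. if i = j then \<i> * complex_of_real (a $ i) else 0)}"

text \<open>The cotangent bundle is trivialised by left translations: \<open>(k, A)\<close> stands for the covector
  \<open>v \<mapsto> A \<bullet> (k\<inverse> v)\<close> on the tangent space at \<open>k\<close>. The cotangent lift of left multiplication then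
  acts only on the first component. Its moment map pairs a covector at \<open>k\<close> with the generating
  vector field \<open>\<xi> \<mapsto> \<xi> k\<close>, which gives \<open>\<xi> \<mapsto> A \<bullet> (k\<inverse> \<xi> k)\<close>, that is, the coadjoint action of
  \<open>k\<close> on \<open>A\<close>.\<close>

definition cotangent_SU3 :: "((complex^3^3) \<times> (complex^3^3)) topology" where
  "cotangent_SU3 = top_of_set (carrier SU3 \<times> su3)"

definition cotangent_SU3_action ::
  "complex^3^3 \<Rightarrow> (complex^3^3) \<times> (complex^3^3) \<Rightarrow> (complex^3^3) \<times> (complex^3^3)" where
  "cotangent_SU3_action g m = (g ** fst m, snd m)"

definition cotangent_SU3_moment :: "(complex^3^3) \<times> (complex^3^3) \<Rightarrow> complex^3^3" where
  "cotangent_SU3_moment m = su3_coadjoint (fst m) (snd m)"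

definition SU3_universal_implosion :: "((complex^3^3) \<times> (complex^3^3)) set topology" where
  "SU3_universal_implosion =
     imploded_cross_section SU3 su3_coadjoint su3_chamber
       cotangent_SU3 cotangent_SU3_action cotangent_SU3_moment"

definition SU3_implosion_link :: "((complex^3) \<times> (complex^3)) topology" where
  "SU3_implosion_link =
     top_of_set {(z, w). (\<Sum>i\<in>UNIV. z $ i * w $ i) = 0 \<and> (norm z)\<^sup>2 + (norm w)\<^sup>2 = 1}"

end

theory Submission
  imports Defs
begin

text \<open>Sending \<open>(k, A)\<close> with moment \<open>i diag(a\<^sub>1, a\<^sub>2, a\<^sub>3)\<close> in the chamber to the first row of \<open>k\<close> scaled
  by \<open>\<surd>(a\<^sub>1 - a\<^sub>2)\<close> and the conjugate of the third row scaled by \<open>\<surd>(a\<^sub>2 - a\<^sub>3)\<close> is a proper surjection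
  onto the quadric \<open>z \<cdot> w = 0\<close> whose fibres are the implosion classes, so the implosion is the
  open cone on the link.

  The quadric without its vertex is exhausted by the open set \<open>z \<noteq> 0\<close>, which retracts onto
  \<open>\<complex>\<^sup>3 - 0\<close> and contributes degree 5, and the open set omitting only the points \<open>(0, w)\<close> with \<open>w\<close>
  on a fixed real ray. Their relative homology is that of \<open>(\<complex>\<^sup>2, \<complex>\<^sup>2 - 0)\<close>, in degree 4, and the ray
  has codimension 9. A four-sphere in the link carries the homology below degree 5 and serves as a
  Moore approximation.

  Collapsing the cone of an arbitrary Moore approximation turns the reduced homology of the
  intersection space into the homology of the pair consisting of the link and the approximation,
  which is that of the link in degrees 5 and above.\<close>

section \<open>Real chains\<close>

text \<open>No connecting map between the strata is ever computed. The relative classes live in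
  degrees 4 and 9, and their boundaries would live in degrees 3 and 8, where the smaller stratum has
  no homology relative to the base point. The groups of the strata being 0 or a line, exact
  sequences enter only as criteria for maps of pairs to be injective or surjective on homology,
  phrased directly with cycles and boundaries.

  That the class of the four-sphere is the degree 4 class of the link is seen by restricting both to
  the same pair, \<open>C^2\<close> and \<open>C^2 - 0\<close>. The cut-off is 9 - 4 = 5, so degree
  4 of the link is matched by any approximation and cancels, while 5 and 9 survive.

  The domain of a Moore approximation is an arbitrary topological space, without cells or a metric.
  The intersection space is therefore cut by a height function into open pieces, and homotopies are
  defined before any identification and descended along the quotient map, which is possible because
  the unit interval is locally compact and Hausdorff.\<close>

lemma lookup_scaleR_poly_mapping [simp]:
  "Poly_Mapping.lookup (r *\<^sub>R c) s = r *\<^sub>R Poly_Mapping.lookup c s"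
proof -
  have "finite {i. r *\<^sub>R Poly_Mapping.lookup c i \<noteq> 0}"
    by (rule finite_subset[OF _ finite_lookup[of c]]) auto
  then show ?thesis
    by (simp add: scaleR_poly_mapping_def)
qed

lemma single_scaleR: "Poly_Mapping.single s (a * b) = a *\<^sub>R Poly_Mapping.single s (b::real)"
  by (rule poly_mapping_eqI) (simp add: lookup_single when_def)

lemma keys_scaleR_subset: "Poly_Mapping.keys (r *\<^sub>R c) \<subseteq> Poly_Mapping.keys (c :: 'b \<Rightarrow>\<^sub>0 real)"
  by (auto simp: in_keys_iff)

text \<open>Real counterpart of \<open>frag_extend\<close>. Boundary and chain map become instances
  of it, so identities between them need checking on single simplices only.\<close>

definition real_extend :: "('b \<Rightarrow> 'v::real_vector) \<Rightarrow> ('b \<Rightarrow>\<^sub>0 real) \<Rightarrow> 'v" where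
  "real_extend g c = (\<Sum>s\<in>Poly_Mapping.keys c. Poly_Mapping.lookup c s *\<^sub>R g s)"

lemma real_extend_superset:
  assumes "finite S" "Poly_Mapping.keys c \<subseteq> S"
  shows "real_extend g c = (\<Sum>s\<in>S. Poly_Mapping.lookup c s *\<^sub>R g s)"
  unfolding real_extend_def
  by (rule sum.mono_neutral_left) (use assms in \<open>auto simp: in_keys_iff\<close>)

lemma linear_real_extend: "linear (real_extend g)"
proof (rule linearI)
  fix a b :: "'a \<Rightarrow>\<^sub>0 real" and r :: real
  let ?S = "Poly_Mapping.keys a \<union> Poly_Mapping.keys b"
  have "real_extend g (a + b) = (\<Sum>s\<in>?S. Poly_Mapping.lookup (a + b) s *\<^sub>R g s)"
    by (rule real_extend_superset) (use keys_add[of a b] in auto)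
  also have "\<dots> = real_extend g a + real_extend g b"
    by (simp add: real_extend_superset[of ?S] lookup_add scaleR_left_distrib sum.distrib)
  finally show "real_extend g (a + b) = real_extend g a + real_extend g b" .
  have "real_extend g (r *\<^sub>R a) = (\<Sum>s\<in>Poly_Mapping.keys a. Poly_Mapping.lookup (r *\<^sub>R a) s *\<^sub>R g s)"
    by (rule real_extend_superset) (auto simp: in_keys_iff)
  then show "real_extend g (r *\<^sub>R a) = r *\<^sub>R real_extend g a"
    by (simp add: real_extend_def scaleR_sum_right)
qed

lemma real_extend_single [simp]: "real_extend g (Poly_Mapping.single s 1) = g s"
  by (simp add: real_extend_def)

lemma real_chain_expansion:
  fixes c :: "'b \<Rightarrow>\<^sub>0 real"
  shows "c = (\<Sum>s\<in>Poly_Mapping.keys c. Poly_Mapping.lookup c s *\<^sub>R Poly_Mapping.single s 1)"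
proof (rule poly_mapping_eqI)
  fix k
  have "(\<Sum>s\<in>Poly_Mapping.keys c. Poly_Mapping.lookup c s * (if s = k then 1 else 0)) = Poly_Mapping.lookup c k"
    by (simp add: if_distrib[of "(*) _"] sum.delta in_keys_iff cong: if_cong)
  then show "Poly_Mapping.lookup c k = Poly_Mapping.lookup
      (\<Sum>s\<in>Poly_Mapping.keys c. Poly_Mapping.lookup c s *\<^sub>R Poly_Mapping.single s 1) k"
    by (simp add: lookup_sum lookup_single when_def)
qed

text \<open>The comparison is restricted to simplices in the support of \<open>c\<close>, so that
  identities known only for singular simplices of a given space can be used.\<close>

lemma linear_eq_on_real_chain:
  fixes c :: "'b \<Rightarrow>\<^sub>0 real"
  assumes "linear F" "linear G"
    and "\<And>s. s \<in> Poly_Mapping.keys c \<Longrightarrow> F (Poly_Mapping.single s 1) = G (Poly_Mapping.single s 1)"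
  shows "F c = G c"
  by (subst (1 2) real_chain_expansion) (simp add: assms linear_sum linear_scale)

lemma real_boundary_eq:
  "real_boundary p = (if p = 0 then (\<lambda>c. 0) else
     real_extend (\<lambda>s. \<Sum>k\<le>p. Poly_Mapping.single (singular_face p k s) ((-1) ^ k)))"
  by (rule ext) (simp add: real_boundary_def real_extend_def scaleR_sum_right
      flip: single_scaleR, simp add: mult.commute)

lemma real_chain_map_eq:
  "real_chain_map p f = real_extend (\<lambda>s. Poly_Mapping.single (simplex_map p f s) 1)"
  by (rule ext) (simp add: real_chain_map_def real_extend_def flip: single_scaleR)

lemma linear_real_boundary: "linear (real_boundary p)"
  by (simp add: real_boundary_eq linear_real_extend linear_zero)

lemma linear_real_chain_map: "linear (real_chain_map p f)"
  by (simp add: real_chain_map_eq linear_real_extend)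

lemmas real_boundary_simps = linear_add[OF linear_real_boundary] linear_diff[OF linear_real_boundary]
  linear_scale[OF linear_real_boundary] linear_neg[OF linear_real_boundary]
  linear_0[OF linear_real_boundary] linear_sum[OF linear_real_boundary]

lemmas real_chain_map_simps = linear_add[OF linear_real_chain_map] linear_diff[OF linear_real_chain_map]
  linear_scale[OF linear_real_chain_map] linear_neg[OF linear_real_chain_map]
  linear_0[OF linear_real_chain_map] linear_sum[OF linear_real_chain_map]

lemma subspace_real_chains: "subspace (real_chains p X)"
  unfolding subspace_def real_chains_def
  using keys_add keys_scaleR_subset by fastforce

section \<open>Integral chains inside real chains\<close>

definition real_of_chain :: "('b \<Rightarrow>\<^sub>0 int) \<Rightarrow> 'b \<Rightarrow>\<^sub>0 real" where
  "real_of_chain c = Poly_Mapping.map real_of_int c"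

lemma lookup_real_of_chain [simp]:
  "Poly_Mapping.lookup (real_of_chain c) s = real_of_int (Poly_Mapping.lookup c s)"
  by (simp add: real_of_chain_def map.rep_eq when_def)

lemma keys_real_of_chain [simp]: "Poly_Mapping.keys (real_of_chain c) = Poly_Mapping.keys c"
  by (auto simp: in_keys_iff)

lemma real_of_chain_simps [simp]:
  "real_of_chain 0 = 0" "real_of_chain (a + b) = real_of_chain a + real_of_chain b"
  "real_of_chain (a - b) = real_of_chain a - real_of_chain b"
  "real_of_chain (frag_of s) = Poly_Mapping.single s 1"
  "real_of_chain (frag_cmul n a) = real_of_int n *\<^sub>R real_of_chain a"
  by (rule poly_mapping_eqI;
      simp add: lookup_add lookup_minus lookup_single when_def lookup_frag_cmul)+

lemma real_of_chain_sum: "real_of_chain (sum f I) = (\<Sum>i\<in>I. real_of_chain (f i))"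
  by (induction I rule: infinite_finite_induct) auto

lemma real_of_chain_frag_extend:
  "real_of_chain (frag_extend g c) = real_extend (\<lambda>s. real_of_chain (g s)) (real_of_chain c)"
  by (simp add: frag_extend_def real_extend_def real_of_chain_sum)

lemma real_of_chain_boundary:
  "real_of_chain (chain_boundary p c) = real_boundary p (real_of_chain c)"
proof -
  have "Poly_Mapping.single s ((-1) ^ k) = (-1) ^ k *\<^sub>R Poly_Mapping.single s (1::real)"
    for s :: "(nat \<Rightarrow> real) \<Rightarrow> 'a" and k :: nat
    by (simp flip: single_scaleR)
  then show ?thesis
    by (simp add: chain_boundary_def real_boundary_eq real_of_chain_frag_extend real_of_chain_sum)
qed

lemma real_of_chain_map:
  "real_of_chain (chain_map p f c) = real_chain_map p f (real_of_chain c)"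
  by (simp add: chain_map_def real_chain_map_eq real_of_chain_frag_extend)

lemma real_of_chain_in_real_chains: "real_of_chain c \<in> real_chains p X \<longleftrightarrow> singular_chain p X c"
  by (simp add: real_chains_def singular_chain_def)

lemma single_eq_real_of_chain: "Poly_Mapping.single s (1::real) = real_of_chain (frag_of s)"
  by simp

text \<open>The integral identity for \<open>frag_of s\<close> is transported through
  \<open>real_of_chain\<close>, and linearity does the rest. The compatibility of boundaries with
  chain maps follows the same scheme.\<close>

lemma real_boundary_boundary:
  assumes "c \<in> real_chains p X"
  shows "real_boundary (p - 1) (real_boundary p c) = 0"
proof -
  have "(real_boundary (p - 1) \<circ> real_boundary p) c = (\<lambda>c. 0) c"
  proof (rule linear_eq_on_real_chain[where F = "real_boundary (p - 1) \<circ> real_boundary p" and G = "\<lambda>c. 0"])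
    fix s assume "s \<in> Poly_Mapping.keys c"
    then have "singular_chain p X (frag_of s)"
      using assms by (auto simp: real_chains_def singular_chain_of)
    from chain_boundary_boundary[OF this]
    show "(real_boundary (p - 1) \<circ> real_boundary p) (Poly_Mapping.single s 1) = 0"
      by (simp only: single_eq_real_of_chain comp_apply flip: real_of_chain_boundary) simp
  qed (auto intro!: linear_compose linear_real_boundary linear_zero)
  then show ?thesis by simp
qed

lemma real_boundary_in_real_chains:
  assumes "c \<in> real_chains p X"
  shows "real_boundary p c \<in> real_chains (p - 1) X"
proof (cases "p = 0")
  case False
  have "real_boundary p (Poly_Mapping.single s 1) \<in> real_chains (p - 1) X"
    if "s \<in> Poly_Mapping.keys c" for s
    using that assms singular_chain_boundary[of p X "frag_of s"]
    by (simp only: single_eq_real_of_chain real_of_chain_in_real_chains flip: real_of_chain_boundary)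
      (auto simp: real_chains_def singular_chain_of)
  then show ?thesis
    by (subst real_chain_expansion)
      (simp add: real_boundary_simps subspace_sum[OF subspace_real_chains] subspace_scale[OF subspace_real_chains])
qed (simp add: real_boundary_def subspace_0[OF subspace_real_chains])

lemma real_chain_map_in_real_chains:
  assumes "c \<in> real_chains p X" "continuous_map X Y f"
  shows "real_chain_map p f c \<in> real_chains p Y"
proof -
  have "real_chain_map p f (Poly_Mapping.single s 1) \<in> real_chains p Y"
    if "s \<in> Poly_Mapping.keys c" for s
    using that assms singular_chain_chain_map[of p X "frag_of s" Y f]
    by (simp only: single_eq_real_of_chain real_of_chain_in_real_chains flip: real_of_chain_map)
      (auto simp: real_chains_def singular_chain_of)
  then show ?thesis
    by (subst real_chain_expansion)
      (simp add: real_chain_map_simps subspace_sum[OF subspace_real_chains] subspace_scale[OF subspace_real_chains])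
qed

lemma real_boundary_chain_map:
  assumes "c \<in> real_chains p X"
  shows "real_boundary p (real_chain_map p f c) = real_chain_map (p - 1) f (real_boundary p c)"
proof -
  have "(real_boundary p \<circ> real_chain_map p f) c = (real_chain_map (p - 1) f \<circ> real_boundary p) c"
  proof (rule linear_eq_on_real_chain[where F = "real_boundary p \<circ> real_chain_map p f"
        and G = "real_chain_map (p - 1) f \<circ> real_boundary p"])
    fix s assume "s \<in> Poly_Mapping.keys c"
    then have "singular_chain p X (frag_of s)"
      using assms by (auto simp: real_chains_def singular_chain_of)
    from chain_boundary_chain_map[OF this, of f]
    have "real_of_chain (chain_boundary p (chain_map p f (frag_of s)))
        = real_of_chain (chain_map (p - 1) f (chain_boundary p (frag_of s)))" by simp
    then show "(real_boundary p \<circ> real_chain_map p f) (Poly_Mapping.single s 1) =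
        (real_chain_map (p - 1) f \<circ> real_boundary p) (Poly_Mapping.single s 1)"
      by (simp only: single_eq_real_of_chain comp_apply real_of_chain_boundary real_of_chain_map)
  qed (auto intro!: linear_compose linear_real_boundary linear_real_chain_map)
  then show ?thesis by simp
qed

lemma real_chain_map_single [simp]:
  "real_chain_map p f (Poly_Mapping.single s 1) = Poly_Mapping.single (simplex_map p f s) 1"
  by (simp add: real_chain_map_eq)

lemma real_chain_map_compose:
  "real_chain_map p (g \<circ> f) c = real_chain_map p g (real_chain_map p f c)"
proof -
  have "real_chain_map p (g \<circ> f) c = (real_chain_map p g \<circ> real_chain_map p f) c"
    by (rule linear_eq_on_real_chain[where F = "real_chain_map p (g \<circ> f)" and
          G = "real_chain_map p g \<circ> real_chain_map p f",
          OF linear_real_chain_map linear_compose[OF linear_real_chain_map linear_real_chain_map]])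
      (simp add: simplex_map_compose)
  then show ?thesis by simp
qed

lemma real_chain_map_eq_on:
  assumes "c \<in> real_chains p X" "\<And>x. x \<in> topspace X \<Longrightarrow> f x = g x"
  shows "real_chain_map p f c = real_chain_map p g c"
  by (rule linear_eq_on_real_chain[where F = "real_chain_map p f", OF linear_real_chain_map linear_real_chain_map])
    (use assms simplex_map_eq[of p X _ f g] in \<open>auto simp: real_chains_def\<close>)

lemma real_chain_map_id:
  assumes "c \<in> real_chains p X" "\<And>x. x \<in> topspace X \<Longrightarrow> f x = x"
  shows "real_chain_map p f c = c"
proof -
  have "real_chain_map p f c = id c"
    by (rule linear_eq_on_real_chain[where F = "real_chain_map p f", OF linear_real_chain_map linear_id])
      (use assms simplex_map_id_gen[of p X _ f] in \<open>auto simp: real_chains_def\<close>)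
  then show ?thesis by simp
qed

lemma real_chains_mono:
  assumes "c \<in> real_chains p (subtopology X A)" "A \<inter> topspace X \<subseteq> B"
  shows "c \<in> real_chains p (subtopology X B)"
proof -
  have "subtopology X A = subtopology (subtopology X B) A"
    using assms(2) by (metis inf.absorb_iff2 inf.assoc inf_commute subtopology_restrict subtopology_subtopology)
  then show ?thesis
    using assms(1) singular_simplex_subtopology[of p "subtopology X B" A] by (auto simp: real_chains_def)
qed

lemma real_chains_subtopology:
  "c \<in> real_chains p (subtopology X A) \<Longrightarrow> c \<in> real_chains p X"
  unfolding real_chains_def by (auto simp: singular_simplex_subtopology)

lemma real_chains_subtopology_iff:
  "c \<in> real_chains p (subtopology X A) \<longleftrightarrow> c \<in> real_chains p X \<and>
     (\<forall>s\<in>Poly_Mapping.keys c. s ` standard_simplex p \<subseteq> A)"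
  unfolding real_chains_def by (auto simp: singular_simplex_subtopology subset_iff Pi_iff image_subset_iff)

lemma real_chains_subtopology_empty [simp]: "real_chains p trivial_topology = {0}"
  by (auto simp: real_chains_def singular_simplex_empty subset_eq intro: poly_mapping_eqI)

section \<open>Real cycles as real combinations of integral cycles\<close>

text \<open>Excision and homotopy invariance are inherited from integral singular homology: writing the
  coefficients of a real chain in a basis of the rational space that they span, rescaled to clear
  denominators, splits the chain into integral chains, and by independence of the basis each of
  these has its support and its boundary where those of the real chain are.\<close>

definition int_independent :: "'b set \<Rightarrow> ('b \<Rightarrow> real) \<Rightarrow> bool" where
  "int_independent B w \<longleftrightarrow>
     finite B \<and> (\<forall>m. (\<Sum>b\<in>B. w b * real_of_int (m b)) = 0 \<longrightarrow> (\<forall>b\<in>B. m b = (0::int)))"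

lemma common_denominator:
  assumes "finite (S :: rat set)"
  shows "\<exists>N>0. \<forall>q\<in>S. \<exists>m. of_int N * q = of_int m"
  using assms
proof (induction S)
  case empty
  show ?case by (intro exI[of _ "1::int"]) simp
next
  case (insert q S)
  then obtain N where N: "N > 0" "\<forall>q\<in>S. \<exists>m. of_int N * q = of_int m" by blast
  obtain a b where ab: "q = of_int a / of_int b" "b > 0"
    by (metis quotient_of_div quotient_of_denom_pos surj_pair)
  show ?case
  proof (rule exI[of _ "N * b"], intro conjI ballI)
    show "N * b > 0" using N ab by simp
    fix r assume "r \<in> insert q S"
    then consider "r = q" | "r \<in> S" by blast
    then show "\<exists>m. of_int (N * b) * r = of_int m"
    proof cases
      case 1
      then show ?thesis using ab by (intro exI[of _ "N * a"]) simp
    next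
      case 2
      then obtain m where "of_int N * r = of_int m" using N by blast
      then show ?thesis by (intro exI[of _ "b * m"]) (simp add: mult.commute mult.left_commute)
    qed
  qed
qed

lemma int_independent_coordinates:
  assumes "finite (V :: real set)"
  obtains B :: "real set" and w n where "int_independent B w"
    "\<And>v. v \<in> V \<Longrightarrow> v = (\<Sum>b\<in>B. w b * real_of_int (n v b))"
proof -
  \<comment> \<open>The reals as a vector space over the rationals: a basis of the span of
    \<open>V\<close> can be chosen inside \<open>V\<close>, hence finite.\<close>
  interpret Q: vector_space "\<lambda>(q::rat) (x::real). of_rat q * x"
    by unfold_locales (simp_all add: of_rat_add of_rat_mult algebra_simps)
  obtain B where B: "B \<subseteq> V" "Q.independent B" "V \<subseteq> Q.span B"
    using Q.maximal_independent_subset by blast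
  have fB: "finite B" using B(1) assms finite_subset by blast
  have "\<exists>u. v = (\<Sum>b\<in>B. of_rat (u b) * b)" if "v \<in> V" for v
    using B(3) that Q.span_finite[OF fB] by auto
  then obtain u where u: "\<And>v. v \<in> V \<Longrightarrow> v = (\<Sum>b\<in>B. of_rat (u v b) * b)" by metis
  have "finite ((\<lambda>(v, b). u v b) ` (V \<times> B))" using assms fB by blast
  from common_denominator[OF this] obtain N where N: "N > 0"
    "\<And>v b. v \<in> V \<Longrightarrow> b \<in> B \<Longrightarrow> \<exists>m. of_int N * u v b = of_int m" by fastforce
  then obtain n where n: "\<And>v b. v \<in> V \<Longrightarrow> b \<in> B \<Longrightarrow> of_int N * u v b = of_int (n v b)" by metis
  have u_eq: "u v b = of_int (n v b) / of_int N" if "v \<in> V" "b \<in> B" for v b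
    using n[OF that] N(1) by (simp add: field_simps)
  show ?thesis
  proof
    \<comment> \<open>Shrinking the basis by the common denominator \<open>N\<close> makes all
      coordinates integers and keeps independence.\<close>
    show "int_independent B (\<lambda>b. b / real_of_int N)"
      unfolding int_independent_def
    proof (intro conjI allI impI ballI)
      fix m :: "real \<Rightarrow> int" and b
      assume "(\<Sum>b\<in>B. b / real_of_int N * real_of_int (m b)) = 0" and b: "b \<in> B"
      then have "(\<Sum>b\<in>B. of_rat (of_int (m b)) * b) / real_of_int N = 0"
        by (simp add: sum_divide_distrib mult.commute)
      then have "(\<Sum>b\<in>B. of_rat (of_int (m b)) * b) = 0"
        using N(1) by simp
      then have "(of_int (m b) :: rat) = 0"
        using Q.independentD[OF B(2) fB subset_refl, of "\<lambda>b. of_int (m b)"] b by blast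
      then show "m b = 0" by simp
    qed (rule fB)
    fix v assume "v \<in> V"
    then have "v = (\<Sum>b\<in>B. of_rat (u v b) * b)" by (rule u)
    also have "\<dots> = (\<Sum>b\<in>B. b / real_of_int N * real_of_int (n v b))"
      by (rule sum.cong) (simp_all add: u_eq \<open>v \<in> V\<close> of_rat_divide)
    finally show "v = \<dots>" .
  qed
qed

lemma real_chain_integral_decomposition:
  fixes c :: "'b \<Rightarrow>\<^sub>0 real"
  obtains B :: "real set" and w C where "int_independent B w"
    "c = (\<Sum>b\<in>B. w b *\<^sub>R real_of_chain (C b))"
proof -
  let ?l = "Poly_Mapping.lookup c"
  have "finite (?l ` Poly_Mapping.keys c)" by simp
  from int_independent_coordinates[OF this] obtain B :: "real set" and w n where
    B: "int_independent B w" and n: "\<And>v. v \<in> ?l ` Poly_Mapping.keys c \<Longrightarrow> v = (\<Sum>b\<in>B. w b * real_of_int (n v b))"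
    by blast
  \<comment> \<open>\<open>C b\<close> collects the \<open>b\<close>-coordinates of all coefficients
    of \<open>c\<close> into one integral chain.\<close>
  define C where "C b = (\<Sum>s\<in>Poly_Mapping.keys c. frag_cmul (n (?l s) b) (frag_of s))" for b
  have "(\<Sum>b\<in>B. w b *\<^sub>R real_of_chain (C b)) =
      (\<Sum>s\<in>Poly_Mapping.keys c. (\<Sum>b\<in>B. w b * real_of_int (n (?l s) b)) *\<^sub>R Poly_Mapping.single s 1)"
    unfolding C_def
    by (simp add: real_of_chain_sum scaleR_sum_right scaleR_sum_left sum.swap[of _ B])
  also have "\<dots> = (\<Sum>s\<in>Poly_Mapping.keys c. ?l s *\<^sub>R Poly_Mapping.single s 1)"
    by (rule sum.cong) (simp_all flip: n)
  also have "\<dots> = c" by (rule real_chain_expansion[symmetric])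
  finally show ?thesis using that B by metis
qed

text \<open>At a simplex outside \<open>K\<close> the real coefficient of the sum vanishes. It is an
  integer combination of the independent weights, so each integral coefficient vanishes there
  too.\<close>

lemma keys_int_independent:
  assumes "int_independent B w" "b \<in> B"
    and "Poly_Mapping.keys (\<Sum>b\<in>B. w b *\<^sub>R real_of_chain (D b)) \<subseteq> K"
  shows "Poly_Mapping.keys (D b) \<subseteq> K"
proof
  fix s assume s: "s \<in> Poly_Mapping.keys (D b)"
  show "s \<in> K"
  proof (rule ccontr)
    assume "s \<notin> K"
    then have "(\<Sum>b\<in>B. w b * real_of_int (Poly_Mapping.lookup (D b) s)) = 0"
      using assms(3) by (auto simp: in_keys_iff lookup_sum dest: subsetD)
    then show False
      using assms(1,2) s by (auto simp: int_independent_def in_keys_iff)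
  qed
qed

text \<open>The boundary of \<open>c\<close> decomposes with the same \<open>B\<close> and
  \<open>w\<close> into the boundaries of the components, so independence controls the support of a
  component and that of its boundary at once.\<close>

lemma real_chain_integral_decomposition_boundary:
  assumes "Poly_Mapping.keys c \<subseteq> K" "Poly_Mapping.keys (real_boundary p c) \<subseteq> L"
  obtains B :: "real set" and w C where "int_independent B w"
    "c = (\<Sum>b\<in>B. w b *\<^sub>R real_of_chain (C b))"
    "\<And>b. b \<in> B \<Longrightarrow> Poly_Mapping.keys (C b) \<subseteq> K"
    "\<And>b. b \<in> B \<Longrightarrow> Poly_Mapping.keys (chain_boundary p (C b)) \<subseteq> L"
proof -
  obtain B :: "real set" and w C where B: "int_independent B w"
    and c: "c = (\<Sum>b\<in>B. w b *\<^sub>R real_of_chain (C b))"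
    by (rule real_chain_integral_decomposition)
  have "real_boundary p c = (\<Sum>b\<in>B. w b *\<^sub>R real_of_chain (chain_boundary p (C b)))"
    by (simp add: c real_boundary_simps real_of_chain_boundary)
  note boundary = this
  show ?thesis
    by (rule that[OF B c keys_int_independent[OF B _ assms(1)[unfolded c]]
          keys_int_independent[OF B _ assms(2)[unfolded boundary]]])
qed

section \<open>Relative real homology\<close>

text \<open>\<open>p - 1\<close> is truncated subtraction: for \<open>p = 0\<close> the boundary is
  0 by definition, so every 0-chain counts as a relative cycle.\<close>

definition rel_real_cycles :: "nat \<Rightarrow> 'a topology \<Rightarrow> 'a set \<Rightarrow> 'a real_chain set" where
  "rel_real_cycles p X A =
     {c \<in> real_chains p X. real_boundary p c \<in> real_chains (p - 1) (subtopology X A)}"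

text \<open>Chains of \<open>A\<close> are added to the boundaries, so relative classes are cosets
  of chains of \<open>X\<close> and no quotient complex is formed.\<close>

definition rel_real_boundaries :: "nat \<Rightarrow> 'a topology \<Rightarrow> 'a set \<Rightarrow> 'a real_chain set" where
  "rel_real_boundaries p X A =
     {real_boundary (Suc p) d + a |d a.
        d \<in> real_chains (Suc p) X \<and> a \<in> real_chains p (subtopology X A)}"

lemmas real_chains_0 = subspace_0[OF subspace_real_chains]
  and real_chains_add = subspace_add[OF subspace_real_chains]
  and real_chains_diff = subspace_diff[OF subspace_real_chains]
  and real_chains_neg = subspace_neg[OF subspace_real_chains]
  and real_chains_scale = subspace_scale[OF subspace_real_chains]

lemmas real_chains_intros = real_chains_0 real_chains_add real_chains_diff real_chains_neg real_chains_scale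

lemma subspace_rel_real_cycles: "subspace (rel_real_cycles p X A)"
  unfolding subspace_def rel_real_cycles_def
  by (auto simp: real_boundary_simps intro!: real_chains_intros)

lemma rel_real_boundariesI:
  "d \<in> real_chains (Suc p) X \<Longrightarrow> a \<in> real_chains p (subtopology X A) \<Longrightarrow>
     real_boundary (Suc p) d + a \<in> rel_real_boundaries p X A"
  by (auto simp: rel_real_boundaries_def)

lemma subspace_rel_real_boundaries: "subspace (rel_real_boundaries p X A)"
proof (rule subspaceI)
  show "0 \<in> rel_real_boundaries p X A"
    using rel_real_boundariesI[OF real_chains_0 real_chains_0] by (simp add: real_boundary_simps)
  fix x y r
  assume "x \<in> rel_real_boundaries p X A"
  then obtain d a where x: "x = real_boundary (Suc p) d + a" "d \<in> real_chains (Suc p) X"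
    "a \<in> real_chains p (subtopology X A)" by (auto simp: rel_real_boundaries_def)
  have "r *\<^sub>R x = real_boundary (Suc p) (r *\<^sub>R d) + r *\<^sub>R a"
    by (simp add: x real_boundary_simps scaleR_add_right)
  then show "r *\<^sub>R x \<in> rel_real_boundaries p X A"
    using x by (auto intro!: rel_real_boundariesI real_chains_intros)
  assume "y \<in> rel_real_boundaries p X A"
  then obtain e b where y: "y = real_boundary (Suc p) e + b" "e \<in> real_chains (Suc p) X"
    "b \<in> real_chains p (subtopology X A)" by (auto simp: rel_real_boundaries_def)
  have "x + y = real_boundary (Suc p) (d + e) + (a + b)"
    by (simp add: x y linear_add[OF linear_real_boundary])
  then show "x + y \<in> rel_real_boundaries p X A"
    by (simp only:) (intro rel_real_boundariesI real_chains_intros x y)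
qed

lemmas rel_real_cycles_intros = subspace_0[OF subspace_rel_real_cycles]
  subspace_add[OF subspace_rel_real_cycles] subspace_diff[OF subspace_rel_real_cycles]
  subspace_scale[OF subspace_rel_real_cycles] subspace_neg[OF subspace_rel_real_cycles]

lemmas rel_real_boundaries_intros = subspace_0[OF subspace_rel_real_boundaries]
  subspace_add[OF subspace_rel_real_boundaries] subspace_diff[OF subspace_rel_real_boundaries]
  subspace_scale[OF subspace_rel_real_boundaries] subspace_neg[OF subspace_rel_real_boundaries]

lemma real_chain_in_rel_real_boundaries:
  "a \<in> real_chains p (subtopology X A) \<Longrightarrow> a \<in> rel_real_boundaries p X A"
  using rel_real_boundariesI[OF real_chains_0] by (metis add_0 linear_0 linear_real_boundary)

lemma real_boundary_in_rel_real_boundaries: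
  "d \<in> real_chains (Suc p) X \<Longrightarrow> real_boundary (Suc p) d \<in> rel_real_boundaries p X A"
  using rel_real_boundariesI[OF _ real_chains_0] by (metis add_0_right)

lemma real_cycles_eq_rel: "real_cycles p X = rel_real_cycles p X {}"
  by (auto simp: real_cycles_def rel_real_cycles_def)

lemma real_boundaries_eq_rel: "real_boundaries p X = rel_real_boundaries p X {}"
  by (auto simp: real_boundaries_def rel_real_boundaries_def)

lemma real_of_chain_rel_real_boundaries:
  "singular_relboundary p X A c \<Longrightarrow> real_of_chain c \<in> rel_real_boundaries p X A"
proof -
  assume "singular_relboundary p X A c"
  then obtain d e where d: "singular_chain (Suc p) X d" "singular_chain p (subtopology X A) e"
    "chain_boundary (Suc p) d = c + e" by (auto simp: singular_relboundary_alt)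
  then have "real_of_chain c = real_boundary (Suc p) (real_of_chain d) + (- real_of_chain e)"
    by (simp flip: real_of_chain_boundary)
  then show ?thesis
    by (simp only:) (intro rel_real_boundariesI real_chains_neg,
        simp_all add: real_of_chain_in_real_chains d)
qed

text \<open>With the singular simplices of \<open>X\<close> and of \<open>A\<close> as the two
  supports, every integral component is itself a relative cycle, and theorems on integral relative
  cycles apply to it.\<close>

lemma rel_real_cycles_integral_decomposition:
  assumes "c \<in> rel_real_cycles p X A"
  obtains B :: "real set" and w C where "finite B"
    "c = (\<Sum>b\<in>B. w b *\<^sub>R real_of_chain (C b))" "\<And>b. b \<in> B \<Longrightarrow> singular_relcycle p X A (C b)"
proof -
  obtain B :: "real set" and w C where B: "int_independent B w"
    "c = (\<Sum>b\<in>B. w b *\<^sub>R real_of_chain (C b))"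
    "\<And>b. b \<in> B \<Longrightarrow> singular_chain p X (C b)"
    "\<And>b. b \<in> B \<Longrightarrow> singular_chain (p - 1) (subtopology X A) (chain_boundary p (C b))"
    using real_chain_integral_decomposition_boundary[of c "Collect (singular_simplex p X)" p
        "Collect (singular_simplex (p - 1) (subtopology X A))"] assms
    by (auto simp: rel_real_cycles_def real_chains_def singular_chain_def)
  then show ?thesis
    by (intro that) (auto simp: int_independent_def singular_relcycle)
qed

lemma rel_real_boundaries_sum:
  "(\<And>b. b \<in> B \<Longrightarrow> C b \<in> rel_real_boundaries p X A) \<Longrightarrow> (\<Sum>b\<in>B. w b *\<^sub>R C b) \<in> rel_real_boundaries p X A"
  by (intro subspace_sum[OF subspace_rel_real_boundaries] rel_real_boundaries_intros) auto

lemma rel_real_boundaries_if_integral: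
  assumes "\<And>c. singular_relcycle p X A c \<Longrightarrow> singular_relboundary p X A c"
  shows "rel_real_cycles p X A \<subseteq> rel_real_boundaries p X A"
proof
  fix c assume c: "c \<in> rel_real_cycles p X A"
  obtain B :: "real set" and w C where "finite B"
    "c = (\<Sum>b\<in>B. w b *\<^sub>R real_of_chain (C b))" "\<And>b. b \<in> B \<Longrightarrow> singular_relcycle p X A (C b)"
    using rel_real_cycles_integral_decomposition[OF c] by blast
  then show "c \<in> rel_real_boundaries p X A"
    using assms by (simp only:) (intro rel_real_boundaries_sum real_of_chain_rel_real_boundaries, blast)
qed

text \<open>Each integral component is moved by the integral theorem; the weights only recombine the
  differences.\<close>

lemma homotopic_imp_homologous_real_chain_maps:
  assumes hom: "homotopic_with (\<lambda>h. h \<in> A \<rightarrow> B) X Y f g" and "c \<in> rel_real_cycles p X A"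
  shows "real_chain_map p f c - real_chain_map p g c \<in> rel_real_boundaries p Y B"
proof -
  obtain K :: "real set" and w C where "finite K" and c:
    "c = (\<Sum>b\<in>K. w b *\<^sub>R real_of_chain (C b))" "\<And>b. b \<in> K \<Longrightarrow> singular_relcycle p X A (C b)"
    using rel_real_cycles_integral_decomposition[OF assms(2)] by blast
  have "real_chain_map p f c - real_chain_map p g c =
      (\<Sum>b\<in>K. w b *\<^sub>R real_of_chain (chain_map p f (C b) - chain_map p g (C b)))"
    by (simp add: c(1) real_chain_map_simps real_of_chain_map sum_subtractf scaleR_diff_right)
  also have "\<dots> \<in> rel_real_boundaries p Y B"
    using homotopic_imp_homologous_rel_chain_maps[OF hom c(2)]
    by (intro rel_real_boundaries_sum real_of_chain_rel_real_boundaries) (simp add: homologous_rel_def)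
  finally show ?thesis .
qed

lemma rel_real_cycles_chain_map:
  assumes "c \<in> rel_real_cycles p X A" "continuous_map X Y f" "f \<in> topspace X \<inter> A \<rightarrow> B"
  shows "real_chain_map p f c \<in> rel_real_cycles p Y B"
proof -
  have "continuous_map (subtopology X A) (subtopology Y B) f"
    using assms by (auto simp: continuous_map_in_subtopology continuous_map_from_subtopology)
  then show ?thesis
    using assms real_boundary_chain_map[of c p X f] real_chain_map_in_real_chains
    unfolding rel_real_cycles_def by fastforce
qed

lemma rel_real_boundaries_chain_map:
  assumes "c \<in> rel_real_boundaries p X A" "continuous_map X Y f" "f \<in> topspace X \<inter> A \<rightarrow> B"
  shows "real_chain_map p f c \<in> rel_real_boundaries p Y B"
proof -
  have f: "continuous_map (subtopology X A) (subtopology Y B) f"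
    using assms by (auto simp: continuous_map_in_subtopology continuous_map_from_subtopology)
  obtain d a where "c = real_boundary (Suc p) d + a" and d: "d \<in> real_chains (Suc p) X"
    and a: "a \<in> real_chains p (subtopology X A)" using assms by (auto simp: rel_real_boundaries_def)
  then have "real_chain_map p f c = real_boundary (Suc p) (real_chain_map (Suc p) f d) + real_chain_map p f a"
    using real_boundary_chain_map[OF d, of f] by (simp add: real_chain_map_simps)
  then show ?thesis
    using real_chain_map_in_real_chains[OF d assms(2)] real_chain_map_in_real_chains[OF a f]
    by (auto intro: rel_real_boundariesI)
qed

section \<open>Excision for open covers\<close>

text \<open>Excision removes the complement of \<open>N\<close>. Since \<open>N\<close> and
  \<open>U\<close> are open and cover, this complement is closed and lies in the open set
  \<open>U\<close>, which is the closure condition that excision asks for.\<close>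

lemma integral_excision:
  assumes N: "openin X N" and U: "openin X U" and "N \<union> U = topspace X"
  shows integral_excision_cycle: "singular_relcycle p X U c \<Longrightarrow>
      \<exists>c'. singular_relcycle p (subtopology X N) (N \<inter> U) c' \<and> homologous_rel p X U c c'"
    and integral_excision_boundary: "singular_relcycle p (subtopology X N) (N \<inter> U) c \<Longrightarrow>
      singular_relboundary p X U c \<Longrightarrow> singular_relboundary p (subtopology X N) (N \<inter> U) c"
proof -
  let ?K = "topspace X - N"
  have sub: "N \<subseteq> topspace X" "U \<subseteq> topspace X"
    using N U openin_subset by blast+
  have "closedin X ?K" using N by blast
  then have cl: "X closure_of ?K \<subseteq> X interior_of U"
    using U assms(3) sub by (auto simp: closure_of_closedin interior_of_openin)
  have eq: "topspace X - ?K = N" "U - ?K = N \<inter> U" "subtopology X (topspace X) = X"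
    using sub by auto
  show "\<exists>c'. singular_relcycle p (subtopology X N) (N \<inter> U) c' \<and> homologous_rel p X U c c'"
    if "singular_relcycle p X U c"
    using excised_relcycle_exists[OF cl sub(2), of p c] that unfolding eq by blast
  assume c: "singular_relcycle p (subtopology X N) (N \<inter> U) c" and bd: "singular_relboundary p X U c"
  let ?h = "hom_induced p (subtopology X N) (N \<inter> U) X U id"
  let ?H = "homologous_rel_set p (subtopology X N) (N \<inter> U)"
  \<comment> \<open>The excision axiom speaks of classes. A chain bounding modulo \<open>U\<close>
    has the same image as 0, and injectivity brings this back to \<open>N\<close>.\<close>
  have inj: "inj_on ?h (carrier (relative_homology_group p (subtopology X N) (N \<inter> U)))"
    using homology_excision_axiom[OF cl sub(2), of p] unfolding eq by (auto simp: iso_def bij_betw_def)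
  have cont: "continuous_map (subtopology X N) X id"
    by (simp add: continuous_map_from_subtopology)
  have cm: "chain_map p id c = c"
    using c chain_map_ident[of p "subtopology X N" c] by (auto simp: singular_relcycle)
  have "?h (?H c) = homologous_rel_set p X U c"
    using hom_induced_chain_map[OF cont _ c, of U] cm by auto
  moreover have "?h (?H 0) = homologous_rel_set p X U 0"
    using hom_induced_chain_map[OF cont, of "N \<inter> U" U p 0] by auto
  moreover have "homologous_rel_set p X U c = homologous_rel_set p X U 0"
    using bd by (metis homologous_rel_set_eq homologous_rel_def diff_zero)
  ultimately have "?H c = ?H 0"
    using inj_onD[OF inj, of "?H c" "?H 0"] c by (simp add: carrier_relative_homology_group)
  then show "singular_relboundary p (subtopology X N) (N \<inter> U) c"
    by (metis homologous_rel_set_eq homologous_rel_def diff_zero)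
qed

lemma keys_diff_supported:
  "\<exists>a b. c = a + b \<and> Poly_Mapping.keys a \<subseteq> K \<and> Poly_Mapping.keys b \<subseteq> L"
  if "Poly_Mapping.keys c \<subseteq> K \<union> L" for c :: "'b \<Rightarrow>\<^sub>0 int"
proof -
  let ?a = "frag_extend (\<lambda>s. if s \<in> K then frag_of s else 0) c"
  let ?b = "frag_extend (\<lambda>s. if s \<in> K then 0 else frag_of s) c"
  have "c = frag_extend frag_of c" by (rule frag_expansion)
  also have "\<dots> = ?a + ?b"
    unfolding frag_extend_def sum.distrib[symmetric]
    by (rule sum.cong) auto
  finally have "c = ?a + ?b" .
  moreover have "Poly_Mapping.keys ?a \<subseteq> K" "Poly_Mapping.keys ?b \<subseteq> L"
    using that keys_frag_extend[of _ c] by (fastforce split: if_splits)+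
  ultimately show ?thesis by blast
qed

lemma real_excision_cycle:
  assumes N: "openin X N" and U: "openin X U" and NU: "N \<union> U = topspace X"
    and "c \<in> rel_real_cycles p X U"
  shows "\<exists>c' \<in> rel_real_cycles p (subtopology X N) (N \<inter> U). c - c' \<in> rel_real_boundaries p X U"
proof -
  obtain B :: "real set" and w C where "finite B" and c:
    "c = (\<Sum>b\<in>B. w b *\<^sub>R real_of_chain (C b))" "\<And>b. b \<in> B \<Longrightarrow> singular_relcycle p X U (C b)"
    using rel_real_cycles_integral_decomposition[OF assms(4)] by blast
  have "\<exists>c'. singular_relcycle p (subtopology X N) (N \<inter> U) c' \<and> homologous_rel p X U (C b) c'"
    if "b \<in> B" for b
    using integral_excision_cycle[OF N U NU c(2)[OF that]] .
  then obtain D where D: "\<And>b. b \<in> B \<Longrightarrow> singular_relcycle p (subtopology X N) (N \<inter> U) (D b)"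
    "\<And>b. b \<in> B \<Longrightarrow> homologous_rel p X U (C b) (D b)" by metis
  let ?c' = "\<Sum>b\<in>B. w b *\<^sub>R real_of_chain (D b)"
  have "real_of_chain (D b) \<in> rel_real_cycles p (subtopology X N) (N \<inter> U)" if "b \<in> B" for b
    using D(1)[OF that]
    by (simp add: rel_real_cycles_def singular_relcycle real_of_chain_in_real_chains flip: real_of_chain_boundary)
  then have "?c' \<in> rel_real_cycles p (subtopology X N) (N \<inter> U)"
    by (auto intro!: subspace_sum[OF subspace_rel_real_cycles] rel_real_cycles_intros)
  moreover have "c - ?c' = (\<Sum>b\<in>B. w b *\<^sub>R real_of_chain (C b - D b))"
    by (simp add: c(1) sum_subtractf scaleR_diff_right)
  moreover have "\<dots> \<in> rel_real_boundaries p X U"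
    using D(2) by (intro rel_real_boundaries_sum real_of_chain_rel_real_boundaries) (simp add: homologous_rel_def)
  ultimately show ?thesis by metis
qed

text \<open>Decomposing \<open>c\<close> itself would lose the fact that it bounds. Instead the
  bounding chain \<open>e\<close> is decomposed, with the boundaries of its components kept among
  the simplices of \<open>N\<close> or of \<open>U\<close>; integral excision then treats the
  \<open>N\<close>-part of each such boundary.\<close>

lemma real_excision_boundary:
  assumes N: "openin X N" and U: "openin X U" and NU: "N \<union> U = topspace X"
    and c: "c \<in> rel_real_cycles p (subtopology X N) (N \<inter> U)" and bd: "c \<in> rel_real_boundaries p X U"
  shows "c \<in> rel_real_boundaries p (subtopology X N) (N \<inter> U)"
proof -
  obtain e a where e: "e \<in> real_chains (Suc p) X" and a: "a \<in> real_chains p (subtopology X U)"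
    and c_eq: "c = real_boundary (Suc p) e + a" using bd by (auto simp: rel_real_boundaries_def)
  let ?K = "{s. singular_simplex p (subtopology X N) s}"
  let ?L = "{s. singular_simplex p (subtopology X U) s}"
  have ck: "c \<in> real_chains p (subtopology X N)" using c by (simp add: rel_real_cycles_def)
  have "Poly_Mapping.keys (c - a) \<subseteq> ?K \<union> ?L"
    using keys_diff[of c a] ck a by (auto simp: real_chains_def)
  moreover have "c - a = real_boundary (Suc p) e" using c_eq by simp
  ultimately have ke: "Poly_Mapping.keys (real_boundary (Suc p) e) \<subseteq> ?K \<union> ?L" by simp
  have "Poly_Mapping.keys e \<subseteq> {s. singular_simplex (Suc p) X s}" using e by (simp add: real_chains_def)
  from real_chain_integral_decomposition_boundary[OF this ke] obtain B :: "real set" and w E where B: "int_independent B w"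
    and e_eq: "e = (\<Sum>b\<in>B. w b *\<^sub>R real_of_chain (E b))"
    and E: "\<And>b. b \<in> B \<Longrightarrow> Poly_Mapping.keys (E b) \<subseteq> {s. singular_simplex (Suc p) X s}"
    and dE: "\<And>b. b \<in> B \<Longrightarrow> Poly_Mapping.keys (chain_boundary (Suc p) (E b)) \<subseteq> ?K \<union> ?L"
    by blast
  have "\<exists>x y. chain_boundary (Suc p) (E b) = x + y \<and> Poly_Mapping.keys x \<subseteq> ?K \<and> Poly_Mapping.keys y \<subseteq> ?L"
    if "b \<in> B" for b by (rule keys_diff_supported[OF dE[OF that]])
  then obtain x y where xy: "\<And>b. b \<in> B \<Longrightarrow> chain_boundary (Suc p) (E b) = x b + y b"
    "\<And>b. b \<in> B \<Longrightarrow> singular_chain p (subtopology X N) (x b)"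
    "\<And>b. b \<in> B \<Longrightarrow> singular_chain p (subtopology X U) (y b)"
    unfolding singular_chain_def by metis
  have x_bd: "singular_relboundary p (subtopology X N) (N \<inter> U) (x b)" if b: "b \<in> B" for b
  proof (rule integral_excision_boundary[OF N U NU])
    have E': "singular_chain (Suc p) X (E b)" using E[OF b] by (simp add: singular_chain_def)
    \<comment> \<open>The two parts of a boundary have opposite boundaries, so that of
      \<open>x b\<close> is carried by \<open>N\<close> and by \<open>U\<close>, which makes
      \<open>x b\<close> a relative cycle.\<close>
    have "chain_boundary p (x b) = - chain_boundary p (y b)"
      using chain_boundary_boundary[OF E'] xy(1)[OF b]
      by (simp add: chain_boundary_add eq_neg_iff_add_eq_0)
    then have "singular_chain (p - 1) (subtopology X U) (chain_boundary p (x b))"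
      using singular_chain_boundary[OF xy(3)[OF b]] by (simp add: singular_chain_minus)
    then have "singular_chain (p - 1) (subtopology (subtopology X N) (N \<inter> U)) (chain_boundary p (x b))"
      using singular_chain_boundary[OF xy(2)[OF b]] by (auto simp: singular_chain_subtopology)
    then show "singular_relcycle p (subtopology X N) (N \<inter> U) (x b)"
      using xy(2)[OF b] by (simp add: singular_relcycle)
    show "singular_relboundary p X U (x b)"
      using E' xy[OF b] by (auto simp: singular_relboundary_alt)
  qed
  let ?x = "\<Sum>b\<in>B. w b *\<^sub>R real_of_chain (x b)" and ?y = "\<Sum>b\<in>B. w b *\<^sub>R real_of_chain (y b)"
  have x: "?x \<in> rel_real_boundaries p (subtopology X N) (N \<inter> U)"
    by (intro rel_real_boundaries_sum real_of_chain_rel_real_boundaries x_bd)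
  have "real_boundary (Suc p) e = ?x + ?y"
    by (simp add: e_eq real_boundary_simps xy(1) scaleR_add_right sum.distrib flip: real_of_chain_boundary)
  \<comment> \<open>The left side is carried by \<open>N\<close>, the right side by
    \<open>U\<close>, so the difference is a chain of the intersection.\<close>
  then have "c - ?x = ?y + a" using c_eq by simp
  moreover have "c - ?x \<in> real_chains p (subtopology X N)"
    by (intro real_chains_intros ck subspace_sum[OF subspace_real_chains])
      (auto simp: real_of_chain_in_real_chains xy(2))
  moreover have "?y + a \<in> real_chains p (subtopology X U)"
    by (intro real_chains_intros a subspace_sum[OF subspace_real_chains])
      (auto simp: real_of_chain_in_real_chains xy(3))
  ultimately have "c - ?x \<in> real_chains p (subtopology (subtopology X N) (N \<inter> U))"
    by (auto simp: real_chains_subtopology_iff)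
  from rel_real_boundaries_intros(2)[OF real_chain_in_rel_real_boundaries[OF this] x]
  show ?thesis by simp
qed

section \<open>Vanishing, one-dimensional and isomorphic homology of pairs\<close>

definition hom_trivial :: "nat \<Rightarrow> 'a topology \<Rightarrow> 'a set \<Rightarrow> bool" where
  "hom_trivial p X A \<longleftrightarrow> rel_real_cycles p X A \<subseteq> rel_real_boundaries p X A"

text \<open>\<open>hom_trivial\<close> and \<open>hom_line\<close> stand for relative homology of
  dimension 0 and 1. Stated on chains, they can be transported between pairs of spaces of different
  types.\<close>

definition hom_line :: "nat \<Rightarrow> 'a topology \<Rightarrow> 'a set \<Rightarrow> bool" where
  "hom_line p X A \<longleftrightarrow> (\<exists>g\<in>rel_real_cycles p X A. g \<notin> rel_real_boundaries p X A \<and>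
     (\<forall>c\<in>rel_real_cycles p X A. \<exists>r. c - r *\<^sub>R g \<in> rel_real_boundaries p X A))"

definition map_of_pairs :: "'a topology \<Rightarrow> 'a set \<Rightarrow> 'b topology \<Rightarrow> 'b set \<Rightarrow> ('a \<Rightarrow> 'b) \<Rightarrow> bool" where
  "map_of_pairs X A Y B f \<longleftrightarrow> continuous_map X Y f \<and> f \<in> topspace X \<inter> A \<rightarrow> B"

definition hom_inj :: "nat \<Rightarrow> 'a topology \<Rightarrow> 'a set \<Rightarrow> 'b topology \<Rightarrow> 'b set \<Rightarrow> ('a \<Rightarrow> 'b) \<Rightarrow> bool" where
  "hom_inj p X A Y B f \<longleftrightarrow> (\<forall>c\<in>rel_real_cycles p X A.
     real_chain_map p f c \<in> rel_real_boundaries p Y B \<longrightarrow> c \<in> rel_real_boundaries p X A)"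

definition hom_surj :: "nat \<Rightarrow> 'a topology \<Rightarrow> 'a set \<Rightarrow> 'b topology \<Rightarrow> 'b set \<Rightarrow> ('a \<Rightarrow> 'b) \<Rightarrow> bool" where
  "hom_surj p X A Y B f \<longleftrightarrow> (\<forall>d\<in>rel_real_cycles p Y B. \<exists>c\<in>rel_real_cycles p X A.
     d - real_chain_map p f c \<in> rel_real_boundaries p Y B)"

definition hom_iso :: "nat \<Rightarrow> 'a topology \<Rightarrow> 'a set \<Rightarrow> 'b topology \<Rightarrow> 'b set \<Rightarrow> ('a \<Rightarrow> 'b) \<Rightarrow> bool" where
  "hom_iso p X A Y B f \<longleftrightarrow> map_of_pairs X A Y B f \<and> hom_inj p X A Y B f \<and> hom_surj p X A Y B f"

lemma map_of_pairs_cycles: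
  "map_of_pairs X A Y B f \<Longrightarrow> c \<in> rel_real_cycles p X A \<Longrightarrow> real_chain_map p f c \<in> rel_real_cycles p Y B"
  unfolding map_of_pairs_def by (blast intro: rel_real_cycles_chain_map)

lemma map_of_pairs_boundaries:
  "map_of_pairs X A Y B f \<Longrightarrow> c \<in> rel_real_boundaries p X A \<Longrightarrow> real_chain_map p f c \<in> rel_real_boundaries p Y B"
  unfolding map_of_pairs_def by (blast intro: rel_real_boundaries_chain_map)

lemma map_of_pairs_compose:
  "map_of_pairs X A Y B f \<Longrightarrow> map_of_pairs Y B Z C g \<Longrightarrow> map_of_pairs X A Z C (g \<circ> f)"
  unfolding map_of_pairs_def using continuous_map_image_subset_topspace[of X Y f]
  by (auto simp: continuous_map_compose Pi_iff image_subset_iff)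

lemma rel_real_boundaries_cong_diff:
  "c - d \<in> rel_real_boundaries p X A \<Longrightarrow> d \<in> rel_real_boundaries p X A \<Longrightarrow> c \<in> rel_real_boundaries p X A"
  using rel_real_boundaries_intros(2)[of "c - d" p X A d] by simp

lemma rel_real_boundaries_cong_diff':
  "c - d \<in> rel_real_boundaries p X A \<Longrightarrow> c \<in> rel_real_boundaries p X A \<Longrightarrow> d \<in> rel_real_boundaries p X A"
  using rel_real_boundaries_intros(3)[of c p X A "c - d"] by simp

lemma rel_real_boundaries_diff_trans:
  "a - b \<in> rel_real_boundaries p X A \<Longrightarrow> b - c \<in> rel_real_boundaries p X A \<Longrightarrow> a - c \<in> rel_real_boundaries p X A"
  using rel_real_boundaries_intros(2)[of "a - b" p X A "b - c"] by simp

lemma hom_iso_compose: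
  assumes f: "hom_iso p X A Y B f" and g: "hom_iso p Y B Z C g"
  shows "hom_iso p X A Z C (g \<circ> f)"
  unfolding hom_iso_def
proof (intro conjI)
  have mf: "map_of_pairs X A Y B f" and mg: "map_of_pairs Y B Z C g" using f g by (auto simp: hom_iso_def)
  then show "map_of_pairs X A Z C (g \<circ> f)" by (rule map_of_pairs_compose)
  show "hom_inj p X A Z C (g \<circ> f)"
    using f g map_of_pairs_cycles[OF mf] unfolding hom_iso_def hom_inj_def
    by (auto simp: real_chain_map_compose)
  show "hom_surj p X A Z C (g \<circ> f)"
    unfolding hom_surj_def
  proof
    fix e assume "e \<in> rel_real_cycles p Z C"
    then obtain d where d: "d \<in> rel_real_cycles p Y B" "e - real_chain_map p g d \<in> rel_real_boundaries p Z C"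
      using g by (auto simp: hom_iso_def hom_surj_def)
    then obtain c where c: "c \<in> rel_real_cycles p X A" "d - real_chain_map p f c \<in> rel_real_boundaries p Y B"
      using f by (auto simp: hom_iso_def hom_surj_def)
    from map_of_pairs_boundaries[OF mg c(2)] d(2)
    have "e - real_chain_map p (g \<circ> f) c \<in> rel_real_boundaries p Z C"
      unfolding real_chain_map_compose by (auto simp: real_chain_map_simps intro: rel_real_boundaries_diff_trans)
    then show "\<exists>c\<in>rel_real_cycles p X A. e - real_chain_map p (g \<circ> f) c \<in> rel_real_boundaries p Z C"
      using c(1) by blast
  qed
qed

text \<open>Two out of three, with \<open>hom_iso_cancel_right\<close> as the other half: a map of
  pairs is recognised as an isomorphism without any homotopy inverse of its own.\<close>

lemma hom_iso_cancel_left: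
  assumes g: "hom_iso p Y B Z C g" and gf: "hom_iso p X A Z C (g \<circ> f)" and mf: "map_of_pairs X A Y B f"
  shows "hom_iso p X A Y B f"
  unfolding hom_iso_def
proof (intro conjI mf)
  have mg: "map_of_pairs Y B Z C g" using g by (auto simp: hom_iso_def)
  show "hom_inj p X A Y B f"
    using gf map_of_pairs_boundaries[OF mg] unfolding hom_iso_def hom_inj_def
    by (auto simp: real_chain_map_compose)
  show "hom_surj p X A Y B f"
    unfolding hom_surj_def
  proof
    fix d assume d: "d \<in> rel_real_cycles p Y B"
    obtain c where c: "c \<in> rel_real_cycles p X A"
      "real_chain_map p g d - real_chain_map p (g \<circ> f) c \<in> rel_real_boundaries p Z C"
      using gf map_of_pairs_cycles[OF mg d] by (auto simp: hom_iso_def hom_surj_def)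
    then have "real_chain_map p g (d - real_chain_map p f c) \<in> rel_real_boundaries p Z C"
      by (simp add: real_chain_map_compose real_chain_map_simps)
    then have "d - real_chain_map p f c \<in> rel_real_boundaries p Y B"
      using g rel_real_cycles_intros(3)[OF d map_of_pairs_cycles[OF mf c(1)]]
      by (auto simp: hom_iso_def hom_inj_def)
    then show "\<exists>c\<in>rel_real_cycles p X A. d - real_chain_map p f c \<in> rel_real_boundaries p Y B"
      using c(1) by blast
  qed
qed

lemma hom_iso_cancel_right:
  assumes f: "hom_iso p X A Y B f" and gf: "hom_iso p X A Z C (g \<circ> f)" and mg: "map_of_pairs Y B Z C g"
  shows "hom_iso p Y B Z C g"
  unfolding hom_iso_def
proof (intro conjI mg)
  have mf: "map_of_pairs X A Y B f" using f by (auto simp: hom_iso_def)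
  show "hom_surj p Y B Z C g"
    using gf map_of_pairs_cycles[OF mf] unfolding hom_iso_def hom_surj_def
    by (metis real_chain_map_compose)
  show "hom_inj p Y B Z C g"
    unfolding hom_inj_def
  proof (intro ballI impI)
    fix d assume d: "d \<in> rel_real_cycles p Y B" and gd: "real_chain_map p g d \<in> rel_real_boundaries p Z C"
    obtain c where c: "c \<in> rel_real_cycles p X A" "d - real_chain_map p f c \<in> rel_real_boundaries p Y B"
      using f d by (auto simp: hom_iso_def hom_surj_def)
    have "real_chain_map p g d - real_chain_map p (g \<circ> f) c \<in> rel_real_boundaries p Z C"
      using map_of_pairs_boundaries[OF mg c(2)] by (simp add: real_chain_map_compose real_chain_map_simps)
    from rel_real_boundaries_cong_diff'[OF this gd] have "c \<in> rel_real_boundaries p X A"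
      using gf c(1) by (auto simp: hom_iso_def hom_inj_def)
    from rel_real_boundaries_cong_diff[OF c(2) map_of_pairs_boundaries[OF mf this]]
    show "d \<in> rel_real_boundaries p Y B" .
  qed
qed

lemma hom_iso_homologous:
  assumes f: "hom_iso p X A Y B f" and mg: "map_of_pairs X A Y B g"
    and fg: "\<And>c. c \<in> rel_real_cycles p X A \<Longrightarrow>
      real_chain_map p f c - real_chain_map p g c \<in> rel_real_boundaries p Y B"
  shows "hom_iso p X A Y B g"
  unfolding hom_iso_def
proof (intro conjI mg)
  show "hom_inj p X A Y B g"
    using f fg rel_real_boundaries_cong_diff unfolding hom_iso_def hom_inj_def by blast
  show "hom_surj p X A Y B g"
    using f fg rel_real_boundaries_diff_trans unfolding hom_iso_def hom_surj_def by blast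
qed

lemma hom_iso_homotopic:
  assumes "hom_iso p X A Y B f" and "homotopic_with (\<lambda>h. h \<in> A \<rightarrow> B) X Y f g"
  shows "hom_iso p X A Y B g"
proof (rule hom_iso_homologous[OF assms(1)])
  show "map_of_pairs X A Y B g"
    using homotopic_with_imp_continuous_maps[OF assms(2)] homotopic_with_imp_property[OF assms(2)]
    by (auto simp: map_of_pairs_def)
qed (rule homotopic_imp_homologous_real_chain_maps[OF assms(2)])

lemma hom_iso_ident:
  assumes "map_of_pairs X A X A f" "\<And>x. x \<in> topspace X \<Longrightarrow> f x = x"
  shows "hom_iso p X A X A f"
proof -
  have "real_chain_map p f c = c" if "c \<in> rel_real_cycles p X A" for c
    by (rule real_chain_map_id) (use that assms in \<open>auto simp: rel_real_cycles_def\<close>)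
  then show ?thesis
    using assms(1) rel_real_boundaries_intros(1)[of p X A]
    unfolding hom_iso_def hom_inj_def hom_surj_def by force
qed

lemma hom_iso_id: "hom_iso p X A X A id"
  by (rule hom_iso_ident) (auto simp: map_of_pairs_def)

lemma hom_iso_cong:
  assumes "hom_iso p X A Y B f" "\<And>x. x \<in> topspace X \<Longrightarrow> f x = g x"
  shows "hom_iso p X A Y B g"
proof (rule hom_iso_homologous[OF assms(1)])
  show "map_of_pairs X A Y B g"
    using assms continuous_map_eq[of X Y f g] by (auto simp: hom_iso_def map_of_pairs_def Pi_iff)
  fix c assume "c \<in> rel_real_cycles p X A"
  then have "real_chain_map p f c = real_chain_map p g c"
    by (intro real_chain_map_eq_on[of c p X]) (use assms in \<open>auto simp: rel_real_cycles_def\<close>)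
  then show "real_chain_map p f c - real_chain_map p g c \<in> rel_real_boundaries p Y B"
    by (simp add: rel_real_boundaries_intros)
qed

text \<open>Both composites are isomorphisms, being homotopic to identities;
  \<open>g \<circ> f\<close> yields injectivity of \<open>f\<close> and \<open>f \<circ> g\<close>
  yields surjectivity.\<close>

lemma hom_iso_homotopy_equivalence:
  assumes mf: "map_of_pairs X A Y B f" and mg: "map_of_pairs Y B X A g"
    and gf: "homotopic_with (\<lambda>h. h \<in> A \<rightarrow> A) X X id (g \<circ> f)"
    and fg: "homotopic_with (\<lambda>h. h \<in> B \<rightarrow> B) Y Y id (f \<circ> g)"
  shows "hom_iso p X A Y B f"
  unfolding hom_iso_def
proof (intro conjI mf)
  have isogf: "hom_iso p X A X A (g \<circ> f)" by (rule hom_iso_homotopic[OF hom_iso_id gf])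
  have isofg: "hom_iso p Y B Y B (f \<circ> g)" by (rule hom_iso_homotopic[OF hom_iso_id fg])
  show "hom_inj p X A Y B f"
    using isogf map_of_pairs_boundaries[OF mg] unfolding hom_iso_def hom_inj_def
    by (auto simp: real_chain_map_compose)
  show "hom_surj p X A Y B f"
    using isofg map_of_pairs_cycles[OF mg] unfolding hom_iso_def hom_surj_def
    by (metis real_chain_map_compose)
qed

lemma hom_trivial_iso:
  assumes "hom_iso p X A Y B f"
  shows "hom_trivial p X A \<longleftrightarrow> hom_trivial p Y B"
proof
  have m: "map_of_pairs X A Y B f" using assms by (auto simp: hom_iso_def)
  show "hom_trivial p X A" if "hom_trivial p Y B"
    using that assms map_of_pairs_cycles[OF m] unfolding hom_trivial_def hom_iso_def hom_inj_def by blast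
  show "hom_trivial p Y B" if "hom_trivial p X A"
    using that assms map_of_pairs_boundaries[OF m] rel_real_boundaries_cong_diff
    unfolding hom_trivial_def hom_iso_def hom_surj_def by blast
qed

lemma hom_line_iso:
  assumes "hom_iso p X A Y B f"
  shows "hom_line p X A \<longleftrightarrow> hom_line p Y B"
proof
  have m: "map_of_pairs X A Y B f" and i: "hom_inj p X A Y B f" and s: "hom_surj p X A Y B f"
    using assms by (auto simp: hom_iso_def)
  show "hom_line p Y B" if l: "hom_line p X A"
  proof -
    obtain g where g: "g \<in> rel_real_cycles p X A" "g \<notin> rel_real_boundaries p X A"
      "\<And>c. c \<in> rel_real_cycles p X A \<Longrightarrow> \<exists>r. c - r *\<^sub>R g \<in> rel_real_boundaries p X A"
      using l unfolding hom_line_def by blast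
    show ?thesis
      unfolding hom_line_def
    proof (intro bexI[of _ "real_chain_map p f g"] conjI ballI)
      show "real_chain_map p f g \<notin> rel_real_boundaries p Y B" using g i by (auto simp: hom_inj_def)
      show "real_chain_map p f g \<in> rel_real_cycles p Y B" using map_of_pairs_cycles[OF m g(1)] .
      fix d assume "d \<in> rel_real_cycles p Y B"
      then obtain c where c: "c \<in> rel_real_cycles p X A" "d - real_chain_map p f c \<in> rel_real_boundaries p Y B"
        using s by (auto simp: hom_surj_def)
      then obtain r where "c - r *\<^sub>R g \<in> rel_real_boundaries p X A" using g by blast
      from rel_real_boundaries_diff_trans[OF c(2)] map_of_pairs_boundaries[OF m this]
      show "\<exists>r. d - r *\<^sub>R real_chain_map p f g \<in> rel_real_boundaries p Y B"
        by (auto simp: real_chain_map_simps)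
    qed
  qed
  show "hom_line p X A" if l: "hom_line p Y B"
  proof -
    obtain h where h: "h \<in> rel_real_cycles p Y B" "h \<notin> rel_real_boundaries p Y B"
      "\<And>c. c \<in> rel_real_cycles p Y B \<Longrightarrow> \<exists>r. c - r *\<^sub>R h \<in> rel_real_boundaries p Y B"
      using l unfolding hom_line_def by blast
    then obtain g where g: "g \<in> rel_real_cycles p X A" "h - real_chain_map p f g \<in> rel_real_boundaries p Y B"
      using s by (auto simp: hom_surj_def)
    show ?thesis
      unfolding hom_line_def
    proof (intro bexI[of _ g] conjI ballI g(1))
      show "g \<notin> rel_real_boundaries p X A"
        using h(2) rel_real_boundaries_cong_diff[OF g(2) map_of_pairs_boundaries[OF m]] by blast
      fix c assume c: "c \<in> rel_real_cycles p X A"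
      then obtain r where r: "real_chain_map p f c - r *\<^sub>R h \<in> rel_real_boundaries p Y B"
        using h(3) map_of_pairs_cycles[OF m] by blast
      have "r *\<^sub>R h - r *\<^sub>R real_chain_map p f g \<in> rel_real_boundaries p Y B"
        using rel_real_boundaries_intros(4)[OF g(2), of r] by (simp add: scaleR_diff_right)
      from rel_real_boundaries_diff_trans[OF r this]
      have "real_chain_map p f (c - r *\<^sub>R g) \<in> rel_real_boundaries p Y B"
        by (simp add: real_chain_map_simps)
      then show "\<exists>r. c - r *\<^sub>R g \<in> rel_real_boundaries p X A"
        using i c g(1) by (auto simp: hom_inj_def intro!: exI[of _ r] rel_real_cycles_intros)
    qed
  qed
qed

lemma hom_iso_excision:
  assumes N: "openin X N" and U: "openin X U" and NU: "N \<union> U = topspace X"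
  shows "hom_iso p (subtopology X N) (N \<inter> U) X U id"
proof -
  have id: "real_chain_map p id c = c" if "c \<in> rel_real_cycles p (subtopology X N) (N \<inter> U)" for c
    by (rule real_chain_map_id[of c p "subtopology X N"]) (use that in \<open>auto simp: rel_real_cycles_def\<close>)
  show ?thesis
    unfolding hom_iso_def
  proof (intro conjI)
    show "map_of_pairs (subtopology X N) (N \<inter> U) X U id"
      by (auto simp: map_of_pairs_def continuous_map_from_subtopology)
    show "hom_inj p (subtopology X N) (N \<inter> U) X U id"
      using real_excision_boundary[OF assms] by (auto simp: hom_inj_def id)
    show "hom_surj p (subtopology X N) (N \<inter> U) X U id"
      using real_excision_cycle[OF assms] id by (fastforce simp: hom_surj_def)
  qed
qed

text \<open>The homotopy respects \<open>A\<close>, so a relative cycle is homologous to its image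
  under \<open>r\<close>, and that image is a chain of \<open>A\<close>.\<close>

lemma hom_trivial_deformation:
  assumes "homotopic_with (\<lambda>h. h \<in> A \<rightarrow> A) X X id r" "r \<in> topspace X \<rightarrow> A"
  shows "hom_trivial p X A"
  unfolding hom_trivial_def
proof
  fix c assume c: "c \<in> rel_real_cycles p X A"
  then have cX: "c \<in> real_chains p X" by (auto simp: rel_real_cycles_def)
  have "continuous_map X (subtopology X A) r"
    using homotopic_with_imp_continuous_maps[OF assms(1)] assms(2) by (auto simp: continuous_map_in_subtopology)
  from real_chain_in_rel_real_boundaries[OF real_chain_map_in_real_chains[OF cX this]]
  have "real_chain_map p r c \<in> rel_real_boundaries p X A" .
  moreover have "real_chain_map p id c = c"
    by (rule real_chain_map_id[OF cX]) simp
  ultimately show "c \<in> rel_real_boundaries p X A"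
    using homotopic_imp_homologous_real_chain_maps[OF assms(1) c] rel_real_boundaries_cong_diff by metis
qed

lemma hom_trivial_self: "hom_trivial p X (topspace X)"
  by (rule hom_trivial_deformation[of _ _ id]) auto

subsection \<open>Exactness for triples\<close>

context
  fixes X :: "'a topology" and A B :: "'a set"
  assumes AB: "A \<subseteq> B"
begin

lemma subtopology_triple: "subtopology (subtopology X B) A = subtopology X A"
  using AB by (simp add: subtopology_subtopology inf.absorb2)

lemma rel_real_cycles_triple:
  "c \<in> rel_real_cycles p (subtopology X B) A \<longleftrightarrow>
     c \<in> real_chains p (subtopology X B) \<and> real_boundary p c \<in> real_chains (p - 1) (subtopology X A)"
  by (simp add: rel_real_cycles_def subtopology_triple)

lemma rel_real_cycles_triple_mono:
  "c \<in> rel_real_cycles p X A \<Longrightarrow> c \<in> rel_real_cycles p X B"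
  using real_chains_mono[of _ _ X A B] AB by (auto simp: rel_real_cycles_def)

lemma rel_real_boundaries_triple_mono:
  "c \<in> rel_real_boundaries p X A \<Longrightarrow> c \<in> rel_real_boundaries p X B"
  using real_chains_mono[of _ p X A B] AB unfolding rel_real_boundaries_def by blast

lemma real_boundary_cycle_triple:
  assumes "c \<in> rel_real_cycles (Suc p) X B"
  shows "real_boundary (Suc p) c \<in> rel_real_cycles p (subtopology X B) A"
  using assms real_boundary_boundary[of c "Suc p" X]
  by (auto simp: rel_real_cycles_triple rel_real_cycles_def[of _ X] real_chains_0)

lemma real_chain_map_id_cycle_triple:
  "c \<in> rel_real_cycles p (subtopology X B) A \<Longrightarrow> real_chain_map p id c = c"
  by (rule real_chain_map_id[of c p "subtopology X B"]) (auto simp: rel_real_cycles_def)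

lemma real_chain_map_id_cycle: "c \<in> rel_real_cycles p X A \<Longrightarrow> real_chain_map p id c = c"
  by (rule real_chain_map_id[of c p X]) (auto simp: rel_real_cycles_def)

lemma map_of_pairs_sub: "map_of_pairs (subtopology X B) A X A id"
  by (auto simp: map_of_pairs_def continuous_map_from_subtopology)

lemma map_of_pairs_quot: "map_of_pairs X A X B id"
  using AB by (auto simp: map_of_pairs_def)

text \<open>Exactness at \<open>H_p(X,A)\<close>: a cycle bounds modulo \<open>B\<close>, and the
  remaining chain in \<open>B\<close> has the same boundary, hence is a cycle of
  \<open>(B,A)\<close>.\<close>

lemma hom_surj_sub:
  assumes "hom_trivial p X B"
  shows "hom_surj p (subtopology X B) A X A id"
  unfolding hom_surj_def
proof
  fix c assume c: "c \<in> rel_real_cycles p X A"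
  then have "c \<in> rel_real_boundaries p X B"
    using assms rel_real_cycles_triple_mono by (auto simp: hom_trivial_def)
  then obtain d b where d: "d \<in> real_chains (Suc p) X" and b: "b \<in> real_chains p (subtopology X B)"
    and eq: "c = real_boundary (Suc p) d + b" by (auto simp: rel_real_boundaries_def)
  have "real_boundary p b = real_boundary p c"
    using real_boundary_boundary[OF d] by (simp add: eq real_boundary_simps)
  then have b': "b \<in> rel_real_cycles p (subtopology X B) A"
    using b c by (simp add: rel_real_cycles_triple) (simp add: rel_real_cycles_def)
  have "c - real_chain_map p id b \<in> rel_real_boundaries p X A"
    using real_boundary_in_rel_real_boundaries[OF d] by (simp add: real_chain_map_id_cycle_triple[OF b'] eq)
  then show "\<exists>b\<in>rel_real_cycles p (subtopology X B) A. c - real_chain_map p id b \<in> rel_real_boundaries p X A"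
    using b' by blast
qed

text \<open>Exactness at \<open>H_p(B,A)\<close>: a chain \<open>d\<close> filling a cycle of
  \<open>(B,A)\<close> is a relative cycle of \<open>(X,B)\<close> one degree higher, so it can be
  replaced by a chain in \<open>B\<close>.\<close>

lemma hom_inj_sub:
  assumes "hom_trivial (Suc p) X B"
  shows "hom_inj p (subtopology X B) A X A id"
  unfolding hom_inj_def
proof (intro ballI impI)
  fix c assume c: "c \<in> rel_real_cycles p (subtopology X B) A"
    and "real_chain_map p id c \<in> rel_real_boundaries p X A"
  then obtain d a where d: "d \<in> real_chains (Suc p) X" and a: "a \<in> real_chains p (subtopology X A)"
    and eq: "c = real_boundary (Suc p) d + a"
    unfolding real_chain_map_id_cycle_triple[OF c] by (auto simp: rel_real_boundaries_def)
  have "real_boundary (Suc p) d = c - a" using eq by simp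
  moreover have "c - a \<in> real_chains p (subtopology X B)"
    using c AB real_chains_mono[OF a, of B] by (intro real_chains_intros) (auto simp: rel_real_cycles_triple)
  ultimately have "d \<in> rel_real_cycles (Suc p) X B" using d by (simp add: rel_real_cycles_def)
  then obtain e b where e: "e \<in> real_chains (Suc (Suc p)) X" and b: "b \<in> real_chains (Suc p) (subtopology X B)"
    and eq': "d = real_boundary (Suc (Suc p)) e + b"
    using assms by (auto simp: hom_trivial_def rel_real_boundaries_def)
  have "c = real_boundary (Suc p) b + a"
    using real_boundary_boundary[OF e] by (simp add: eq eq' real_boundary_simps)
  then show "c \<in> rel_real_boundaries p (subtopology X B) A"
    using a b by (simp add: subtopology_triple rel_real_boundariesI)
qed

lemma hom_iso_sub:
  "hom_trivial p X B \<Longrightarrow> hom_trivial (Suc p) X B \<Longrightarrow> hom_iso p (subtopology X B) A X A id"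
  by (simp add: hom_iso_def map_of_pairs_sub hom_surj_sub hom_inj_sub)

text \<open>Exactness at \<open>H_p(X,B)\<close>: injectivity one degree lower forces the connecting
  map to vanish. The guard \<open>p = Suc q\<close> leaves degree 0, where there is no connecting
  map, unconditional.\<close>

lemma hom_surj_quot:
  assumes "\<And>q. p = Suc q \<Longrightarrow> hom_inj q (subtopology X B) A X A id"
  shows "hom_surj p X A X B id"
  unfolding hom_surj_def
proof
  fix c assume c: "c \<in> rel_real_cycles p X B"
  have "\<exists>b\<in>real_chains p (subtopology X B). c - b \<in> rel_real_cycles p X A"
  proof (cases p)
    case 0
    then show ?thesis
      using c by (intro bexI[of _ 0]) (auto simp: rel_real_cycles_def real_boundary_def real_chains_0)
  next
    case (Suc q)
    have dc: "real_boundary (Suc q) c \<in> rel_real_cycles q (subtopology X B) A"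
      using real_boundary_cycle_triple c Suc by blast
    have "real_boundary (Suc q) c \<in> rel_real_boundaries q X A"
      using c Suc by (intro real_boundary_in_rel_real_boundaries) (auto simp: rel_real_cycles_def)
    then have "real_boundary (Suc q) c \<in> rel_real_boundaries q (subtopology X B) A"
      using assms[OF Suc] dc real_chain_map_id_cycle_triple[OF dc] by (auto simp: hom_inj_def)
    then obtain b a where b: "b \<in> real_chains p (subtopology X B)" and a: "a \<in> real_chains q (subtopology X A)"
      and eq: "real_boundary p c = real_boundary p b + a"
      unfolding Suc by (auto simp: rel_real_boundaries_def subtopology_triple)
    have "c - b \<in> rel_real_cycles p X A"
      using c a real_chains_subtopology[OF b]
      by (auto simp: rel_real_cycles_def real_boundary_simps eq Suc[symmetric] real_chains_diff) (simp add: Suc)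
    then show ?thesis using b by blast
  qed
  then obtain b where b: "b \<in> real_chains p (subtopology X B)" "c - b \<in> rel_real_cycles p X A" by blast
  have "c - real_chain_map p id (c - b) \<in> rel_real_boundaries p X B"
    using real_chain_in_rel_real_boundaries[OF b(1)] by (simp add: real_chain_map_id_cycle[OF b(2)])
  then show "\<exists>b\<in>rel_real_cycles p X A. c - real_chain_map p id b \<in> rel_real_boundaries p X B"
    using b(2) by blast
qed

lemma hom_inj_quot:
  assumes "hom_trivial p (subtopology X B) A"
  shows "hom_inj p X A X B id"
  unfolding hom_inj_def
proof (intro ballI impI)
  fix c assume c: "c \<in> rel_real_cycles p X A" and "real_chain_map p id c \<in> rel_real_boundaries p X B"
  then obtain d b where d: "d \<in> real_chains (Suc p) X" and b: "b \<in> real_chains p (subtopology X B)"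
    and eq: "c = real_boundary (Suc p) d + b"
    unfolding real_chain_map_id_cycle[OF c] by (auto simp: rel_real_boundaries_def)
  have "real_boundary p b = real_boundary p c"
    using real_boundary_boundary[OF d] by (simp add: eq real_boundary_simps)
  then have "b \<in> rel_real_cycles p (subtopology X B) A"
    using b c by (simp add: rel_real_cycles_triple) (simp add: rel_real_cycles_def)
  then have bb: "b \<in> rel_real_boundaries p (subtopology X B) A" using assms by (auto simp: hom_trivial_def)
  have "b \<in> rel_real_boundaries p X A"
    using map_of_pairs_boundaries[OF map_of_pairs_sub bb]
      real_chain_map_id[of b p "subtopology X B" id] b by simp
  then show "c \<in> rel_real_boundaries p X A"
    unfolding eq by (intro rel_real_boundaries_intros real_boundary_in_rel_real_boundaries d)
qed

lemma hom_iso_quot: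
  assumes "hom_trivial p (subtopology X B) A" "\<And>q. p = Suc q \<Longrightarrow> hom_inj q (subtopology X B) A X A id"
  shows "hom_iso p X A X B id"
  using assms by (simp add: hom_iso_def map_of_pairs_quot hom_surj_quot hom_inj_quot)

text \<open>\<open>H_p(X,B)\<close> sits between \<open>H_p(X,A)\<close>, whose image dies because
  it comes from \<open>B\<close>, and \<open>H_q(B,A)\<close>, into which the connecting map is
  zero.\<close>

lemma hom_trivial_quot:
  assumes "hom_surj p (subtopology X B) A X A id" "\<And>q. p = Suc q \<Longrightarrow> hom_inj q (subtopology X B) A X A id"
  shows "hom_trivial p X B"
  unfolding hom_trivial_def
proof
  fix c assume "c \<in> rel_real_cycles p X B"
  then obtain c' where c': "c' \<in> rel_real_cycles p X A" "c - real_chain_map p id c' \<in> rel_real_boundaries p X B"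
    using hom_surj_quot[OF assms(2)] by (auto simp: hom_surj_def)
  then obtain b where b: "b \<in> rel_real_cycles p (subtopology X B) A"
    "c' - real_chain_map p id b \<in> rel_real_boundaries p X A" using assms(1) by (auto simp: hom_surj_def)
  have "b \<in> rel_real_boundaries p X B"
    using b by (intro real_chain_in_rel_real_boundaries) (auto simp: rel_real_cycles_def)
  moreover have "c - c' \<in> rel_real_boundaries p X B" "c' - b \<in> rel_real_boundaries p X B"
    using c'(2) rel_real_boundaries_triple_mono[OF b(2)]
    by (simp_all add: real_chain_map_id_cycle[OF c'(1)] real_chain_map_id_cycle_triple[OF b(1)])
  ultimately show "c \<in> rel_real_boundaries p X B"
    using rel_real_boundaries_cong_diff by blast
qed

lemma hom_trivial_triple:
  assumes "hom_trivial p X A" "\<And>q. p = Suc q \<Longrightarrow> hom_trivial q (subtopology X B) A"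
  shows "hom_trivial p X B"
proof (rule hom_trivial_quot)
  show "hom_surj p (subtopology X B) A X A id"
    using assms(1) by (auto simp: hom_surj_def hom_trivial_def real_chain_map_simps intro!: bexI[of _ 0]
        rel_real_cycles_intros)
  show "hom_inj q (subtopology X B) A X A id" if "p = Suc q" for q
    using assms(2)[OF that] by (auto simp: hom_inj_def hom_trivial_def)
qed

lemma hom_trivial_middle:
  assumes "hom_trivial p X B" "hom_trivial p (subtopology X B) A"
  shows "hom_trivial p X A"
  using assms hom_inj_quot map_of_pairs_cycles[OF map_of_pairs_quot]
  unfolding hom_trivial_def hom_inj_def by blast

lemma hom_trivial_sub:
  assumes "hom_trivial p X A" "hom_trivial (Suc p) X B"
  shows "hom_trivial p (subtopology X B) A"
  using assms hom_inj_sub map_of_pairs_cycles[OF map_of_pairs_sub]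
  unfolding hom_trivial_def hom_inj_def by blast

text \<open>Two neighbouring zeros in the exact sequence make the connecting map an isomorphism.
  Only the transport of a generator in both directions is carried out: by taking boundaries one way,
  by filling the other way.\<close>

lemma hom_line_connecting:
  assumes "hom_trivial p X A" "hom_trivial (Suc p) X A"
  shows "hom_line (Suc p) X B \<longleftrightarrow> hom_line p (subtopology X B) A"
proof
  assume "hom_line p (subtopology X B) A"
  then obtain g where g: "g \<in> rel_real_cycles p (subtopology X B) A" "g \<notin> rel_real_boundaries p (subtopology X B) A"
    "\<And>c. c \<in> rel_real_cycles p (subtopology X B) A \<Longrightarrow> \<exists>r. c - r *\<^sub>R g \<in> rel_real_boundaries p (subtopology X B) A"
    unfolding hom_line_def by blast
  have "g \<in> rel_real_boundaries p X A"
    using map_of_pairs_cycles[OF map_of_pairs_sub g(1)] assms(1)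
    by (auto simp: hom_trivial_def real_chain_map_id_cycle_triple[OF g(1)])
  \<comment> \<open>\<open>G\<close> fills the generator \<open>g\<close> up to chains of
    \<open>A\<close>; its class is the preimage of that of \<open>g\<close> under the connecting
    map.\<close>
  then obtain G a where G: "G \<in> real_chains (Suc p) X" and a: "a \<in> real_chains p (subtopology X A)"
    and geq: "g = real_boundary (Suc p) G + a" by (auto simp: rel_real_boundaries_def)
  have dG: "real_boundary (Suc p) G = g - a" using geq by simp
  have "g - a \<in> real_chains p (subtopology X B)"
    using g(1) AB real_chains_mono[OF a, of B] by (intro real_chains_intros) (auto simp: rel_real_cycles_triple)
  then have Gc: "G \<in> rel_real_cycles (Suc p) X B" using G dG by (simp add: rel_real_cycles_def)
  show "hom_line (Suc p) X B"
    unfolding hom_line_def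
  proof (intro bexI[OF _ Gc] conjI ballI notI)
    assume "G \<in> rel_real_boundaries (Suc p) X B"
    then obtain e b where e: "e \<in> real_chains (Suc (Suc p)) X" and b: "b \<in> real_chains (Suc p) (subtopology X B)"
      and eq: "G = real_boundary (Suc (Suc p)) e + b" by (auto simp: rel_real_boundaries_def)
    have "g = real_boundary (Suc p) b + a"
      using real_boundary_boundary[OF e] by (simp add: geq eq real_boundary_simps)
    then show False using g(2) a b by (simp add: subtopology_triple rel_real_boundariesI)
  next
    fix c assume c: "c \<in> rel_real_cycles (Suc p) X B"
    then obtain r where "real_boundary (Suc p) c - r *\<^sub>R g \<in> rel_real_boundaries p (subtopology X B) A"
      using g(3) real_boundary_cycle_triple by blast
    then obtain b a' where b: "b \<in> real_chains (Suc p) (subtopology X B)" and a': "a' \<in> real_chains p (subtopology X A)"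
      and eq: "real_boundary (Suc p) c - r *\<^sub>R g = real_boundary (Suc p) b + a'"
      by (auto simp: rel_real_boundaries_def subtopology_triple)
    have "real_boundary (Suc p) (c - r *\<^sub>R G - b) = a' + r *\<^sub>R a"
      using eq by (simp add: real_boundary_simps dG algebra_simps)
    \<comment> \<open>Correcting by \<open>b\<close> leaves a cycle relative to \<open>A\<close>,
      and these bound by the vanishing in degree \<open>Suc p\<close>.\<close>
    then have "c - r *\<^sub>R G - b \<in> rel_real_cycles (Suc p) X A"
      using c G a a' real_chains_subtopology[OF b]
      by (auto simp: rel_real_cycles_def intro!: real_chains_intros)
    then have "c - r *\<^sub>R G - b \<in> rel_real_boundaries (Suc p) X B"
      using assms(2) rel_real_boundaries_triple_mono by (auto simp: hom_trivial_def)
    then show "\<exists>r. c - r *\<^sub>R G \<in> rel_real_boundaries (Suc p) X B"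
      using rel_real_boundaries_cong_diff real_chain_in_rel_real_boundaries[OF b] by blast
  qed
next
  assume "hom_line (Suc p) X B"
  then obtain G where G: "G \<in> rel_real_cycles (Suc p) X B" "G \<notin> rel_real_boundaries (Suc p) X B"
    "\<And>c. c \<in> rel_real_cycles (Suc p) X B \<Longrightarrow> \<exists>r. c - r *\<^sub>R G \<in> rel_real_boundaries (Suc p) X B"
    unfolding hom_line_def by blast
  let ?g = "real_boundary (Suc p) G"
  have gc: "?g \<in> rel_real_cycles p (subtopology X B) A" by (rule real_boundary_cycle_triple[OF G(1)])
  show "hom_line p (subtopology X B) A"
    unfolding hom_line_def
  proof (intro bexI[OF _ gc] conjI ballI notI)
    assume "?g \<in> rel_real_boundaries p (subtopology X B) A"
    then obtain b a where b: "b \<in> real_chains (Suc p) (subtopology X B)" and a: "a \<in> real_chains p (subtopology X A)"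
      and eq: "?g = real_boundary (Suc p) b + a"
      by (auto simp: rel_real_boundaries_def subtopology_triple)
    have "G - b \<in> rel_real_cycles (Suc p) X A"
      using G(1) a real_chains_subtopology[OF b]
      by (auto simp: rel_real_cycles_def real_boundary_simps eq intro!: real_chains_intros)
    then have "G - b \<in> rel_real_boundaries (Suc p) X B"
      using assms(2) rel_real_boundaries_triple_mono by (auto simp: hom_trivial_def)
    then show False
      using G(2) rel_real_boundaries_cong_diff real_chain_in_rel_real_boundaries[OF b] by blast
  next
    fix c assume c: "c \<in> rel_real_cycles p (subtopology X B) A"
    then have "c \<in> rel_real_boundaries p X A"
      using map_of_pairs_cycles[OF map_of_pairs_sub c] assms(1)
      by (auto simp: hom_trivial_def real_chain_map_id_cycle_triple[OF c])
    then obtain d a where d: "d \<in> real_chains (Suc p) X" and a: "a \<in> real_chains p (subtopology X A)"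
      and ceq: "c = real_boundary (Suc p) d + a" by (auto simp: rel_real_boundaries_def)
    have dd: "real_boundary (Suc p) d = c - a" using ceq by simp
    have "c - a \<in> real_chains p (subtopology X B)"
      using c AB real_chains_mono[OF a, of B] by (intro real_chains_intros) (auto simp: rel_real_cycles_triple)
    then have "d \<in> rel_real_cycles (Suc p) X B" using d dd by (simp add: rel_real_cycles_def)
    then obtain r where "d - r *\<^sub>R G \<in> rel_real_boundaries (Suc p) X B" using G(3) by blast
    then obtain e b where e: "e \<in> real_chains (Suc (Suc p)) X" and b: "b \<in> real_chains (Suc p) (subtopology X B)"
      and eq: "d - r *\<^sub>R G = real_boundary (Suc (Suc p)) e + b" by (auto simp: rel_real_boundaries_def)
    have "real_boundary (Suc p) (d - r *\<^sub>R G) = real_boundary (Suc p) b"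
      using real_boundary_boundary[OF e] by (simp add: eq linear_add[OF linear_real_boundary])
    then have "c - r *\<^sub>R ?g = real_boundary (Suc p) b + a"
      using ceq by (simp add: real_boundary_simps algebra_simps)
    then have "c - r *\<^sub>R ?g \<in> rel_real_boundaries p (subtopology X B) A"
      using a b by (simp add: subtopology_triple rel_real_boundariesI)
    then show "\<exists>r. c - r *\<^sub>R ?g \<in> rel_real_boundaries p (subtopology X B) A" ..
  qed
qed

end

subsection \<open>Points and the augmentation\<close>

definition augmentation :: "('b \<Rightarrow>\<^sub>0 real) \<Rightarrow> real" where
  "augmentation = real_extend (\<lambda>s. 1)"

lemma augmentation_alt: "augmentation c = (\<Sum>s\<in>Poly_Mapping.keys c. Poly_Mapping.lookup c s)"
  by (simp add: augmentation_def real_extend_def)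

lemma linear_augmentation: "linear augmentation"
  by (simp add: augmentation_def linear_real_extend)

lemma augmentation_single [simp]: "augmentation (Poly_Mapping.single s r) = r"
  by (cases "r = 0") (simp_all add: augmentation_alt)

lemma augmentation_real_boundary: "augmentation (real_boundary (Suc 0) c) = 0"
proof -
  have "(augmentation \<circ> real_boundary (Suc 0)) c = (\<lambda>c. 0) c"
  proof (rule linear_eq_on_real_chain[where F = "augmentation \<circ> real_boundary (Suc 0)" and G = "\<lambda>c. 0"])
    show "(augmentation \<circ> real_boundary (Suc 0)) (Poly_Mapping.single s 1) = 0" for s
      by (simp add: real_boundary_eq linear_add[OF linear_augmentation])
  qed (auto intro: linear_compose linear_real_boundary linear_augmentation linear_zero)
  then show ?thesis by simp
qed

lemma augmentation_rel_real_boundaries: "c \<in> rel_real_boundaries 0 X {} \<Longrightarrow> augmentation c = 0"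
  by (auto simp: rel_real_boundaries_def augmentation_real_boundary)

lemma rel_real_cycles_0: "rel_real_cycles 0 X A = real_chains 0 X"
  by (auto simp: rel_real_cycles_def real_boundary_def real_chains_0)

text \<open>Singular simplices are extensional functions on the standard simplex, hence the
  restriction of the constant map.\<close>

definition point_simplex :: "'a \<Rightarrow> (nat \<Rightarrow> real) \<Rightarrow> 'a" where
  "point_simplex x = restrict (\<lambda>_. x) (standard_simplex 0)"

lemma real_chains_0_point:
  assumes "x \<in> topspace X" "c \<in> real_chains 0 (subtopology X {x})"
  shows "c = Poly_Mapping.single (point_simplex x) (augmentation c)"
proof -
  have "topspace (subtopology X {x}) = {x}" using assms by auto
  then have "Poly_Mapping.keys c \<subseteq> {point_simplex x}"
    using assms(2) singular_simplex_singleton[of "subtopology X {x}" x 0]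
    by (auto simp: real_chains_def point_simplex_def)
  then have "c = Poly_Mapping.single (point_simplex x) (Poly_Mapping.lookup c (point_simplex x))"
    by (intro poly_mapping_eqI) (auto simp: lookup_single when_def in_keys_iff)
  then show ?thesis by (metis augmentation_single)
qed

lemma point_simplex_chain:
  assumes "x \<in> topspace X" "x \<in> A"
  shows "Poly_Mapping.single (point_simplex x) r \<in> real_chains 0 (subtopology X A)"
  using singular_simplex_singleton[of "subtopology (subtopology X A) {x}" x 0 "point_simplex x"] assms
    singular_simplex_subtopology[of 0 "subtopology X A" "{x}"]
  by (auto simp: real_chains_def point_simplex_def)

lemma hom_trivial_point:
  assumes "topspace X = {x}" "p \<ge> 1"
  shows "hom_trivial p X {}"
  unfolding hom_trivial_def
  by (rule rel_real_boundaries_if_integral) (use singular_boundary_eq_cycle_singleton[OF assms] in blast)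

text \<open>In degree 0 the augmentation vanishes on boundaries and detects every multiple of the
  point; in positive degrees a point has no homology.\<close>

lemma hom_inj_point:
  assumes "x \<in> topspace X"
  shows "hom_inj p (subtopology X {x}) {} X {} id"
proof (cases "p = 0")
  case True
  have "c \<in> rel_real_boundaries 0 (subtopology X {x}) {}"
    if c: "c \<in> real_chains 0 (subtopology X {x})" and bd: "real_chain_map 0 id c \<in> rel_real_boundaries 0 X {}" for c
  proof -
    have "real_chain_map 0 id c = c" by (rule real_chain_map_id[OF c]) simp
    then have "augmentation c = 0" using augmentation_rel_real_boundaries bd by metis
    then have "c = 0" using real_chains_0_point[OF assms c] by simp
    then show ?thesis by (simp add: rel_real_boundaries_intros)
  qed
  then show ?thesis by (simp add: hom_inj_def rel_real_cycles_0 True)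
next
  case False
  then have "hom_trivial p (subtopology X {x}) {}"
    using assms by (intro hom_trivial_point[of _ x]) auto
  then show ?thesis by (auto simp: hom_inj_def hom_trivial_def)
qed

text \<open>The critical case is degree 1, where surjectivity rests on the injectivity of the
  point's class in degree 0.\<close>

lemma hom_iso_rel_point:
  assumes "x \<in> topspace X" "p \<ge> 1"
  shows "hom_iso p X {} X {x} id"
  using assms by (intro hom_iso_quot hom_inj_point hom_trivial_point[of _ x]) auto

text \<open>\<open>hom_trivial 0 X {x}\<close> plays the role of path-connectedness: a 0-chain is
  homologous to a multiple of the point simplex at \<open>x\<close>, and the augmentation is that
  multiple.\<close>

lemma hom_trivial_0_rel_point:
  assumes "hom_trivial 0 X {x}" "x \<in> topspace X" "c \<in> real_chains 0 X" "augmentation c = 0"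
  shows "c \<in> rel_real_boundaries 0 X {}"
proof -
  have "c \<in> rel_real_boundaries 0 X {x}"
    using assms by (auto simp: hom_trivial_def rel_real_cycles_0)
  then obtain d a where d: "d \<in> real_chains (Suc 0) X" and a: "a \<in> real_chains 0 (subtopology X {x})"
    and eq: "c = real_boundary (Suc 0) d + a" by (auto simp: rel_real_boundaries_def)
  have "augmentation a = 0"
    using assms(4) by (simp add: eq linear_add[OF linear_augmentation] augmentation_real_boundary)
  then have "a = 0" using real_chains_0_point[OF assms(2) a] by simp
  then show ?thesis using d by (simp add: eq real_boundary_in_rel_real_boundaries)
qed

lemma augmentation_real_chain_map: "augmentation (real_chain_map p f c) = augmentation c"
proof -
  have "(augmentation \<circ> real_chain_map p f) c = augmentation c"
    by (rule linear_eq_on_real_chain[where F = "augmentation \<circ> real_chain_map p f",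
          OF linear_compose[OF linear_real_chain_map linear_augmentation] linear_augmentation]) simp
  then show ?thesis by simp
qed

lemma hom_iso_0_connected:
  assumes "continuous_map X Y f" "x \<in> topspace X" "hom_trivial 0 X {x}" "hom_trivial 0 Y {f x}"
  shows "hom_iso 0 X {} Y {} f"
  unfolding hom_iso_def
proof (intro conjI)
  have fx: "f x \<in> topspace Y" using assms(1,2) by (auto simp: continuous_map_def)
  show "map_of_pairs X {} Y {} f" using assms by (auto simp: map_of_pairs_def)
  show "hom_inj 0 X {} Y {} f"
    unfolding hom_inj_def rel_real_cycles_0
    using augmentation_rel_real_boundaries hom_trivial_0_rel_point[OF assms(3,2)]
    by (metis augmentation_real_chain_map)
  show "hom_surj 0 X {} Y {} f"
    unfolding hom_surj_def rel_real_cycles_0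
  proof
    fix d assume d: "d \<in> real_chains 0 Y"
    let ?c = "Poly_Mapping.single (point_simplex x) (augmentation d)"
    have c: "?c \<in> real_chains 0 X" using point_simplex_chain[OF assms(2), of UNIV] by simp
    have "d - real_chain_map 0 f ?c \<in> rel_real_boundaries 0 Y {}"
      by (rule hom_trivial_0_rel_point[OF assms(4) fx])
        (auto simp: linear_diff[OF linear_augmentation] augmentation_real_chain_map
          intro!: real_chains_intros d real_chain_map_in_real_chains[OF c assms(1)])
    then show "\<exists>c\<in>real_chains 0 X. d - real_chain_map 0 f c \<in> rel_real_boundaries 0 Y {}"
      using c by blast
  qed
qed

lemma hom_line_0_connected:
  assumes "x \<in> topspace X" "hom_trivial 0 X {x}"
  shows "hom_line 0 X {}"
  unfolding hom_line_def rel_real_cycles_0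
proof (intro bexI[of _ "Poly_Mapping.single (point_simplex x) 1"] conjI ballI)
  show s: "Poly_Mapping.single (point_simplex x) 1 \<in> real_chains 0 X"
    using point_simplex_chain[OF assms(1), of UNIV] by simp
  show "Poly_Mapping.single (point_simplex x) 1 \<notin> rel_real_boundaries 0 X {}"
    using augmentation_rel_real_boundaries by fastforce
  fix c assume c: "c \<in> real_chains 0 X"
  have "c - augmentation c *\<^sub>R Poly_Mapping.single (point_simplex x) 1 \<in> rel_real_boundaries 0 X {}"
    by (rule hom_trivial_0_rel_point[OF assms(2,1)])
      (auto simp: linear_diff[OF linear_augmentation] linear_scale[OF linear_augmentation]
        intro!: real_chains_intros c s)
  then show "\<exists>r. c - r *\<^sub>R Poly_Mapping.single (point_simplex x) 1 \<in> rel_real_boundaries 0 X {}" ..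
qed

lemma not_hom_trivial_0:
  assumes "x \<in> topspace X"
  shows "\<not> hom_trivial 0 X {}"
proof
  assume "hom_trivial 0 X {}"
  moreover have "Poly_Mapping.single (point_simplex x) 1 \<in> real_chains 0 X"
    using point_simplex_chain[OF assms, of UNIV] by simp
  ultimately have "augmentation (Poly_Mapping.single (point_simplex x) (1::real)) = 0"
    by (intro augmentation_rel_real_boundaries[of _ X]) (auto simp: hom_trivial_def rel_real_cycles_0)
  then show False by simp
qed

text \<open>Moore approximations are defined by absolute homology, whereas the computations are
  relative to a base point. The two differ in degree 0 only, which connectedness settles.\<close>

lemma hom_iso_absolute:
  assumes f: "continuous_map X Y f" and x: "x \<in> topspace X"
    and "hom_iso p X {x} Y {f x} f" and "p = 0 \<Longrightarrow> hom_trivial 0 X {x}"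
  shows "hom_iso p X {} Y {} f"
proof (cases "p = 0")
  case True
  then show ?thesis using assms hom_iso_0_connected[OF f x] hom_trivial_iso[of 0 X "{x}" Y "{f x}" f] by simp
next
  case False
  have fx: "f x \<in> topspace Y" using assms(1,2) by (auto simp: continuous_map_def)
  have p: "p \<ge> 1" using False by simp
  have "hom_iso p X {} Y {f x} (f \<circ> id)"
    by (rule hom_iso_compose[OF hom_iso_rel_point[OF x p] assms(3)])
  then have "hom_iso p X {} Y {f x} (id \<circ> f)" by simp
  from hom_iso_cancel_left[OF hom_iso_rel_point[OF fx p] this]
  show ?thesis using f by (simp add: map_of_pairs_def)
qed

section \<open>Homology as a vector space\<close>

context
  fixes B :: "'v::real_vector set"
  assumes B: "subspace B"
begin

lemma coset_eq_iff: "(+) z ` B = (+) z' ` B \<longleftrightarrow> z - z' \<in> B"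
proof
  assume eq: "(+) z ` B = (+) z' ` B"
  have "z + 0 \<in> (+) z ` B" using subspace_0[OF B] by blast
  then obtain b where "b \<in> B" "z + 0 = z' + b" unfolding eq by blast
  then show "z - z' \<in> B" by (simp add: algebra_simps)
next
  assume "z - z' \<in> B"
  have *: "(+) x ` B \<subseteq> (+) y ` B" if "x - y \<in> B" for x y
  proof
    fix v assume "v \<in> (+) x ` B"
    then obtain b where "b \<in> B" "v = x + b" by blast
    then have "v = y + ((x - y) + b)" "(x - y) + b \<in> B"
      using subspace_add[OF B that] by auto
    then show "v \<in> (+) y ` B" by blast
  qed
  have "z' - z \<in> B" using subspace_neg[OF B \<open>z - z' \<in> B\<close>] by simp
  then show "(+) z ` B = (+) z' ` B" using * \<open>z - z' \<in> B\<close> by blast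
qed

lemma coset_add: "{s + t |s t. s \<in> (+) z ` B \<and> t \<in> (+) z' ` B} = (+) (z + z') ` B"
proof safe
  fix b c assume "b \<in> B" "c \<in> B"
  then have "z + b + (z' + c) = (z + z') + (b + c)" "b + c \<in> B" by (auto intro: subspace_add[OF B])
  then show "z + b + (z' + c) \<in> (+) (z + z') ` B" by blast
next
  fix b assume "b \<in> B"
  then have "z + z' + b = (z + 0) + (z' + b)" "0 \<in> B" using subspace_0[OF B] by (auto simp: algebra_simps)
  then show "\<exists>s t. z + z' + b = s + t \<and> s \<in> (+) z ` B \<and> t \<in> (+) z' ` B"
    using \<open>b \<in> B\<close> by blast
qed

lemma coset_scale: "{r *\<^sub>R s + b |s b. s \<in> (+) z ` B \<and> b \<in> B} = (+) (r *\<^sub>R z) ` B"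
proof safe
  fix b c assume "b \<in> B" "c \<in> B"
  then have "r *\<^sub>R (z + c) + b = r *\<^sub>R z + (r *\<^sub>R c + b)" "r *\<^sub>R c + b \<in> B"
    by (auto intro: subspace_add[OF B] subspace_scale[OF B] simp: algebra_simps)
  then show "r *\<^sub>R (z + c) + b \<in> (+) (r *\<^sub>R z) ` B" by blast
next
  fix b assume "b \<in> B"
  then have "r *\<^sub>R z + b = r *\<^sub>R (z + 0) + b" "0 \<in> B" using subspace_0[OF B] by auto
  then show "\<exists>s c. r *\<^sub>R z + b = r *\<^sub>R s + c \<and> s \<in> (+) z ` B \<and> c \<in> B"
    using \<open>b \<in> B\<close> by blast
qed

lemma quotient_space_linearly_isomorphic_zero_iff:
  assumes Z: "subspace Z"
  shows "linearly_isomorphic (quotient_space Z B) (vector_space_of {0::real}) \<longleftrightarrow> Z \<subseteq> B"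
proof
  assume "linearly_isomorphic (quotient_space Z B) (vector_space_of {0::real})"
  then obtain h where "bij_betw h ((\<lambda>z. (+) z ` B) ` Z) {0::real}"
    by (auto simp: linearly_isomorphic_def linear_iso_def quotient_space_def vector_space_of_def)
  then have h: "inj_on h ((\<lambda>z. (+) z ` B) ` Z)" "h ` (\<lambda>z. (+) z ` B) ` Z = {0}"
    by (auto simp: bij_betw_def)
  show "Z \<subseteq> B"
  proof
    fix z assume z: "z \<in> Z"
    have 0: "0 \<in> Z" using subspace_0[OF Z] .
    have "h ((+) z ` B) = 0" "h ((+) 0 ` B) = 0" using h(2) z 0 by blast+
    then have "(+) z ` B = (+) 0 ` B" using inj_onD[OF h(1)] z 0 by (metis image_eqI)
    then show "z \<in> B" by (subst (asm) coset_eq_iff) simp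
  qed
next
  assume "Z \<subseteq> B"
  then have "(+) z ` B = (+) 0 ` B" if "z \<in> Z" for z
    using that by (subst coset_eq_iff) auto
  then have "(\<lambda>z. (+) z ` B) ` Z = {(+) 0 ` B}"
    using subspace_0[OF Z] by blast
  then have "bij_betw (\<lambda>_. 0) ((\<lambda>z. (+) z ` B) ` Z) {0::real}"
    by (auto simp: bij_betw_def)
  then show "linearly_isomorphic (quotient_space Z B) (vector_space_of {0::real})"
    unfolding linearly_isomorphic_def linear_iso_def
    by (intro exI[of _ "\<lambda>_. 0"]) (simp add: quotient_space_def vector_space_of_def)
qed

text \<open>Since \<open>g\<close> lies outside \<open>B\<close>, the coefficient
  \<open>\<rho> z\<close> of \<open>g\<close> in \<open>z\<close> is unique. Uniqueness makes it
  linear in \<open>z\<close> and independent of the representative that \<open>h\<close> picks from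
  a coset.\<close>

lemma quotient_space_linearly_isomorphic_line:
  assumes Z: "subspace Z" and g: "g \<in> Z" "g \<notin> B" and gen: "\<And>z. z \<in> Z \<Longrightarrow> \<exists>r. z - r *\<^sub>R g \<in> B"
  shows "linearly_isomorphic (quotient_space Z B) (vector_space_of (UNIV :: real set))"
proof -
  let ?c = "\<lambda>z. (+) z ` B"
  have uniq: "r = r'" if "z - r *\<^sub>R g \<in> B" "z - r' *\<^sub>R g \<in> B" for z r r'
  proof (rule ccontr)
    assume "r \<noteq> r'"
    have "(r' - r) *\<^sub>R g \<in> B" using subspace_diff[OF B that] by (simp add: algebra_simps)
    from subspace_scale[OF B this, of "1 / (r' - r)"] \<open>r \<noteq> r'\<close> g(2) show False by simp
  qed
  obtain \<rho> where \<rho>: "\<And>z. z \<in> Z \<Longrightarrow> z - \<rho> z *\<^sub>R g \<in> B" using gen by metis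
  have \<rho>_eq: "\<rho> z = r" if "z \<in> Z" "z - r *\<^sub>R g \<in> B" for z r
    using uniq \<rho> that by blast
  define h where "h S = \<rho> (SOME z. z \<in> Z \<and> S = ?c z)" for S
  have h: "h (?c z) = \<rho> z" if "z \<in> Z" for z
  proof -
    let ?z = "SOME z'. z' \<in> Z \<and> ?c z = ?c z'"
    have z': "?z \<in> Z \<and> ?c z = ?c ?z" using that by (intro someI[where P = "\<lambda>z'. z' \<in> Z \<and> ?c z = ?c z'"]) blast
    then have "z - ?z \<in> B" by (subst (asm) coset_eq_iff) blast
    from subspace_add[OF B this, of "?z - \<rho> ?z *\<^sub>R g"] \<rho> z'
    have "z - \<rho> ?z *\<^sub>R g \<in> B" by simp
    then show ?thesis using \<rho>_eq that by (simp add: h_def)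
  qed
  have "linear_iso h (quotient_space Z B) (vector_space_of (UNIV :: real set))"
    unfolding linear_iso_def
  proof (intro conjI ballI allI)
    show "bij_betw h (carrier (quotient_space Z B)) (carrier (vector_space_of (UNIV::real set)))"
      unfolding bij_betw_def
    proof
      show "inj_on h (carrier (quotient_space Z B))"
      proof (rule inj_onI)
        fix S T assume "S \<in> carrier (quotient_space Z B)" "T \<in> carrier (quotient_space Z B)" "h S = h T"
        then obtain z w where zw: "z \<in> Z" "w \<in> Z" "S = ?c z" "T = ?c w" "\<rho> z = \<rho> w"
          by (auto simp: quotient_space_def h)
        have "z - w = (z - \<rho> z *\<^sub>R g) - (w - \<rho> w *\<^sub>R g)" using zw by simp
        then have "z - w \<in> B" using subspace_diff[OF B] \<rho> zw by metis
        then show "S = T" using zw coset_eq_iff by blast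
      qed
      have "r \<in> h ` ?c ` Z" for r
      proof -
        have "r *\<^sub>R g \<in> Z" using subspace_scale[OF Z g(1)] .
        moreover have "\<rho> (r *\<^sub>R g) = r" using \<rho>_eq[OF calculation, of r] subspace_0[OF B] by simp
        ultimately show ?thesis using h by (metis image_eqI)
      qed
      then show "h ` carrier (quotient_space Z B) = carrier (vector_space_of (UNIV::real set))"
        by (auto simp: quotient_space_def vector_space_of_def)
    qed
    fix S assume "S \<in> carrier (quotient_space Z B)"
    then obtain z where z: "z \<in> Z" "S = ?c z" by (auto simp: quotient_space_def)
    show "h (r \<odot>\<^bsub>quotient_space Z B\<^esub> S) = r \<odot>\<^bsub>vector_space_of (UNIV::real set)\<^esub> h S" for r
    proof -
      have "r *\<^sub>R z \<in> Z" using subspace_scale[OF Z z(1)] .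
      moreover have "r *\<^sub>R z - (r * \<rho> z) *\<^sub>R g \<in> B"
        using subspace_scale[OF B \<rho>[OF z(1)], of r] by (simp add: scaleR_diff_right)
      ultimately have "\<rho> (r *\<^sub>R z) = r * \<rho> z" by (rule \<rho>_eq)
      then show ?thesis
        using h[OF z(1)] h[OF \<open>r *\<^sub>R z \<in> Z\<close>]
        by (simp add: quotient_space_def vector_space_of_def z coset_scale)
    qed
    fix T assume "T \<in> carrier (quotient_space Z B)"
    then obtain w where w: "w \<in> Z" "T = ?c w" by (auto simp: quotient_space_def)
    have "z + w \<in> Z" using subspace_add[OF Z z(1) w(1)] .
    moreover have "z + w - (\<rho> z + \<rho> w) *\<^sub>R g \<in> B"
      using subspace_add[OF B \<rho>[OF z(1)] \<rho>[OF w(1)]] by (simp add: algebra_simps)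
    ultimately have "\<rho> (z + w) = \<rho> z + \<rho> w" by (rule \<rho>_eq)
    then show "h (S \<oplus>\<^bsub>quotient_space Z B\<^esub> T) = h S \<oplus>\<^bsub>vector_space_of (UNIV::real set)\<^esub> h T"
      using h[OF z(1)] h[OF w(1)] h[OF \<open>z + w \<in> Z\<close>]
      by (simp add: quotient_space_def vector_space_of_def z w coset_add)
  qed
  then show ?thesis unfolding linearly_isomorphic_def by blast
qed

end

text \<open>The map has the form of \<open>real_homology_induced\<close>. On a coset it is the coset
  of the image, so linearity is automatic and only bijectivity remains, which is injectivity and
  surjectivity modulo \<open>B\<close> and \<open>B'\<close>.\<close>

lemma linear_iso_quotient_space_iff:
  fixes f :: "'v::real_vector \<Rightarrow> 'w::real_vector"
  assumes Z: "subspace Z" and B: "subspace B" and B': "subspace B'"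
    and f: "linear f" "f ` Z \<subseteq> Z'" "f ` B \<subseteq> B'"
  shows "linear_iso (\<lambda>S. {f c + b |c b. c \<in> S \<and> b \<in> B'}) (quotient_space Z B) (quotient_space Z' B') \<longleftrightarrow>
     (\<forall>c\<in>Z. f c \<in> B' \<longrightarrow> c \<in> B) \<and> (\<forall>d\<in>Z'. \<exists>c\<in>Z. d - f c \<in> B')"
    (is "linear_iso ?h _ _ \<longleftrightarrow> ?inj \<and> ?surj")
proof -
  have h: "?h ((+) z ` B) = (+) (f z) ` B'" for z
  proof safe
    fix b c assume "b \<in> B" "c \<in> B'"
    then have "f (z + b) + c = f z + (f b + c)" "f b + c \<in> B'"
      using f by (auto simp: linear_add intro: subspace_add[OF B'])
    then show "f (z + b) + c \<in> (+) (f z) ` B'" by blast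
  next
    fix b assume "b \<in> B'"
    then have "f z + b = f (z + 0) + b" "0 \<in> B" using subspace_0[OF B] by auto
    then show "\<exists>c d. f z + b = f c + d \<and> c \<in> (+) z ` B \<and> d \<in> B'" using \<open>b \<in> B'\<close> by blast
  qed
  note ce = coset_eq_iff[OF B] coset_eq_iff[OF B']
  have "bij_betw ?h (carrier (quotient_space Z B)) (carrier (quotient_space Z' B')) \<longleftrightarrow> ?inj \<and> ?surj"
  proof
    assume "bij_betw ?h (carrier (quotient_space Z B)) (carrier (quotient_space Z' B'))"
    then have i: "inj_on ?h ((\<lambda>z. (+) z ` B) ` Z)" and s: "?h ` (\<lambda>z. (+) z ` B) ` Z = (\<lambda>z. (+) z ` B') ` Z'"
      by (auto simp: bij_betw_def quotient_space_def)
    have ?inj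
    proof (intro ballI impI)
      fix c assume c: "c \<in> Z" "f c \<in> B'"
      then have "?h ((+) c ` B) = ?h ((+) 0 ` B)" unfolding h ce by (simp add: linear_0[OF f(1)])
      then have "(+) c ` B = (+) 0 ` B"
        using inj_onD[OF i] c subspace_0[OF Z] by blast
      then show "c \<in> B" unfolding ce by simp
    qed
    moreover have ?surj
    proof
      fix d assume "d \<in> Z'"
      then have "(+) d ` B' \<in> ?h ` (\<lambda>z. (+) z ` B) ` Z" unfolding s by blast
      then obtain c where "c \<in> Z" "(+) d ` B' = ?h ((+) c ` B)" by blast
      then show "\<exists>c\<in>Z. d - f c \<in> B'" unfolding h ce by blast
    qed
    ultimately show "?inj \<and> ?surj" ..
  next
    assume a: "?inj \<and> ?surj"
    have "inj_on ?h ((\<lambda>z. (+) z ` B) ` Z)"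
    proof (rule inj_onI)
      fix S T assume "S \<in> (\<lambda>z. (+) z ` B) ` Z" "T \<in> (\<lambda>z. (+) z ` B) ` Z" and eq: "?h S = ?h T"
      then obtain z w where zw: "z \<in> Z" "w \<in> Z" "S = (+) z ` B" "T = (+) w ` B" by blast
      have "f (z - w) \<in> B'" using eq unfolding zw h ce by (simp add: linear_diff[OF f(1)])
      then have "z - w \<in> B" using a subspace_diff[OF Z zw(1,2)] by blast
      then show "S = T" unfolding zw ce .
    qed
    moreover have "?h ` (\<lambda>z. (+) z ` B) ` Z = (\<lambda>z. (+) z ` B') ` Z'"
    proof (intro equalityI subsetI)
      fix S assume "S \<in> ?h ` (\<lambda>z. (+) z ` B) ` Z"
      then show "S \<in> (\<lambda>z. (+) z ` B') ` Z'" unfolding image_image h using f(2) by blast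
    next
      fix S assume "S \<in> (\<lambda>z. (+) z ` B') ` Z'"
      then obtain d where d: "d \<in> Z'" "S = (+) d ` B'" by blast
      then obtain c where "c \<in> Z" "d - f c \<in> B'" using a by blast
      then show "S \<in> ?h ` (\<lambda>z. (+) z ` B) ` Z" unfolding image_image h d(2) using ce(2) by blast
    qed
    ultimately show "bij_betw ?h (carrier (quotient_space Z B)) (carrier (quotient_space Z' B'))"
      by (simp add: bij_betw_def quotient_space_def)
  qed
  moreover have "?h (x \<oplus>\<^bsub>quotient_space Z B\<^esub> y) = ?h x \<oplus>\<^bsub>quotient_space Z' B'\<^esub> ?h y"
    if xy: "x \<in> carrier (quotient_space Z B)" "y \<in> carrier (quotient_space Z B)" for x y
  proof -
    obtain z w where "x = (+) z ` B" "y = (+) w ` B" using xy by (auto simp: quotient_space_def)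
    then show ?thesis
      by (simp only: quotient_space_def ring.simps monoid.simps module.simps coset_add[OF B] coset_add[OF B'] h linear_add[OF f(1)])
  qed
  moreover have "?h (r \<odot>\<^bsub>quotient_space Z B\<^esub> x) = r \<odot>\<^bsub>quotient_space Z' B'\<^esub> ?h x"
    if x: "x \<in> carrier (quotient_space Z B)" for x r
  proof -
    obtain z where "x = (+) z ` B" using x by (auto simp: quotient_space_def)
    then show ?thesis
      by (simp only: quotient_space_def ring.simps monoid.simps module.simps coset_scale[OF B] coset_scale[OF B'] h linear_scale[OF f(1)])
  qed
  ultimately show ?thesis unfolding linear_iso_def by blast
qed

lemma real_homology_eq_rel:
  "real_homology p X = quotient_space (rel_real_cycles p X {}) (rel_real_boundaries p X {})"
  by (simp add: real_homology_def real_cycles_eq_rel real_boundaries_eq_rel)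

lemma real_homology_zero_iff:
  "linearly_isomorphic (real_homology p X) (vector_space_of {0::real}) \<longleftrightarrow> hom_trivial p X {}"
  unfolding real_homology_eq_rel hom_trivial_def
  by (rule quotient_space_linearly_isomorphic_zero_iff[OF subspace_rel_real_boundaries subspace_rel_real_cycles])

lemma real_homology_induced_iso_iff:
  assumes "continuous_map X Y f"
  shows "linear_iso (real_homology_induced p Y f) (real_homology p X) (real_homology p Y) \<longleftrightarrow> hom_iso p X {} Y {} f"
proof -
  have m: "map_of_pairs X {} Y {} f" using assms by (auto simp: map_of_pairs_def)
  have "real_homology_induced p Y f =
      (\<lambda>S. {real_chain_map p f c + b |c b. c \<in> S \<and> b \<in> rel_real_boundaries p Y {}})"
    by (rule ext) (simp add: real_homology_induced_def real_boundaries_eq_rel)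
  then show ?thesis
    unfolding real_homology_eq_rel
    using linear_iso_quotient_space_iff[OF subspace_rel_real_cycles[of p X "{}"] subspace_rel_real_boundaries[of p X "{}"]
        subspace_rel_real_boundaries[of p Y "{}"] linear_real_chain_map[of p f], of "rel_real_cycles p Y {}"] m
      map_of_pairs_cycles[OF m] map_of_pairs_boundaries[OF m]
    by (auto simp: hom_iso_def hom_inj_def hom_surj_def image_subset_iff)
qed

lemma reduced_real_cycles_eq:
  "reduced_real_cycles p X = {c \<in> rel_real_cycles p X {}. p = 0 \<longrightarrow> augmentation c = 0}"
  by (simp add: reduced_real_cycles_def real_cycles_eq_rel augmentation_alt)

lemma subspace_reduced_real_cycles: "subspace (reduced_real_cycles p X)"
  using subspace_rel_real_cycles[of p X "{}"] 
  unfolding reduced_real_cycles_eq subspace_def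
  by (auto simp: linear_0[OF linear_augmentation] linear_add[OF linear_augmentation] linear_scale[OF linear_augmentation])

text \<open>Reduced homology agrees with homology relative to a point: above degree 0 both are the
  absolute one, and in degree 0 the augmentation condition removes the class of the point.\<close>

lemma reduced_real_homology_zero:
  assumes "x \<in> topspace X" "hom_trivial p X {x}"
  shows "linearly_isomorphic (reduced_real_homology p X) (vector_space_of {0::real})"
proof -
  have "reduced_real_cycles p X \<subseteq> rel_real_boundaries p X {}"
  proof (cases "p = 0")
    case True
    then show ?thesis
      using hom_trivial_0_rel_point assms by (auto simp: reduced_real_cycles_eq rel_real_cycles_0)
  next
    case False
    then have "hom_trivial p X {}"
      using hom_trivial_iso[OF hom_iso_rel_point[OF assms(1), of p]] assms(2) by simp
    then show ?thesis by (auto simp: reduced_real_cycles_eq hom_trivial_def)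
  qed
  then show ?thesis
    by (simp add: reduced_real_homology_def real_boundaries_eq_rel
        quotient_space_linearly_isomorphic_zero_iff[OF subspace_rel_real_boundaries subspace_reduced_real_cycles])
qed

lemma reduced_real_homology_line:
  assumes "x \<in> topspace X" "hom_line p X {x}" "p \<ge> 1"
  shows "linearly_isomorphic (reduced_real_homology p X) (vector_space_of (UNIV :: real set))"
proof -
  have "hom_line p X {}"
    using hom_line_iso[OF hom_iso_rel_point[OF assms(1,3)]] assms(2) by simp
  then obtain g where "g \<in> rel_real_cycles p X {}" "g \<notin> rel_real_boundaries p X {}"
    "\<And>c. c \<in> rel_real_cycles p X {} \<Longrightarrow> \<exists>r. c - r *\<^sub>R g \<in> rel_real_boundaries p X {}"
    unfolding hom_line_def by blast
  from quotient_space_linearly_isomorphic_line[OF subspace_rel_real_boundaries subspace_rel_real_cycles this]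
  show ?thesis
    using assms(3) by (simp add: reduced_real_homology_def real_boundaries_eq_rel reduced_real_cycles_eq)
qed

section \<open>Local homology of Euclidean space\<close>

lemma homotopic_pairsI:
  fixes h :: "real \<times> 'a \<Rightarrow> 'b"
  assumes "continuous_map (prod_topology (top_of_set {0..1}) X) Y h"
    and "\<And>x. x \<in> topspace X \<Longrightarrow> h (0, x) = f x" "\<And>x. x \<in> topspace X \<Longrightarrow> h (1, x) = g x"
    and "A \<subseteq> topspace X" "\<And>t x. t \<in> {0..1} \<Longrightarrow> x \<in> A \<Longrightarrow> h (t, x) \<in> B"
  shows "homotopic_with (\<lambda>h. h \<in> A \<rightarrow> B) X Y f g"
proof -
  \<comment> \<open>\<open>homotopic_with\<close> prescribes the end maps at all points of the type,
    also outside the space, where \<open>h\<close> is arbitrary and has to be redefined.\<close>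
  let ?k = "\<lambda>(t::real, x). if x \<in> topspace X then h (t, x) else if t = 0 then f x else g x"
  have "continuous_map (prod_topology (top_of_set {0..1}) X) Y ?k"
    by (rule continuous_map_eq[OF assms(1)]) auto
  moreover have "(\<lambda>x. ?k (t, x)) \<in> A \<rightarrow> B" if "t \<in> {0..1}" for t
    using that assms(4,5) by auto
  moreover have "?k (0, x) = f x" "?k (1, x) = g x" for x
    using assms(2,3) by auto
  ultimately show ?thesis
    unfolding homotopic_with_def by blast
qed

lemma homotopic_pairs_top_of_setI:
  fixes h :: "real \<times> 'a::topological_space \<Rightarrow> 'b::topological_space"
  assumes "continuous_on ({0..1} \<times> S) h"
    and "\<And>t x. t \<in> {0..1} \<Longrightarrow> x \<in> S \<Longrightarrow> h (t, x) \<in> T"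
    and "\<And>x. x \<in> S \<Longrightarrow> h (0, x) = f x" "\<And>x. x \<in> S \<Longrightarrow> h (1, x) = g x"
    and "A \<subseteq> S" "\<And>t x. t \<in> {0..1} \<Longrightarrow> x \<in> A \<Longrightarrow> h (t, x) \<in> B"
  shows "homotopic_with (\<lambda>h. h \<in> A \<rightarrow> B) (top_of_set S) (top_of_set T) f g"
  by (rule homotopic_pairsI[of _ _ h])
    (use assms in \<open>auto simp: prod_topology_subtopology_eu continuous_map_subtopology_eu\<close>)

lemma hom_trivial_top_of_set:
  fixes h :: "real \<times> 'a::topological_space \<Rightarrow> 'a"
  assumes "continuous_on ({0..1} \<times> S) h"
    and "\<And>t x. t \<in> {0..1} \<Longrightarrow> x \<in> S \<Longrightarrow> h (t, x) \<in> S" "\<And>x. x \<in> S \<Longrightarrow> h (0, x) = x"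
    and "A \<subseteq> S" "\<And>t x. t \<in> {0..1} \<Longrightarrow> x \<in> A \<Longrightarrow> h (t, x) \<in> A" "\<And>x. x \<in> S \<Longrightarrow> h (1, x) \<in> A"
  shows "hom_trivial p (top_of_set S) A"
  by (rule hom_trivial_deformation[OF homotopic_pairs_top_of_setI[of S h, where g = "\<lambda>x. h (1, x)"]])
    (use assms in auto)

lemma hom_iso_top_of_set:
  fixes h :: "real \<times> 'a::topological_space \<Rightarrow> 'a" and f :: "'a \<Rightarrow> 'b::topological_space"
  assumes f: "continuous_on S f" "\<And>x. x \<in> S \<Longrightarrow> f x \<in> T" "\<And>x. x \<in> A \<Longrightarrow> f x \<in> B"
    and g: "continuous_on T g" "\<And>x. x \<in> T \<Longrightarrow> g x \<in> S" "\<And>x. x \<in> B \<Longrightarrow> g x \<in> A"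
    and AB: "A \<subseteq> S" "B \<subseteq> T" and fg: "\<And>y. y \<in> T \<Longrightarrow> f (g y) = y"
    and h: "continuous_on ({0..1} \<times> S) h"
      "\<And>t x. t \<in> {0..1} \<Longrightarrow> x \<in> S \<Longrightarrow> h (t, x) \<in> S" "\<And>x. x \<in> S \<Longrightarrow> h (0, x) = x"
      "\<And>x. x \<in> S \<Longrightarrow> h (1, x) = g (f x)" "\<And>t x. t \<in> {0..1} \<Longrightarrow> x \<in> A \<Longrightarrow> h (t, x) \<in> A"
  shows "hom_iso p (top_of_set S) A (top_of_set T) B f"
proof (rule hom_iso_homotopy_equivalence)
  show "map_of_pairs (top_of_set S) A (top_of_set T) B f"
    using f AB by (auto simp: map_of_pairs_def continuous_map_subtopology_eu)
  show "map_of_pairs (top_of_set T) B (top_of_set S) A g"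
    using g AB by (auto simp: map_of_pairs_def continuous_map_subtopology_eu)
  show "homotopic_with (\<lambda>h. h \<in> A \<rightarrow> A) (top_of_set S) (top_of_set S) id (g \<circ> f)"
    by (rule homotopic_pairs_top_of_setI[OF h(1)]) (use h AB in auto)
  have "continuous_on ({0..1::real} \<times> T) (\<lambda>x. snd x)" by (intro continuous_intros)
  then show "homotopic_with (\<lambda>h. h \<in> B \<rightarrow> B) (top_of_set T) (top_of_set T) id (f \<circ> g)"
    by (rule homotopic_pairs_top_of_setI) (use AB fg in auto)
qed

lemma hom_iso_excision_top_of_set:
  assumes "openin (top_of_set W) N" "openin (top_of_set W) U" "N \<union> U = W"
  shows "hom_iso p (top_of_set N) (N \<inter> U) (top_of_set W) U id"
proof -
  have "W \<inter> N = N" using assms(3) by blast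
  then have "subtopology (top_of_set W) N = top_of_set N"
    by (simp add: subtopology_subtopology)
  then show ?thesis using hom_iso_excision[OF assms(1,2)] assms(3) by auto
qed

lemma subtopology_top_of_set: "A \<subseteq> S \<Longrightarrow> subtopology (top_of_set S) A = top_of_set A"
  by (simp add: subtopology_subtopology inf.absorb2)

context
  fixes S :: "'a::euclidean_space set" and e :: 'a
  assumes S: "subspace S" and e: "e \<in> S" "norm e = 1"
begin

lemma inner_ee: "e \<bullet> e = 1"
  using e by (simp add: dot_square_norm)

lemma dim_orthogonal_hyperplane: "dim S = Suc (dim {x \<in> S. x \<bullet> e = 0})"
proof -
  let ?T = "{x \<in> S. x \<bullet> e = 0}"
  have T: "subspace ?T"
    using S by (auto simp: subspace_def inner_add_left)
  have "e \<notin> ?T" using inner_ee by simp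
  then have "e \<notin> span ?T" using span_eq_iff[of ?T] T by metis
  moreover have "span (insert e ?T) = S"
  proof (rule span_subspace[OF _ _ S])
    show "insert e ?T \<subseteq> S" using e by auto
    show "S \<subseteq> span (insert e ?T)"
    proof
      fix x assume "x \<in> S"
      then have "x - (x \<bullet> e) *\<^sub>R e \<in> ?T"
        using S e by (simp add: subspace_diff subspace_scale inner_diff_left inner_ee)
      then have "x - (x \<bullet> e) *\<^sub>R e \<in> span (insert e ?T)" "(x \<bullet> e) *\<^sub>R e \<in> span (insert e ?T)"
        by (auto intro: span_base span_scale)
      from span_add[OF this] show "x \<in> span (insert e ?T)" by simp
    qed
  qed
  ultimately show ?thesis
    using dim_insert[of e ?T] dim_span[of "insert e ?T"] by simp
qed

text \<open>\<open>S\<close> without the closed ray through \<open>e\<close>; it is star-shaped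
  about \<open>- e\<close>.\<close>

definition "slit = {x \<in> S. x \<noteq> (x \<bullet> e) *\<^sub>R e \<or> x \<bullet> e < 0}"
definition "upper_half = {x \<in> S. x \<bullet> e > 0}"

lemma hom_trivial_slit: "hom_trivial p (top_of_set S) slit"
proof (rule hom_trivial_top_of_set)
  let ?h = "\<lambda>(s::real, x). (1 - s) *\<^sub>R x - s *\<^sub>R e"
  show "continuous_on ({0..1} \<times> S) ?h" by (auto intro!: continuous_intros simp: case_prod_unfold)
  show "slit \<subseteq> S" by (auto simp: slit_def)
  show "?h (t, x) \<in> S" if "x \<in> S" for t x
    using that e S by (auto intro: subspace_diff subspace_scale)
  have "- e \<in> slit" using e S inner_ee by (auto simp: slit_def subspace_neg)
  then show "?h (1, x) \<in> slit" for x by simp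
  show "?h (t, x) \<in> slit" if t: "t \<in> {0..1}" and x: "x \<in> slit" for t x
  proof (cases "t = 1")
    case True
    then show ?thesis using \<open>- e \<in> slit\<close> by simp
  next
    case False
    then have t1: "1 - t > 0" using t by simp
    let ?y = "(1 - t) *\<^sub>R x - t *\<^sub>R e"
    have xS: "x \<in> S" using x by (simp add: slit_def)
    have y: "?y \<in> S" using xS e S by (auto intro: subspace_diff subspace_scale)
    have ye: "?y \<bullet> e = (1 - t) * (x \<bullet> e) - t" by (simp add: inner_diff_left inner_ee)
    \<comment> \<open>The part orthogonal to \<open>e\<close> is only scaled by
      \<open>1 - t\<close>, so a point off the line through \<open>e\<close> stays off it until the
      end.\<close>
    have eq: "?y - (?y \<bullet> e) *\<^sub>R e = (1 - t) *\<^sub>R (x - (x \<bullet> e) *\<^sub>R e)"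
      unfolding ye by (simp add: algebra_simps)
    consider "x \<noteq> (x \<bullet> e) *\<^sub>R e" | "x \<bullet> e < 0" using x by (auto simp: slit_def)
    then have "?y \<in> slit"
    proof cases
      case 1
      then have "?y - (?y \<bullet> e) *\<^sub>R e \<noteq> 0" unfolding eq using t1 by simp
      then show ?thesis using y by (simp add: slit_def)
    next
      case 2
      then have "(1 - t) * (x \<bullet> e) < 0" using t1 by (simp add: mult_pos_neg)
      then have "?y \<bullet> e < 0" unfolding ye using t by simp
      then show ?thesis using y by (simp add: slit_def)
    qed
    then show ?thesis by simp
  qed
qed simp

text \<open>What \<open>slit\<close> omits from the punctured space is the open ray through
  \<open>e\<close>, which lies in the open half space, so the two sets form an open cover.\<close>

lemma hom_iso_upper_half:
  "hom_iso p (top_of_set upper_half) (upper_half \<inter> slit) (top_of_set (S - {0})) slit id"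
proof (rule hom_iso_excision_top_of_set)
  have "upper_half = (S - {0}) \<inter> {x. x \<bullet> e > 0}" by (auto simp: upper_half_def)
  moreover have "open {x. x \<bullet> e > 0}" by (intro open_Collect_less continuous_intros)
  ultimately show "openin (top_of_set (S - {0})) upper_half" by (metis openin_open_Int)
  have "slit = (S - {0}) \<inter> ({x. x \<noteq> (x \<bullet> e) *\<^sub>R e} \<union> {x. x \<bullet> e < 0})"
    by (auto simp: slit_def)
  moreover have "open ({x. x \<noteq> (x \<bullet> e) *\<^sub>R e} \<union> {x. x \<bullet> e < 0})"
    by (intro open_Un open_Collect_less open_Collect_neq continuous_intros)
  ultimately show "openin (top_of_set (S - {0})) slit" by (metis openin_open_Int)
  have "x \<in> upper_half" if "x \<in> S" "x \<noteq> 0" "x = (x \<bullet> e) *\<^sub>R e" "\<not> x \<bullet> e < 0" for x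
    using that by (cases "x \<bullet> e = 0") (auto simp: upper_half_def)
  then show "upper_half \<union> slit = S - {0}"
    by (auto simp: upper_half_def slit_def)
qed

text \<open>Moving along \<open>e\<close> retracts the half space onto its slice at height 1, a
  translate of the hyperplane, which meets the omitted ray in the single point
  \<open>e\<close>.\<close>

lemma hom_iso_hyperplane:
  "hom_iso p (top_of_set upper_half) (upper_half \<inter> slit) (top_of_set {x \<in> S. x \<bullet> e = 0})
     ({x \<in> S. x \<bullet> e = 0} - {0}) (\<lambda>x. x - (x \<bullet> e) *\<^sub>R e)"
proof (rule hom_iso_top_of_set[where g = "\<lambda>y. y + e"
      and h = "\<lambda>(t, x). x + (t * (1 - x \<bullet> e)) *\<^sub>R e"])
  let ?h = "\<lambda>(t, x). x + (t * (1 - x \<bullet> e)) *\<^sub>R e"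
  have h: "?h (t, x) \<in> upper_half" if "t \<in> {0..1}" "x \<in> upper_half" for t x
  proof -
    have x: "x \<in> S" "x \<bullet> e > 0" using that by (auto simp: upper_half_def)
    have "(1 - t) * (x \<bullet> e) + t > 0"
      using that x by (cases "t = 1") (auto intro: add_pos_nonneg)
    then show ?thesis
      using x e S by (auto simp: upper_half_def inner_add_left inner_ee algebra_simps
          intro!: subspace_add subspace_scale subspace_diff)
  qed
  then show "?h (t, x) \<in> upper_half" if "t \<in> {0..1}" "x \<in> upper_half" for t x using that by blast
  show "?h (t, x) \<in> upper_half \<inter> slit" if "t \<in> {0..1}" "x \<in> upper_half \<inter> slit" for t x
  proof -
    have "x - (x \<bullet> e) *\<^sub>R e \<noteq> 0" using that by (auto simp: slit_def upper_half_def)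
    then have "?h (t, x) - (?h (t, x) \<bullet> e) *\<^sub>R e \<noteq> 0"
      by (simp add: inner_add_left inner_ee algebra_simps)
    then show ?thesis using h[of t x] that by (auto simp: slit_def upper_half_def)
  qed
  show "continuous_on ({0..1} \<times> upper_half) ?h"
    by (auto intro!: continuous_intros simp: case_prod_unfold)
  show "continuous_on upper_half (\<lambda>x. x - (x \<bullet> e) *\<^sub>R e)" by (intro continuous_intros)
  show "continuous_on {x \<in> S. x \<bullet> e = 0} (\<lambda>y. y + e)" by (intro continuous_intros)
  show "x - (x \<bullet> e) *\<^sub>R e \<in> {x \<in> S. x \<bullet> e = 0}" if "x \<in> upper_half" for x
    using that e S by (auto simp: upper_half_def inner_diff_left inner_ee intro: subspace_diff subspace_scale)
  then show "x - (x \<bullet> e) *\<^sub>R e \<in> {x \<in> S. x \<bullet> e = 0} - {0}" if "x \<in> upper_half \<inter> slit" for x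
    using that by (auto simp: slit_def upper_half_def)
  show "y + e \<in> upper_half" if "y \<in> {x \<in> S. x \<bullet> e = 0}" for y
    using that e S by (auto simp: upper_half_def inner_add_left inner_ee intro: subspace_add)
  then show "y + e \<in> upper_half \<inter> slit" if "y \<in> {x \<in> S. x \<bullet> e = 0} - {0}" for y
    using that e S by (auto simp: slit_def inner_add_left inner_ee intro: subspace_add)
  show "upper_half \<inter> slit \<subseteq> upper_half" "{x \<in> S. x \<bullet> e = 0} - {0} \<subseteq> {x \<in> S. x \<bullet> e = 0}" by auto
qed (auto simp: inner_add_left inner_ee algebra_simps)

lemma hom_iso_slit_hyperplane:
  "hom_trivial p (top_of_set (S - {0})) slit \<longleftrightarrow>
     hom_trivial p (top_of_set {x \<in> S. x \<bullet> e = 0}) ({x \<in> S. x \<bullet> e = 0} - {0})"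
  "hom_line p (top_of_set (S - {0})) slit \<longleftrightarrow>
     hom_line p (top_of_set {x \<in> S. x \<bullet> e = 0}) ({x \<in> S. x \<bullet> e = 0} - {0})"
  using hom_trivial_iso[OF hom_iso_upper_half] hom_trivial_iso[OF hom_iso_hyperplane]
    hom_line_iso[OF hom_iso_upper_half] hom_line_iso[OF hom_iso_hyperplane] by blast+

lemma slit_subset: "slit \<subseteq> S - {0}"
  by (auto simp: slit_def)

text \<open>\<open>S\<close> relative to \<open>slit\<close> has no homology, so the connecting map
  shifts the local homology of \<open>S\<close> down to the punctured space relative to
  \<open>slit\<close>, which excision identifies with the local homology of a hyperplane.\<close>

lemma hom_line_subspace_Suc:
  "hom_line (Suc p) (top_of_set S) (S - {0}) \<longleftrightarrow>
     hom_line p (top_of_set {x \<in> S. x \<bullet> e = 0}) ({x \<in> S. x \<bullet> e = 0} - {0})"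
  using hom_line_connecting[OF slit_subset hom_trivial_slit hom_trivial_slit, of p]
  by (simp add: subtopology_top_of_set hom_iso_slit_hyperplane)

lemma hom_trivial_subspace_Suc:
  assumes "hom_trivial p (top_of_set {x \<in> S. x \<bullet> e = 0}) ({x \<in> S. x \<bullet> e = 0} - {0})"
  shows "hom_trivial (Suc p) (top_of_set S) (S - {0})"
  by (rule hom_trivial_triple[OF slit_subset hom_trivial_slit])
    (use assms in \<open>simp add: subtopology_top_of_set hom_iso_slit_hyperplane\<close>)

lemma hom_trivial_subspace_0: "hom_trivial 0 (top_of_set S) (S - {0})"
  by (rule hom_trivial_triple[OF slit_subset hom_trivial_slit]) simp

end

text \<open>Stated for all subspaces of one fixed type so that the induction can descend to an
  orthogonal hyperplane; the base case is a single point.\<close>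

lemma homology_punctured_subspace:
  fixes S :: "'a::euclidean_space set"
  assumes "subspace S"
  shows "hom_line (dim S) (top_of_set S) (S - {0}) \<and>
    (\<forall>p. p \<noteq> dim S \<longrightarrow> hom_trivial p (top_of_set S) (S - {0}))"
  using assms
proof (induction "dim S" arbitrary: S)
  case 0
  then have S: "S = {0}"
    using dim_eq_0[of S] subspace_0 by fastforce
  have "hom_trivial 0 (top_of_set S) {0}"
    using hom_trivial_self[of 0 "top_of_set S"] S by simp
  then have "hom_line 0 (top_of_set S) {}"
    using hom_line_0_connected[of 0 "top_of_set S"] S by simp
  moreover have "hom_trivial p (top_of_set S) {}" if "p \<noteq> 0" for p
    by (rule hom_trivial_point[of _ 0]) (use S that in auto)
  ultimately show ?case using 0 S by auto
next
  case (Suc n)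
  then have "S \<noteq> {0}" by (metis nat.distinct(1) dim_eq_0 subset_refl)
  then obtain v where v: "v \<in> S" "v \<noteq> 0" using subspace_0[OF Suc.prems] by blast
  define e where "e = v /\<^sub>R norm v"
  have e: "e \<in> S" "norm e = 1" using v Suc.prems by (auto simp: e_def subspace_scale)
  let ?T = "{x \<in> S. x \<bullet> e = 0}"
  have T: "subspace ?T" using Suc.prems by (auto simp: subspace_def inner_add_left)
  have dS: "dim S = Suc (dim ?T)" by (rule dim_orthogonal_hyperplane[OF Suc.prems e])
  then have "n = dim ?T" using Suc.hyps(2) by simp
  note IH = Suc.hyps(1)[OF this T]
  have "hom_line (dim S) (top_of_set S) (S - {0})"
    using IH hom_line_subspace_Suc[OF Suc.prems e, of "dim ?T"] unfolding dS by blast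
  moreover have "hom_trivial p (top_of_set S) (S - {0})" if "p \<noteq> dim S" for p
  proof (cases p)
    case 0
    then show ?thesis using hom_trivial_subspace_0[OF Suc.prems e] by simp
  next
    case (Suc q)
    then show ?thesis using that IH hom_trivial_subspace_Suc[OF \<open>subspace S\<close> e, of q] dS by auto
  qed
  ultimately show ?case by blast
qed

lemma homology_punctured_UNIV:
  fixes p :: nat
  shows "hom_line DIM('a::euclidean_space) euclidean (- {0 :: 'a})"
    and "p \<noteq> DIM('a) \<Longrightarrow> hom_trivial p euclidean (- {0 :: 'a})"
  using homology_punctured_subspace[of "UNIV :: 'a set"] by (auto simp: Compl_eq_Diff_UNIV)

section \<open>The link\<close>

definition e1 :: "complex^3" where "e1 = axis 1 1"

definition quadric_cone :: "((complex^3) \<times> (complex^3)) set" where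
  "quadric_cone = {(z, w). (\<Sum>i\<in>UNIV. z $ i * w $ i) = 0} - {0}"

definition open_stratum :: "((complex^3) \<times> (complex^3)) set" where
  "open_stratum = {(z, w) \<in> quadric_cone. z \<noteq> 0}"

text \<open>The equation \<open>w = - (norm w *\<^sub>R e1)\<close> describes the closed ray through
  \<open>- e1\<close>, including \<open>w = 0\<close>.\<close>

definition big_stratum :: "((complex^3) \<times> (complex^3)) set" where
  "big_stratum = {(z, w) \<in> quadric_cone. z \<noteq> 0 \<or> w \<noteq> - (norm w *\<^sub>R e1)}"

definition base_point :: "(complex^3) \<times> (complex^3)" where
  "base_point = (e1, 0)"

lemma e1_nth [simp]: "e1 $ 1 = 1" "e1 $ 2 = 0" "e1 $ 3 = 0"
  by (simp_all add: e1_def axis_def)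

lemma vec3_eq_iff: "(x :: 'a^3) = y \<longleftrightarrow> x $ 1 = y $ 1 \<and> x $ 2 = y $ 2 \<and> x $ 3 = y $ 3"
  by (auto simp: vec_eq_iff forall_3)

lemma norm_complex_vec3: "(norm (x :: complex^3))\<^sup>2 = (cmod (x $ 1))\<^sup>2 + (cmod (x $ 2))\<^sup>2 + (cmod (x $ 3))\<^sup>2"
  by (simp add: power2_norm_eq_inner inner_vec_def sum_3)

lemma norm_e1 [simp]: "norm e1 = 1" "e1 \<noteq> 0"
proof -
  have "(norm e1)\<^sup>2 = 1\<^sup>2" using norm_complex_vec3[of e1] by simp
  then show "norm e1 = 1" by (simp only: power2_eq_iff_nonneg norm_ge_zero zero_le_one)
  then show "e1 \<noteq> 0" by auto
qed

lemma quadric_cone_iff: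
  "(z, w) \<in> quadric_cone \<longleftrightarrow> z $ 1 * w $ 1 + z $ 2 * w $ 2 + z $ 3 * w $ 3 = 0 \<and> (z \<noteq> 0 \<or> w \<noteq> 0)"
  by (auto simp: quadric_cone_def sum_3 zero_prod_def)

lemma strata_iff:
  "(z, w) \<in> open_stratum \<longleftrightarrow> (z, w) \<in> quadric_cone \<and> z \<noteq> 0"
  "(z, w) \<in> big_stratum \<longleftrightarrow> (z, w) \<in> quadric_cone \<and> (z \<noteq> 0 \<or> w \<noteq> - (norm w *\<^sub>R e1))"
  by (auto simp: open_stratum_def big_stratum_def)

lemma strata_subset: "base_point \<in> open_stratum" "open_stratum \<subseteq> big_stratum" "big_stratum \<subseteq> quadric_cone"
  by (auto simp: strata_iff base_point_def quadric_cone_iff)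

text \<open>Over each \<open>z \<noteq> 0\<close> the fibre is the linear space of all
  \<open>w\<close> annihilated by \<open>z\<close>, so \<open>w\<close> can be scaled to 0 without
  leaving the stratum.\<close>

lemma homology_open_stratum:
  "hom_line 5 (top_of_set open_stratum) {base_point}"
  "p \<noteq> 5 \<Longrightarrow> hom_trivial p (top_of_set open_stratum) {base_point}"
proof -
  have iso: "hom_iso p (top_of_set open_stratum) {base_point} (top_of_set (- {0})) {e1} fst" for p
    by (rule hom_iso_top_of_set[where g = "\<lambda>z. (z, 0)" and h = "\<lambda>(t, z, w). (z, (1 - t) *\<^sub>R w)"])
      (auto simp: strata_iff quadric_cone_iff base_point_def case_prod_unfold algebra_simps
        intro!: continuous_intros simp flip: distrib_left scaleR_add_right)
  have triv: "hom_trivial p euclidean {e1}" for p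
  proof -
    have "hom_trivial p (top_of_set UNIV) {e1}"
      by (rule hom_trivial_top_of_set[where h = "\<lambda>(t, x). (1 - t) *\<^sub>R x + t *\<^sub>R e1"])
        (auto simp: case_prod_unfold algebra_simps intro!: continuous_intros)
    then show ?thesis by simp
  qed
  have sub: "{e1} \<subseteq> - {0}" by simp
  \<comment> \<open>6 is the real dimension of \<open>C^3\<close>. The whole space is contractible
    to \<open>e1\<close>, so the connecting map lowers the degree to 5.\<close>
  have "hom_line 6 euclidean (- {0 :: complex^3})"
    using homology_punctured_UNIV(1)[where 'a = "complex^3"] by simp
  then have "hom_line 5 (top_of_set (- {0})) {e1}"
    using hom_line_connecting[OF sub triv triv, of 5] by simp
  then show "hom_line 5 (top_of_set open_stratum) {base_point}"
    using hom_line_iso[OF iso] by blast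
  assume "p \<noteq> 5"
  then have "hom_trivial (Suc p) euclidean (- {0 :: complex^3})"
    by (intro homology_punctured_UNIV(2)) simp
  from hom_trivial_sub[OF sub triv this]
  show "hom_trivial p (top_of_set open_stratum) {base_point}"
    using hom_trivial_iso[OF iso] by blast
qed

text \<open>Off the ray \<open>w = - |w| e1\<close>, the vector \<open>transversal w\<close> is transversal both to the
  hyperplane \<open>w\<^sup>\<bottom>\<close> and to the coordinate hyperplane \<open>z\<^sub>1 = 0\<close>, so that projecting along it
  identifies the two.\<close>

definition transversal :: "complex^3 \<Rightarrow> complex^3" where
  "transversal w = (\<chi> i. cnj (w $ i)) + norm w *\<^sub>R e1"

lemma transversal_nth:
  "transversal w $ 1 = cnj (w $ 1) + norm w" "transversal w $ 2 = cnj (w $ 2)" "transversal w $ 3 = cnj (w $ 3)"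
  by (simp_all add: transversal_def scaleR_conv_of_real[where 'a = complex])

text \<open>If the first coordinate of \<open>w\<close> equals minus its norm, that coordinate uses
  up the whole norm and \<open>w\<close> lies on the omitted ray.\<close>

lemma transversal_first_neq_0:
  assumes "w \<noteq> - (norm w *\<^sub>R e1)"
  shows "transversal w $ 1 \<noteq> 0"
proof
  assume "transversal w $ 1 = 0"
  then have "cnj (w $ 1) = - complex_of_real (norm w)"
    by (simp add: transversal_nth eq_neg_iff_add_eq_0)
  then have w1: "w $ 1 = - complex_of_real (norm w)"
    by (metis complex_cnj_cnj complex_cnj_complex_of_real complex_cnj_minus)
  then have "(cmod (w $ 2))\<^sup>2 + (cmod (w $ 3))\<^sup>2 = 0"
    using norm_complex_vec3[of w] by simp
  then have "w $ 2 = 0" "w $ 3 = 0"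
    by (auto simp: sum_power2_eq_zero_iff)
  then have "w = - (norm w *\<^sub>R e1)"
    using w1 by (simp add: vec3_eq_iff scaleR_conv_of_real[where 'a = complex])
  then show False using assms by simp
qed

definition pairing :: "complex^3 \<Rightarrow> complex^3 \<Rightarrow> complex" where
  "pairing z w = z $ 1 * w $ 1 + z $ 2 * w $ 2 + z $ 3 * w $ 3"

text \<open>The conjugate vector contributes the squared norm of \<open>w\<close>, the multiple of
  \<open>e1\<close> the rest. The value vanishes exactly under the condition excluded by
  \<open>transversal_first_neq_0\<close>.\<close>

lemma pairing_transversal: "pairing w (transversal w) = norm w * (w $ 1 + norm w)"
proof -
  have "complex_of_real ((norm w)\<^sup>2) = w $ 1 * cnj (w $ 1) + w $ 2 * cnj (w $ 2) + w $ 3 * cnj (w $ 3)"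
    by (simp only: norm_complex_vec3 of_real_add complex_norm_square)
  then show ?thesis
    by (simp add: pairing_def transversal_nth algebra_simps power2_eq_square)
qed

lemma pairing_transversal_neq_0:
  assumes "w \<noteq> - (norm w *\<^sub>R e1)"
  shows "pairing w (transversal w) \<noteq> 0"
proof -
  have "w \<noteq> 0" using assms by auto
  moreover have "w $ 1 + norm w \<noteq> 0"
    using transversal_first_neq_0[OF assms] unfolding transversal_nth
    by (metis complex_cnj_add complex_cnj_complex_of_real complex_cnj_zero_iff)
  ultimately show ?thesis by (simp add: pairing_transversal)
qed

text \<open>\<open>slope\<close> projects along \<open>transversal w\<close> onto
  \<open>z $ 1 = 0\<close>; \<open>unslope\<close> projects along the same vector onto the
  annihilator of \<open>w\<close>.\<close>

definition slope :: "(complex^3) \<times> (complex^3) \<Rightarrow> complex^3" where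
  "slope = (\<lambda>(z, w). z - (\<chi> i. z $ 1 / transversal w $ 1 * transversal w $ i))"

definition unslope :: "complex^3 \<Rightarrow> complex^3 \<Rightarrow> complex^3" where
  "unslope x w = x - (\<chi> i. pairing w x / pairing w (transversal w) * transversal w $ i)"

definition tube :: "((complex^3) \<times> (complex^3)) set" where
  "tube = {(z, w) \<in> quadric_cone. w \<noteq> - (norm w *\<^sub>R e1)}"

text \<open>The omitted ray contains 0, so being off it gives \<open>w \<noteq> 0\<close> and keeps
  the vertex out.\<close>

lemma tube_iff: "(z, w) \<in> tube \<longleftrightarrow> pairing z w = 0 \<and> w \<noteq> - (norm w *\<^sub>R e1)"
  by (auto simp: tube_def quadric_cone_iff pairing_def)

lemma pairing_simps:
  "pairing (x - y) w = pairing x w - pairing y w" "pairing w (x - y) = pairing w x - pairing w y"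
  "pairing (\<chi> i. a * x $ i) w = a * pairing x w" "pairing w (\<chi> i. a * x $ i) = a * pairing w x"
  "pairing x y = pairing y x"
  by (simp_all add: pairing_def algebra_simps)

lemma pairing_commute: "pairing x y = pairing y x"
  by (simp add: pairing_def mult.commute)

lemma unslope_in_hyperplane:
  "w \<noteq> - (norm w *\<^sub>R e1) \<Longrightarrow> pairing (unslope x w) w = 0"
  using pairing_transversal_neq_0[of w]
  by (subst pairing_commute, simp add: unslope_def pairing_simps(2,4) del: times_divide_eq_left) simp

lemma slope_first: "w \<noteq> - (norm w *\<^sub>R e1) \<Longrightarrow> slope (z, w) $ 1 = 0"
  using transversal_first_neq_0[of w] by (simp add: slope_def)

lemma unslope_slope:
  assumes "(z, w) \<in> tube"
  shows "unslope (slope (z, w)) w = z"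
proof -
  let ?c = "transversal w" and ?a = "z $ 1 / transversal w $ 1"
  have "pairing w z = 0" using assms by (simp add: tube_iff pairing_commute)
  then have "pairing w (slope (z, w)) = - ?a * pairing w ?c"
    by (simp add: slope_def pairing_simps(2,4) del: times_divide_eq_left)
  then have "pairing w (slope (z, w)) / pairing w ?c = - ?a"
    using pairing_transversal_neq_0[of w] assms by (simp add: tube_iff)
  then show ?thesis by (simp add: unslope_def vec_eq_iff) (simp add: slope_def)
qed

text \<open>The kernel of the projection consists of multiples of \<open>transversal w\<close>, and
  a nonzero multiple has nonzero first coordinate.\<close>

lemma unslope_neq_0:
  assumes "w \<noteq> - (norm w *\<^sub>R e1)" "x $ 1 = 0" "x \<noteq> 0"
  shows "unslope x w \<noteq> 0"
proof
  let ?a = "pairing w x / pairing w (transversal w)"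
  assume "unslope x w = 0"
  then have eq: "x $ i = ?a * transversal w $ i" for i
    by (auto simp: unslope_def vec_eq_iff)
  then have "?a = 0" using transversal_first_neq_0[OF assms(1)] assms(2) eq[of 1] by simp
  then show False using eq assms(3) by (simp add: vec_eq_iff)
qed

lemma slope_eq_0_iff:
  assumes "(z, w) \<in> tube"
  shows "slope (z, w) = 0 \<longleftrightarrow> z = 0"
proof
  have "unslope 0 w = 0" by (simp add: unslope_def pairing_def vec_eq_iff)
  then show "z = 0" if "slope (z, w) = 0" using unslope_slope[OF assms] that by simp
  show "slope (z, w) = 0" if "z = 0" using that by (simp add: slope_def vec_eq_iff)
qed

lemma continuous_on_pairing [continuous_intros]:
  "continuous_on S f \<Longrightarrow> continuous_on S g \<Longrightarrow> continuous_on S (\<lambda>x. pairing (f x) (g x))"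
  unfolding pairing_def by (intro continuous_intros)

lemma continuous_on_transversal [continuous_intros]:
  "continuous_on S f \<Longrightarrow> continuous_on S (\<lambda>x. transversal (f x))"
  unfolding transversal_def by (auto intro!: continuous_intros)

lemma continuous_on_slope:
  "continuous_on T f \<Longrightarrow> (\<And>x. x \<in> T \<Longrightarrow> f x \<in> tube) \<Longrightarrow> continuous_on T (\<lambda>x. slope (f x))"
  unfolding slope_def case_prod_unfold
  by (intro continuous_intros) (use transversal_first_neq_0 in \<open>auto simp: tube_def case_prod_unfold\<close>)

definition slit_path :: "real \<Rightarrow> complex^3 \<Rightarrow> complex^3" where
  "slit_path t w = (1 - t) *\<^sub>R w + t *\<^sub>R e1"

text \<open>A point of the segment from \<open>w\<close> to \<open>e1\<close> lying on the opposite
  ray would, solved for \<open>w\<close>, put \<open>w\<close> itself on that ray.\<close>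

lemma slit_path:
  assumes t: "t \<in> {0..1}" and w: "w \<noteq> - (norm w *\<^sub>R e1)"
  shows "slit_path t w \<noteq> - (norm (slit_path t w) *\<^sub>R e1)"
proof
  let ?v = "slit_path t w"
  assume v: "?v = - (norm ?v *\<^sub>R e1)"
  \<comment> \<open>\<open>r\<close> absorbs the multiple of \<open>e1\<close>, so that
    \<open>(1 - t) *\<^sub>R w\<close> becomes a nonpositive multiple of \<open>e1\<close>.\<close>
  define r where "r = norm ?v + t"
  have "(1 - t) *\<^sub>R w = ?v - t *\<^sub>R e1" by (simp add: slit_path_def)
  also have "\<dots> = - (r *\<^sub>R e1)" by (subst v) (simp add: r_def scaleR_left_distrib)
  finally have eq: "(1 - t) *\<^sub>R w = - (r *\<^sub>R e1)" .
  have "r \<ge> 0" using t by (simp add: r_def)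
  show False
  proof (cases "t = 1")
    case True
    then have "r *\<^sub>R e1 = 0" using eq by simp
    then show False using True by (simp add: r_def add_nonneg_eq_0_iff)
  next
    case False
    then have pos: "1 - t > 0" using t by simp
    have "w = (1 / (1 - t)) *\<^sub>R ((1 - t) *\<^sub>R w)" using pos by simp
    then have w': "w = - ((r / (1 - t)) *\<^sub>R e1)" unfolding eq by simp
    then have "norm w = r / (1 - t)" using pos \<open>r \<ge> 0\<close> by (simp del: scaleR_minus_left)
    then show False using w w' by simp
  qed
qed

text \<open>The tube is a complex plane bundle over the contractible set of admissible
  \<open>w\<close>, trivialised by the two free coordinates of \<open>slope\<close>. The open
  stratum is the complement of its zero section.\<close>

lemma hom_iso_tube:
  "hom_iso p (top_of_set tube) (tube \<inter> open_stratum) euclidean (- {0})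
     (\<lambda>v. (slope v $ 2, slope v $ 3))"
proof -
  let ?f = "\<lambda>v. (slope v $ 2, slope v $ 3)"
  let ?g = "\<lambda>(a, b). ((\<chi> i. if i = 2 then a else if i = 3 then b else 0) :: complex^3, e1)"
  \<comment> \<open>The fibre coordinate \<open>slope v\<close> is kept while \<open>w\<close> moves
    to \<open>e1\<close>, where \<open>unslope\<close> does nothing to vectors with first coordinate
    0.\<close>
  let ?h = "\<lambda>(t, v). (unslope (slope v) (slit_path t (snd v)), slit_path t (snd v))"
  have e1: "e1 \<noteq> - (norm e1 *\<^sub>R e1)" by (simp add: vec3_eq_iff)
  have tube_open: "(z, w) \<in> tube \<inter> open_stratum \<longleftrightarrow> (z, w) \<in> tube \<and> z \<noteq> 0" for z w
    by (auto simp: tube_def strata_iff)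
  have h: "?h (t, v) \<in> tube" if "t \<in> {0..1}" "v \<in> tube" for t v
    using that slit_path[of t "snd v"] unslope_in_hyperplane
    by (cases v) (auto simp: tube_iff)
  have slope_nth: "slope v $ 1 = 0" if "v \<in> tube" for v
    using that slope_first by (cases v) (auto simp: tube_iff)
  have unslope_e1: "unslope x e1 = x" if "x $ 1 = 0" for x
    using that by (simp add: unslope_def pairing_def vec_eq_iff)
  have cf: "continuous_on tube ?f"
    by (intro continuous_intros continuous_on_slope)
  have ch: "continuous_on ({0..1} \<times> tube) ?h"
  proof -
    have "continuous_on ({0..1} \<times> tube) (\<lambda>x. slope (snd x))"
      by (rule continuous_on_slope) (auto intro: continuous_intros)
    moreover have "continuous_on ({0..1} \<times> tube) (\<lambda>x. slit_path (fst x) (snd (snd x)))"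
      unfolding slit_path_def by (intro continuous_intros)
    moreover have "pairing (slit_path (fst x) (snd (snd x))) (transversal (slit_path (fst x) (snd (snd x)))) \<noteq> 0"
      if "x \<in> {0..1} \<times> tube" for x
      using that pairing_transversal_neq_0 slit_path by (auto simp: tube_iff)
    ultimately show ?thesis
      unfolding case_prod_unfold unslope_def by (intro continuous_intros) auto
  qed
  have cg: "continuous_on UNIV ?g"
  proof -
    have "continuous_on UNIV (\<lambda>x. if i = 2 then fst x else if i = 3 then snd x else 0 :: complex)" for i :: 3
      by (cases "i = 2"; cases "i = 3") (auto intro!: continuous_intros)
    then show ?thesis
      unfolding case_prod_unfold by (intro continuous_intros)
  qed
  have g1: "?g x \<in> tube" for x
    using e1 by (cases x) (auto simp: tube_iff pairing_def)
  have g2: "?g x \<in> tube \<inter> open_stratum" if "x \<in> - {0}" for x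
  proof (cases x)
    case (Pair a b)
    let ?z = "(\<chi> i. if i = 2 then a else if i = 3 then b else 0) :: complex^3"
    have "?z \<noteq> 0" using that Pair by (auto simp: vec3_eq_iff zero_prod_def)
    moreover have "(?z, e1) \<in> tube" using e1 by (simp only: tube_iff) (simp add: pairing_def)
    ultimately show ?thesis unfolding Pair by (simp only: tube_open prod.case simp_thms)
  qed
  have f2: "?f v \<in> - {0}" if "v \<in> tube \<inter> open_stratum" for v
  proof -
    obtain z w where "v = (z, w)" by (cases v)
    then have v: "v = (z, w)" "(z, w) \<in> tube" "z \<noteq> 0" using that by (simp_all only: tube_open simp_thms)
    then have "slope v \<noteq> 0" using slope_eq_0_iff by blast
    then show ?thesis using slope_nth[of v] v by (auto simp: zero_prod_def vec3_eq_iff)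
  qed
  have fg: "?f (?g x) = x" for x
    by (cases x) (simp add: slope_def)
  have h0: "?h (0, v) = v" if "v \<in> tube" for v
    using that unslope_slope by (cases v) (auto simp: slit_path_def)
  have h1: "?h (1, v) = ?g (?f v)" if "v \<in> tube" for v
    using slope_nth[OF that] by (simp add: slit_path_def unslope_e1 vec3_eq_iff)
  have hA: "?h (t, v) \<in> tube \<inter> open_stratum" if "t \<in> {0..1}" "v \<in> tube \<inter> open_stratum" for t v
  proof -
    have "?h (t, v) \<in> tube" using h that by blast
    moreover have "unslope (slope v) (slit_path t (snd v)) \<noteq> 0"
    proof -
      obtain z w where "v = (z, w)" by (cases v)
    then have v: "v = (z, w)" "(z, w) \<in> tube" "z \<noteq> 0" using that by (simp_all only: tube_open simp_thms)
      then have "slope v \<noteq> 0" using slope_eq_0_iff by blast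
      then show ?thesis
        using slope_nth[of v] v slit_path[OF that(1)] by (intro unslope_neq_0) (simp_all add: tube_iff)
    qed
    ultimately show ?thesis by (simp only: tube_open prod.case simp_thms)
  qed
  have "hom_iso p (top_of_set tube) (tube \<inter> open_stratum) (top_of_set UNIV) (- {0}) ?f"
    by (rule hom_iso_top_of_set[where g = ?g and h = ?h, OF cf UNIV_I f2 cg g1 g2 Int_lower1 subset_UNIV fg ch h h0 h1 hA])
  then show ?thesis by simp
qed

lemma openin_quadric_coneI:
  assumes "open O'" "S = T \<inter> O'"
  shows "openin (top_of_set T) S"
  using assms openin_open by blast

lemma open_off_ray: "open {x :: (complex^3) \<times> (complex^3). snd x \<noteq> - (norm (snd x) *\<^sub>R e1)}"
  "open {x :: (complex^3) \<times> (complex^3). fst x \<noteq> 0}"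
  by (intro open_Collect_neq continuous_intros)+

lemma hom_iso_tube_big_stratum:
  "hom_iso p (top_of_set tube) (tube \<inter> open_stratum) (top_of_set big_stratum) open_stratum id"
proof (rule hom_iso_excision_top_of_set)
  show "openin (top_of_set big_stratum) tube"
    by (rule openin_quadric_coneI[OF open_off_ray(1)]) (auto simp: tube_def strata_iff)
  show "openin (top_of_set big_stratum) open_stratum"
    by (rule openin_quadric_coneI[OF open_off_ray(2)]) (auto simp: strata_iff)
  show "tube \<union> open_stratum = big_stratum" by (auto simp: tube_def strata_iff)
qed

lemma homology_big_stratum_rel:
  "hom_line 4 (top_of_set big_stratum) open_stratum"
  "p \<noteq> 4 \<Longrightarrow> hom_trivial p (top_of_set big_stratum) open_stratum"
proof -
  show "hom_line 4 (top_of_set big_stratum) open_stratum"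
    using homology_punctured_UNIV(1)[where 'a = "complex \<times> complex"] hom_line_iso[OF hom_iso_tube, of 4]
      hom_line_iso[OF hom_iso_tube_big_stratum, of 4] by simp
  show "hom_trivial p (top_of_set big_stratum) open_stratum" if "p \<noteq> 4"
    using that homology_punctured_UNIV(2)[where 'a = "complex \<times> complex", of p]
      hom_trivial_iso[OF hom_iso_tube, of p] hom_trivial_iso[OF hom_iso_tube_big_stratum, of p] by simp
qed

section \<open>A neighbourhood of the omitted ray\<close>

lemma neg_ray_nth:
  assumes "w = - (r *\<^sub>R e1)"
  shows "w $ 1 = - complex_of_real r" "w $ 2 = 0" "w $ 3 = 0"
  using assms by (simp_all add: scaleR_conv_of_real[where 'a = complex])

text \<open>Near the ray \<open>w $ 1\<close> is nonzero, so the equation determines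
  \<open>z $ 1\<close>, while \<open>Re (w $ 1)\<close> runs along the ray. The nine real
  coordinates that remain are transverse to it.\<close>

definition end_chart :: "(complex^3) \<times> (complex^3) \<Rightarrow> complex \<times> complex \<times> complex \<times> complex \<times> real" where
  "end_chart = (\<lambda>(z, w). (z $ 2, z $ 3, w $ 2, w $ 3, Im (w $ 1)))"

definition end_nbhd :: "((complex^3) \<times> (complex^3)) set" where
  "end_nbhd = {(z, w) \<in> quadric_cone. Re (w $ 1) < 0}"

lemma end_nbhd_iff:
  "(z, w) \<in> end_nbhd \<longleftrightarrow> z $ 1 = - (z $ 2 * w $ 2 + z $ 3 * w $ 3) / w $ 1 \<and> Re (w $ 1) < 0"
proof (cases "Re (w $ 1) < 0")
  case True
  then have w1: "w $ 1 \<noteq> 0" "w \<noteq> 0" by auto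
  have "z $ 1 = - (z $ 2 * w $ 2 + z $ 3 * w $ 3) / w $ 1 \<longleftrightarrow>
      z $ 1 * w $ 1 + z $ 2 * w $ 2 + z $ 3 * w $ 3 = 0"
    by (simp only: nonzero_eq_divide_eq[OF w1(1)] eq_neg_iff_add_eq_0 add.assoc)
  then show ?thesis
    using True w1 by (simp only: end_nbhd_def quadric_cone_iff mem_Collect_eq prod.case) blast
qed (simp add: end_nbhd_def)

text \<open>The zero set of the chart is the omitted ray: when the transverse coordinates vanish,
  the equation yields \<open>z $ 1 = 0\<close> and \<open>w $ 1\<close> is a negative real
  number.\<close>

lemma big_stratum_end_nbhd:
  assumes "(z, w) \<in> end_nbhd"
  shows "(z, w) \<in> big_stratum \<longleftrightarrow> end_chart (z, w) \<noteq> 0"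
proof -
  have z1: "z $ 1 = - (z $ 2 * w $ 2 + z $ 3 * w $ 3) / w $ 1" and w1: "Re (w $ 1) < 0"
    using assms by (auto simp: end_nbhd_iff)
  have "z = 0 \<and> w = - (norm w *\<^sub>R e1) \<longleftrightarrow> end_chart (z, w) = 0"
  proof
    assume "z = 0 \<and> w = - (norm w *\<^sub>R e1)"
    then have z: "z = 0" and w: "w = - (norm w *\<^sub>R e1)" by blast+
    have "w $ 2 = 0" "w $ 3 = 0" "Im (w $ 1) = 0"
      using neg_ray_nth[OF w] by (simp_all add: complex_eq_iff)
    then show "end_chart (z, w) = 0" using z by (simp add: end_chart_def zero_prod_def)
  next
    assume "end_chart (z, w) = 0"
    then have *: "z $ 2 = 0" "z $ 3 = 0" "w $ 2 = 0" "w $ 3 = 0" "Im (w $ 1) = 0"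
      by (auto simp: end_chart_def zero_prod_def)
    then have nw: "(norm w)\<^sup>2 = (- Re (w $ 1))\<^sup>2"
      using norm_complex_vec3[of w] by (simp add: cmod_power2)
    have nw: "norm w = - Re (w $ 1)"
      by (rule power2_eq_imp_eq[OF nw]) (use w1 in auto)
    have "w = - (norm w *\<^sub>R e1)"
      unfolding nw using * by (simp add: vec3_eq_iff complex_eq_iff)
    then show "z = 0 \<and> w = - (norm w *\<^sub>R e1)"
      using * z1 by (simp only: vec3_eq_iff) simp
  qed
  moreover have "(z, w) \<in> quadric_cone" using assms by (auto simp: end_nbhd_def)
  ultimately show ?thesis by (simp only: strata_iff simp_thms) blast
qed

text \<open>With the chart held fixed, \<open>Re (w $ 1)\<close> is moved linearly to -1, which
  stays negative throughout. The slice reached in this way is a graph over the nine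
  coordinates.\<close>

lemma hom_iso_end_nbhd:
  "hom_iso p (top_of_set end_nbhd) (end_nbhd \<inter> big_stratum) euclidean (- {0}) end_chart"
proof -
  let ?v = "\<lambda>u a b. (\<chi> i. if i = 1 then u else if i = 2 then a else b) :: complex^3"
  let ?p = "\<lambda>u a b c d. (?v (- (a * c + b * d) / u) a b, ?v u c d)"
  let ?g = "\<lambda>(a, b, c, d, r). ?p (Complex (-1) r) a b c d"
  let ?u = "\<lambda>t z. Complex ((1 - t) * Re z - t) (Im z)"
  let ?h = "\<lambda>(t, z, w). ?p (?u t (w $ 1)) (z $ 2) (z $ 3) (w $ 2) (w $ 3)"
  have cont_v: "continuous_on S (\<lambda>x. ?v (f x) (g x) (h x))"
    if "continuous_on S f" "continuous_on S g" "continuous_on S h" for S :: "'x::topological_space set" and f g h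
  proof (rule continuous_on_vec_lambda)
    show "continuous_on S (\<lambda>x. if i = 1 then f x else if i = 2 then g x else h x)" for i :: 3
      using that by (cases "i = 1"; cases "i = 2") auto
  qed
  have cont_p: "continuous_on S (\<lambda>x. ?p (u x) (a x) (b x) (c x) (d x))"
    if "continuous_on S u" "continuous_on S a" "continuous_on S b" "continuous_on S c" "continuous_on S d"
      "\<And>x. x \<in> S \<Longrightarrow> u x \<noteq> 0" for S :: "'x::topological_space set" and u a b c d
    by (intro continuous_on_Pair cont_v continuous_intros that ballI) (use that in auto)
  have cont_c: "continuous_on S (\<lambda>x. Complex (f x) (g x))"
    if "continuous_on S f" "continuous_on S g" for S :: "'x::topological_space set" and f g
    unfolding Complex_eq by (intro continuous_intros that)
  have p: "?p u a b c d \<in> end_nbhd \<longleftrightarrow> Re u < 0" "end_chart (?p u a b c d) = (a, b, c, d, Im u)" for u a b c d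
    by (auto simp: end_nbhd_iff end_chart_def)
  have u: "Re (?u t z) < 0" if "t \<in> {0..1}" "Re z < 0" for t z
  proof (cases "t = 1")
    case False
    then have "(1 - t) * Re z < 0" using that by (simp add: mult_pos_neg)
    then show ?thesis using that by simp
  qed simp
  have neg: "Re (w $ 1) < 0" if "(z, w) \<in> end_nbhd" for z w using that by (simp add: end_nbhd_iff)
  have cf: "continuous_on end_nbhd end_chart"
    unfolding end_chart_def case_prod_unfold by (intro continuous_intros)
  have cg: "continuous_on UNIV ?g"
    unfolding case_prod_unfold
    by (intro cont_p cont_c continuous_intros) (simp_all add: complex_eq_iff)
  have ch: "continuous_on ({0..1} \<times> end_nbhd) ?h"
    unfolding case_prod_unfold
  proof (intro cont_p cont_c)
    show "?u (fst x) (snd (snd x) $ 1) \<noteq> 0" if "x \<in> {0..1} \<times> end_nbhd" for x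
      using u[of "fst x" "snd (snd x) $ 1"] neg[of "fst (snd x)" "snd (snd x)"] that by (auto simp: complex_eq_iff)
  qed (intro continuous_intros)+
  have g1: "?g x \<in> end_nbhd" and fg: "end_chart (?g x) = x" for x
    using p by (auto simp: case_prod_unfold)
  have g2: "?g x \<in> end_nbhd \<inter> big_stratum" if "x \<in> - {0}" for x
  proof -
    have "?g x \<in> end_nbhd" "end_chart (?g x) \<noteq> 0" using g1[of x] fg[of x] that by auto
    then show ?thesis using big_stratum_end_nbhd[of "fst (?g x)" "snd (?g x)"] by auto
  qed
  have f2: "end_chart x \<in> - {0}" if "x \<in> end_nbhd \<inter> big_stratum" for x
    using that big_stratum_end_nbhd by (cases x) auto
  have h: "?h (t, x) \<in> end_nbhd" if "t \<in> {0..1}" "x \<in> end_nbhd" for t x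
  proof -
    obtain z w where x: "x = (z, w)" by (cases x)
    then have "Re (?u t (w $ 1)) < 0" using u[OF that(1)] neg[of z w] that(2) by blast
    then show ?thesis unfolding x prod.case p(1) .
  qed
  have hc: "end_chart (?h (t, x)) = end_chart x" for t x
    using p(2) by (auto simp: case_prod_unfold end_chart_def)
  have hA: "?h (t, x) \<in> end_nbhd \<inter> big_stratum" if "t \<in> {0..1}" "x \<in> end_nbhd \<inter> big_stratum" for t x
    using that h[of t x] hc[of t x] big_stratum_end_nbhd[of "fst (?h (t, x))" "snd (?h (t, x))"]
      big_stratum_end_nbhd[of "fst x" "snd x"] by auto
  have h0: "?h (0, x) = x" if "x \<in> end_nbhd" for x
    using that by (cases x) (auto simp: end_nbhd_iff vec3_eq_iff)
  have h1: "?h (1, x) = ?g (end_chart x)" if "x \<in> end_nbhd" for x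
    by (cases x) (auto simp: end_chart_def)
  have "hom_iso p (top_of_set end_nbhd) (end_nbhd \<inter> big_stratum) (top_of_set UNIV) (- {0}) end_chart"
    by (rule hom_iso_top_of_set[where g = ?g and h = ?h,
          OF cf UNIV_I f2 cg g1 g2 Int_lower1 subset_UNIV fg ch h h0 h1 hA])
  then show ?thesis by simp
qed

lemma hom_iso_end_nbhd_quadric_cone:
  "hom_iso p (top_of_set end_nbhd) (end_nbhd \<inter> big_stratum) (top_of_set quadric_cone) big_stratum id"
proof (rule hom_iso_excision_top_of_set)
  have "open {x :: (complex^3) \<times> (complex^3). Re (snd x $ 1) < 0}"
    by (intro open_Collect_less continuous_intros)
  then show "openin (top_of_set quadric_cone) end_nbhd"
    by (rule openin_quadric_coneI) (auto simp: end_nbhd_def)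
  show "openin (top_of_set quadric_cone) big_stratum"
    by (rule openin_quadric_coneI[OF open_Un[OF open_off_ray]]) (auto simp: strata_iff)
  \<comment> \<open>Points outside the big stratum have \<open>z = 0\<close> and \<open>w\<close> on
    the ray, and \<open>w \<noteq> 0\<close> makes the first coordinate negative.\<close>
  have "(0, w) \<in> end_nbhd" if "w = - (norm w *\<^sub>R e1)" "(0, w) \<in> quadric_cone" for w
  proof -
    have "w \<noteq> 0" using that(2) by (simp add: quadric_cone_iff)
    then have "Re (w $ 1) < 0" using neg_ray_nth(1)[OF that(1)] by simp
    then show ?thesis using that(2) by (simp add: end_nbhd_def)
  qed
  then show "end_nbhd \<union> big_stratum = quadric_cone"
    by (auto simp: end_nbhd_def strata_iff)
qed

lemma homology_quadric_cone_rel: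
  "hom_line 9 (top_of_set quadric_cone) big_stratum"
  "p \<noteq> 9 \<Longrightarrow> hom_trivial p (top_of_set quadric_cone) big_stratum"
proof -
  show "hom_line 9 (top_of_set quadric_cone) big_stratum"
    using homology_punctured_UNIV(1)[where 'a = "complex \<times> complex \<times> complex \<times> complex \<times> real"]
      hom_line_iso[OF hom_iso_end_nbhd, of 9] hom_line_iso[OF hom_iso_end_nbhd_quadric_cone, of 9] by simp
  show "hom_trivial p (top_of_set quadric_cone) big_stratum" if "p \<noteq> 9"
    using that homology_punctured_UNIV(2)[where 'a = "complex \<times> complex \<times> complex \<times> complex \<times> real", of p]
      hom_trivial_iso[OF hom_iso_end_nbhd, of p] hom_trivial_iso[OF hom_iso_end_nbhd_quadric_cone, of p] by simp
qed

text \<open>Degree 5 is inherited from the open stratum; the relative class of degree 4 lifts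
  because the open stratum has nothing in degree 3.\<close>

lemma homology_big_stratum:
  "hom_line 4 (top_of_set big_stratum) {base_point}"
  "hom_line 5 (top_of_set big_stratum) {base_point}"
  "p \<noteq> 4 \<Longrightarrow> p \<noteq> 5 \<Longrightarrow> hom_trivial p (top_of_set big_stratum) {base_point}"
proof -
  have sub: "{base_point} \<subseteq> open_stratum" using strata_subset by simp
  have eq: "subtopology (top_of_set big_stratum) open_stratum = top_of_set open_stratum"
    by (rule subtopology_top_of_set[OF strata_subset(2)])
  have inj: "hom_inj 3 (subtopology (top_of_set big_stratum) open_stratum) {base_point}
      (top_of_set big_stratum) {base_point} id"
    unfolding eq using homology_open_stratum(2)[of 3] by (auto simp: hom_inj_def hom_trivial_def)
  have "hom_iso 4 (top_of_set big_stratum) {base_point} (top_of_set big_stratum) open_stratum id"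
    by (rule hom_iso_quot[OF sub]) (use inj homology_open_stratum(2)[of 4] in \<open>auto simp: eq numeral_eq_Suc\<close>)
  from hom_line_iso[OF this] show "hom_line 4 (top_of_set big_stratum) {base_point}"
    using homology_big_stratum_rel(1) by simp
  have "hom_iso 5 (top_of_set open_stratum) {base_point} (top_of_set big_stratum) {base_point} id"
    using hom_iso_sub[OF sub homology_big_stratum_rel(2) homology_big_stratum_rel(2), of 5] by (simp add: eq)
  from hom_line_iso[OF this] show "hom_line 5 (top_of_set big_stratum) {base_point}"
    using homology_open_stratum(1) by simp
  show "hom_trivial p (top_of_set big_stratum) {base_point}" if "p \<noteq> 4" "p \<noteq> 5"
    by (rule hom_trivial_middle[OF sub homology_big_stratum_rel(2)])
      (use that homology_open_stratum(2) in \<open>auto simp: eq\<close>)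
qed

lemma homology_quadric_cone:
  "p \<in> {4, 5, 9} \<Longrightarrow> hom_line p (top_of_set quadric_cone) {base_point}"
  "p \<notin> {4, 5, 9} \<Longrightarrow> hom_trivial p (top_of_set quadric_cone) {base_point}"
proof -
  have sub: "{base_point} \<subseteq> big_stratum" using strata_subset by auto
  have eq: "subtopology (top_of_set quadric_cone) big_stratum = top_of_set big_stratum"
    by (rule subtopology_top_of_set[OF strata_subset(3)])
  have inj: "hom_inj 8 (subtopology (top_of_set quadric_cone) big_stratum) {base_point}
      (top_of_set quadric_cone) {base_point} id"
    unfolding eq using homology_big_stratum(3)[of 8] by (auto simp: hom_inj_def hom_trivial_def)
  have "hom_iso 9 (top_of_set quadric_cone) {base_point} (top_of_set quadric_cone) big_stratum id"
    by (rule hom_iso_quot[OF sub]) (use inj homology_big_stratum(3)[of 9] in \<open>auto simp: eq numeral_eq_Suc\<close>)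
  from hom_line_iso[OF this] have 9: "hom_line 9 (top_of_set quadric_cone) {base_point}"
    using homology_quadric_cone_rel(1) by simp
  \<comment> \<open>Both \<open>p\<close> and \<open>Suc p\<close> must avoid the relative degree 9,
    hence the bound 8.\<close>
  have "hom_iso p (top_of_set big_stratum) {base_point} (top_of_set quadric_cone) {base_point} id" if "p < 8" for p
    using hom_iso_sub[OF sub homology_quadric_cone_rel(2) homology_quadric_cone_rel(2), of p] that
    by (simp add: eq)
  from hom_line_iso[OF this[of 4]] hom_line_iso[OF this[of 5]] 9
  show "hom_line p (top_of_set quadric_cone) {base_point}" if "p \<in> {4, 5, 9}"
    using that homology_big_stratum by auto
  show "hom_trivial p (top_of_set quadric_cone) {base_point}" if "p \<notin> {4, 5, 9}"
    by (rule hom_trivial_middle[OF sub homology_quadric_cone_rel(2)])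
      (use that homology_big_stratum(3) in \<open>auto simp: eq\<close>)
qed

subsection \<open>A four-sphere carrying the homology below the cut-off degree\<close>

text \<open>The condition \<open>z $ 1 * w $ 1 = 0\<close> makes this a union of two pieces. On unit
  vectors each is a four-disc: one has \<open>w = 0\<close> and \<open>z $ 1\<close> real and
  nonnegative, the other has \<open>z $ 1 = 0\<close> and \<open>w\<close> a nonnegative multiple of
  \<open>e1\<close>. They meet in the three-sphere of \<open>C^2\<close>.\<close>

definition sphere_cone :: "((complex^3) \<times> (complex^3)) set" where
  "sphere_cone = {(z, w). (z \<noteq> 0 \<or> w \<noteq> 0) \<and> Im (z $ 1) = 0 \<and> Re (z $ 1) \<ge> 0 \<and> w $ 2 = 0 \<and> w $ 3 = 0 \<and>
     Im (w $ 1) = 0 \<and> Re (w $ 1) \<ge> 0 \<and> z $ 1 * w $ 1 = 0}"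

lemma sphere_cone_subset: "sphere_cone \<subseteq> quadric_cone"
  by (auto simp: sphere_cone_def quadric_cone_iff)

lemma base_point_in_sphere_cone: "base_point \<in> sphere_cone"
  by (auto simp: sphere_cone_def base_point_def)

text \<open>Shrinking \<open>w\<close> leaves the disc with \<open>w = 0\<close>, which then
  contracts towards \<open>e1\<close>.\<close>

lemma hom_trivial_sphere_cone_open:
  "hom_trivial p (top_of_set (sphere_cone \<inter> open_stratum)) {base_point}"
proof -
  let ?X = "sphere_cone \<inter> open_stratum" and ?V = "sphere_cone \<inter> {x. snd x = 0}"
  have V: "?V \<subseteq> ?X" using sphere_cone_subset by (auto simp: strata_iff sphere_cone_def)
  have X: "(z, w) \<in> ?X \<longleftrightarrow> (z, w) \<in> sphere_cone \<and> z \<noteq> 0" for z w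
    using sphere_cone_subset by (auto simp: strata_iff)
  have 1: "hom_trivial p (top_of_set ?X) ?V"
  proof (rule hom_trivial_top_of_set[where h = "\<lambda>(t, z, w). (z, (1 - t) *\<^sub>R w)"])
    show "(case (t, x) of (t, z, w) \<Rightarrow> (z, (1 - t) *\<^sub>R w)) \<in> ?X" if "t \<in> {0..1}" "x \<in> ?X" for t x
    proof -
      obtain z w where x: "x = (z, w)" by (cases x)
      show ?thesis using that unfolding x prod.case X by (auto simp: sphere_cone_def)
    qed
    show "(case (1, x) of (t, z, w) \<Rightarrow> (z, (1 - t) *\<^sub>R w)) \<in> ?V" if "x \<in> ?X" for x
    proof -
      obtain z w where x: "x = (z, w)" by (cases x)
      show ?thesis using that unfolding x prod.case X by (auto simp: sphere_cone_def)
    qed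
  qed (use V in \<open>auto simp: case_prod_unfold intro!: continuous_intros\<close>)
  have 2: "hom_trivial p (top_of_set ?V) {base_point}"
  proof (rule hom_trivial_top_of_set[where h = "\<lambda>(t, z, w). ((1 - t) *\<^sub>R z + t *\<^sub>R e1, 0)"])
    show "(case (t, x) of (t, z, w) \<Rightarrow> ((1 - t) *\<^sub>R z + t *\<^sub>R e1, 0)) \<in> ?V" if t: "t \<in> {0..1}" and x: "x \<in> ?V" for t x
    proof -
      obtain z where z: "x = (z, 0)" "z \<noteq> 0" "Im (z $ 1) = 0" "Re (z $ 1) \<ge> 0"
        using x by (cases x) (auto simp: sphere_cone_def)
      \<comment> \<open>The first coordinate of \<open>z\<close> has nonnegative real part, so
        adding a positive multiple of \<open>e1\<close> cannot reach 0.\<close>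
      have "(1 - t) *\<^sub>R z + t *\<^sub>R e1 \<noteq> 0"
      proof (cases "t = 0")
        case False
        then have "Re (((1 - t) *\<^sub>R z + t *\<^sub>R e1) $ 1) > 0" using t z by (simp add: add_nonneg_pos)
        then show ?thesis by (metis less_irrefl zero_index zero_complex.sel(1))
      qed (use z in simp)
      then show ?thesis using z t by (auto simp: sphere_cone_def)
    qed
  qed (use base_point_in_sphere_cone in \<open>auto simp: case_prod_unfold base_point_def scaleR_left_diff_distrib intro!: continuous_intros\<close>)
  have sub: "{base_point} \<subseteq> ?V" using base_point_in_sphere_cone by (auto simp: base_point_def)
  show ?thesis
    by (rule hom_trivial_middle[OF sub 1]) (use 2 in \<open>simp add: subtopology_top_of_set[OF V]\<close>)
qed

text \<open>On this part \<open>z $ 1 = 0\<close> and \<open>w\<close> is a positive multiple of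
  \<open>e1\<close>, so \<open>slope\<close> returns \<open>z\<close> unchanged and the chart of the
  full tube restricts to an explicit product.\<close>

lemma hom_iso_sphere_cone_tube:
  "hom_iso p (top_of_set (sphere_cone \<inter> tube)) (sphere_cone \<inter> tube \<inter> open_stratum)
     euclidean (- {0}) (\<lambda>v. (slope v $ 2, slope v $ 3))"
proof -
  let ?S = "sphere_cone \<inter> tube" and ?f = "\<lambda>v. (slope v $ 2, slope v $ 3)"
  let ?g = "\<lambda>(a, b). ((\<chi> i. if i = 2 then a else if i = 3 then b else 0) :: complex^3, e1)"
  let ?h = "\<lambda>(t, z, w). (z, (1 - t) *\<^sub>R w + t *\<^sub>R e1)"
  have S: "(z, w) \<in> ?S \<longleftrightarrow> z $ 1 = 0 \<and> w $ 2 = 0 \<and> w $ 3 = 0 \<and> Im (w $ 1) = 0 \<and> Re (w $ 1) > 0" for z w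
  proof
    assume *: "(z, w) \<in> ?S"
    have "Re (w $ 1) \<noteq> 0"
    proof
      assume "Re (w $ 1) = 0"
      then have "w = 0" using * by (simp add: sphere_cone_def vec3_eq_iff complex_eq_iff)
      then show False using * by (simp add: tube_iff)
    qed
    then show "z $ 1 = 0 \<and> w $ 2 = 0 \<and> w $ 3 = 0 \<and> Im (w $ 1) = 0 \<and> Re (w $ 1) > 0"
      using * by (auto simp: sphere_cone_def)
  next
    assume *: "z $ 1 = 0 \<and> w $ 2 = 0 \<and> w $ 3 = 0 \<and> Im (w $ 1) = 0 \<and> Re (w $ 1) > 0"
    have "Re ((- (norm w *\<^sub>R e1)) $ 1) \<le> 0" by simp
    then have "w \<noteq> - (norm w *\<^sub>R e1)" using * by (metis less_le_not_le)
    moreover have "w \<noteq> 0" using * by auto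
    ultimately show "(z, w) \<in> ?S" using * by (simp add: sphere_cone_def tube_iff pairing_def)
  qed
  have U: "(z, w) \<in> ?S \<inter> open_stratum \<longleftrightarrow> (z, w) \<in> ?S \<and> z \<noteq> 0" for z w
    using sphere_cone_subset by (auto simp: strata_iff)
  have f: "?f (z, w) = (z $ 2, z $ 3)" if "(z, w) \<in> ?S" for z w
    using that unfolding S by (simp add: slope_def)
  have cf: "continuous_on ?S ?f"
    by (intro continuous_intros continuous_on_slope) auto
  have cg: "continuous_on UNIV ?g"
  proof -
    have "continuous_on UNIV (\<lambda>x. if i = 2 then fst x else if i = 3 then snd x else 0 :: complex)" for i :: 3
      by (cases "i = 2"; cases "i = 3") (auto intro!: continuous_intros)
    then show ?thesis
      unfolding case_prod_unfold by (intro continuous_intros)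
  qed
  have ch: "continuous_on ({0..1} \<times> ?S) ?h"
    unfolding case_prod_unfold by (intro continuous_intros)
  have h: "?h (t, x) \<in> ?S" if "t \<in> {0..1}" "x \<in> ?S" for t x
  proof -
    obtain z w where x: "x = (z, w)" by (cases x)
    have "(1 - t) * Re (w $ 1) + t > 0" if "Re (w $ 1) > 0"
      using that \<open>t \<in> {0..1}\<close> by (cases "t = 1") (auto simp: add_pos_nonneg)
    then show ?thesis using that(2) unfolding x prod.case S by simp
  qed
  have hA: "?h (t, x) \<in> ?S \<inter> open_stratum" if "t \<in> {0..1}" "x \<in> ?S \<inter> open_stratum" for t x
  proof -
    obtain z w where x: "x = (z, w)" by (cases x)
    show ?thesis using that h[of t x] unfolding x prod.case U by blast
  qed
  have g: "?g x \<in> ?S" for x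
  proof -
    obtain a b where x: "x = (a, b)" by (cases x)
    show ?thesis unfolding x prod.case S by simp
  qed
  have g2: "?g x \<in> ?S \<inter> open_stratum" if "x \<in> - {0}" for x
  proof -
    obtain a b where x: "x = (a, b)" by (cases x)
    show ?thesis using g[of x] that unfolding x prod.case U by (auto simp: vec3_eq_iff zero_prod_def)
  qed
  have f2: "?f v \<in> - {0}" if "v \<in> ?S \<inter> open_stratum" for v
  proof -
    obtain z w where v: "v = (z, w)" by (cases v)
    have zw: "(z, w) \<in> ?S" "z \<noteq> 0" using that unfolding v U by blast+
    then have "z $ 1 = 0" using S by blast
    then show ?thesis using f[OF zw(1)] zw(2) unfolding v by (auto simp: zero_prod_def vec3_eq_iff)
  qed
  have fg: "?f (?g x) = x" for x
  proof -
    obtain a b where x: "x = (a, b)" by (cases x)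
    show ?thesis using f[of "fst (?g x)" "snd (?g x)"] g[of x] unfolding x prod.case fst_conv snd_conv by simp
  qed
  have h1: "?h (1, x) = ?g (?f x)" if "x \<in> ?S" for x
  proof -
    obtain z w where x: "x = (z, w)" by (cases x)
    have "z $ 1 = 0" using that unfolding x S by blast
    moreover have "?f (z, w) = (z $ 2, z $ 3)" using f that unfolding x by blast
    ultimately show ?thesis unfolding x prod.case by (simp add: vec3_eq_iff)
  qed
  have h0: "?h (0, x) = x" for x by (cases x) simp
  have "hom_iso p (top_of_set ?S) (?S \<inter> open_stratum) (top_of_set UNIV) (- {0}) ?f"
    by (rule hom_iso_top_of_set[where g = ?g and h = ?h,
          OF cf UNIV_I f2 cg g g2 Int_lower1 subset_UNIV fg ch h h0 h1 hA])
  then show ?thesis by simp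
qed

lemma hom_iso_sphere_cone_excision:
  "hom_iso p (top_of_set (sphere_cone \<inter> tube)) (sphere_cone \<inter> tube \<inter> open_stratum)
     (top_of_set sphere_cone) (sphere_cone \<inter> open_stratum) id"
proof -
  have "hom_iso p (top_of_set (sphere_cone \<inter> tube)) ((sphere_cone \<inter> tube) \<inter> (sphere_cone \<inter> open_stratum))
     (top_of_set sphere_cone) (sphere_cone \<inter> open_stratum) id"
  proof (rule hom_iso_excision_top_of_set)
    show "openin (top_of_set sphere_cone) (sphere_cone \<inter> tube)"
      by (rule openin_quadric_coneI[OF open_off_ray(1)]) (use sphere_cone_subset in \<open>auto simp: tube_def\<close>)
    show "openin (top_of_set sphere_cone) (sphere_cone \<inter> open_stratum)"
      by (rule openin_quadric_coneI[OF open_off_ray(2)]) (use sphere_cone_subset in \<open>auto simp: strata_iff\<close>)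
    have "(0, w) \<in> tube" if "(0, w) \<in> sphere_cone" for w
    proof -
      have w: "w \<noteq> 0" "Re (w $ 1) \<ge> 0" "Im (w $ 1) = 0" "w $ 2 = 0" "w $ 3 = 0"
        using that by (auto simp: sphere_cone_def)
      have "w \<noteq> - (norm w *\<^sub>R e1)"
      proof
        assume "w = - (norm w *\<^sub>R e1)"
        from neg_ray_nth(1)[OF this] have "Re (w $ 1) = - norm w" by simp
        then show False using w by simp
      qed
      then show ?thesis by (simp add: tube_iff pairing_def)
    qed
    then show "sphere_cone \<inter> tube \<union> sphere_cone \<inter> open_stratum = sphere_cone"
      using sphere_cone_subset by (auto simp: strata_iff)
  qed
  moreover have "(sphere_cone \<inter> tube) \<inter> (sphere_cone \<inter> open_stratum) = sphere_cone \<inter> tube \<inter> open_stratum"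
    by blast
  ultimately show ?thesis by simp
qed

lemma map_of_pairs_inclusion:
  "S \<subseteq> T \<Longrightarrow> A \<inter> S \<subseteq> B \<Longrightarrow> map_of_pairs (top_of_set S) A (top_of_set T) B id"
  by (auto simp: map_of_pairs_def continuous_map_subtopology_eu intro: continuous_on_id)

text \<open>The chart of the small tube is that of the large tube precomposed with the inclusion.
  Both are isomorphisms, so the inclusion is one, and excision spreads this to the sphere and to the
  quadric. The bound 8 keeps clear of the ray's degree 9.\<close>

lemma hom_iso_sphere_cone_rel:
  assumes "p < 8"
  shows "hom_iso p (top_of_set sphere_cone) (sphere_cone \<inter> open_stratum) (top_of_set quadric_cone) open_stratum id"
proof -
  let ?N = "sphere_cone \<inter> tube"
  have "hom_iso p (top_of_set ?N) (?N \<inter> open_stratum) (top_of_set tube) (tube \<inter> open_stratum) id"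
    by (rule hom_iso_cancel_left[OF hom_iso_tube]) 
      (use hom_iso_sphere_cone_tube in \<open>auto intro: map_of_pairs_inclusion\<close>)
  from hom_iso_compose[OF this hom_iso_tube_big_stratum]
  have 1: "hom_iso p (top_of_set ?N) (?N \<inter> open_stratum) (top_of_set big_stratum) open_stratum id" by simp
  have "hom_iso p (top_of_set big_stratum) open_stratum (top_of_set quadric_cone) open_stratum id"
    using hom_iso_sub[OF strata_subset(2) homology_quadric_cone_rel(2) homology_quadric_cone_rel(2), of p] assms
    by (simp add: subtopology_top_of_set[OF strata_subset(3)])
  from hom_iso_compose[OF 1 this]
  have 2: "hom_iso p (top_of_set ?N) (?N \<inter> open_stratum) (top_of_set quadric_cone) open_stratum (id \<circ> id)"
    by simp
  show ?thesis
    by (rule hom_iso_cancel_right[OF hom_iso_sphere_cone_excision 2])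
      (auto intro!: map_of_pairs_inclusion sphere_cone_subset)
qed

lemma hom_iso_sphere_cone_base:
  "hom_iso p (top_of_set sphere_cone) {base_point} (top_of_set sphere_cone) (sphere_cone \<inter> open_stratum) id"
proof (rule hom_iso_quot)
  show "{base_point} \<subseteq> sphere_cone \<inter> open_stratum"
    using base_point_in_sphere_cone strata_subset by auto
  have eq: "subtopology (top_of_set sphere_cone) (sphere_cone \<inter> open_stratum) = top_of_set (sphere_cone \<inter> open_stratum)"
    by (rule subtopology_top_of_set) auto
  show "hom_trivial p (subtopology (top_of_set sphere_cone) (sphere_cone \<inter> open_stratum)) {base_point}"
    unfolding eq by (rule hom_trivial_sphere_cone_open)
  show "hom_inj q (subtopology (top_of_set sphere_cone) (sphere_cone \<inter> open_stratum)) {base_point}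
      (top_of_set sphere_cone) {base_point} id" for q
    unfolding eq using hom_trivial_sphere_cone_open[of q] by (auto simp: hom_inj_def hom_trivial_def)
qed

lemma hom_trivial_sphere_cone:
  assumes "p \<noteq> 4"
  shows "hom_trivial p (top_of_set sphere_cone) {base_point}"
  using assms homology_punctured_UNIV(2)[where 'a = "complex \<times> complex", of p]
    hom_trivial_iso[OF hom_iso_sphere_cone_base, of p] hom_trivial_iso[OF hom_iso_sphere_cone_excision, of p]
    hom_trivial_iso[OF hom_iso_sphere_cone_tube, of p] by simp

text \<open>Passing to homology relative to the parts with \<open>z \<noteq> 0\<close> changes
  nothing here: that part is acyclic in the sphere and has no homology below degree 5 in the
  quadric.\<close>

lemma hom_iso_sphere_cone_quadric_cone:
  assumes "p < 5"
  shows "hom_iso p (top_of_set sphere_cone) {base_point} (top_of_set quadric_cone) {base_point} id"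
proof -
  have eq: "subtopology (top_of_set quadric_cone) open_stratum = top_of_set open_stratum"
    using strata_subset by (intro subtopology_top_of_set) blast
  have "hom_iso p (top_of_set quadric_cone) {base_point} (top_of_set quadric_cone) open_stratum id"
  proof (rule hom_iso_quot)
    show "{base_point} \<subseteq> open_stratum" using strata_subset by simp
    show "hom_trivial p (subtopology (top_of_set quadric_cone) open_stratum) {base_point}"
      unfolding eq using assms by (intro homology_open_stratum(2)) simp
    show "hom_inj q (subtopology (top_of_set quadric_cone) open_stratum) {base_point}
        (top_of_set quadric_cone) {base_point} id" if "p = Suc q" for q
      unfolding eq using that assms homology_open_stratum(2)[of q] by (auto simp: hom_inj_def hom_trivial_def)
  qed
  moreover have "hom_iso p (top_of_set sphere_cone) {base_point} (top_of_set quadric_cone) open_stratum (id \<circ> id)"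
    using hom_iso_compose[OF hom_iso_sphere_cone_base hom_iso_sphere_cone_rel, of p] assms by simp
  ultimately show ?thesis
    by (rule hom_iso_cancel_left) (use base_point_in_sphere_cone sphere_cone_subset in \<open>auto intro: map_of_pairs_inclusion\<close>)
qed

subsection \<open>Normalisation\<close>

text \<open>Invariance under positive scaling lets the straight path from a vector to its
  normalisation stay inside \<open>C\<close>; the unit vector \<open>x\<close> does not
  move.\<close>

lemma hom_iso_unit_sphere:
  fixes C :: "'a::real_normed_vector set"
  assumes C: "\<And>r v. r > 0 \<Longrightarrow> v \<in> C \<Longrightarrow> r *\<^sub>R v \<in> C" and "0 \<notin> C" and x: "x \<in> C" "norm x = 1"
  shows "hom_iso p (top_of_set (C \<inter> sphere 0 1)) {x} (top_of_set C) {x} id"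
proof -
  let ?f = "\<lambda>v. v /\<^sub>R norm v"
  have nz: "v \<noteq> 0" if "v \<in> C" for v using that assms(2) by auto
  have "hom_iso p (top_of_set C) {x} (top_of_set (C \<inter> sphere 0 1)) {x} ?f"
  proof (rule hom_iso_top_of_set[where g = id and h = "\<lambda>(t, v). (1 - t + t / norm v) *\<^sub>R v"])
    show "continuous_on C ?f" using nz by (intro continuous_intros) auto
    show "?f v \<in> C \<inter> sphere 0 1" if "v \<in> C" for v using nz[OF that] C[OF _ that] that by simp
    show "continuous_on ({0..1} \<times> C) (\<lambda>(t, v). (1 - t + t / norm v) *\<^sub>R v)"
      unfolding case_prod_unfold using nz by (intro continuous_intros) auto
    show "(case (t, v) of (t, v) \<Rightarrow> (1 - t + t / norm v) *\<^sub>R v) \<in> C" if "t \<in> {0..1}" "v \<in> C" for t v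
    proof -
      have "1 - t + t / norm v > 0"
        using that nz by (cases "t = 1") (auto intro: add_pos_nonneg)
      then show ?thesis using C that by simp
    qed
  qed (use x in \<open>auto simp: divide_inverse\<close>)
  moreover have "hom_iso p (top_of_set (C \<inter> sphere 0 1)) {x} (top_of_set (C \<inter> sphere 0 1)) {x} (?f \<circ> id)"
    by (rule hom_iso_ident) (use x in \<open>auto simp: map_of_pairs_def continuous_map_subtopology_eu
          intro!: continuous_intros\<close>)
  ultimately show ?thesis
    by (rule hom_iso_cancel_left) (use x in \<open>auto intro: map_of_pairs_inclusion\<close>)
qed

lemma link_eq: "SU3_implosion_link = top_of_set (quadric_cone \<inter> sphere 0 1)"
proof -
  have "(z, w) \<in> sphere 0 1 \<longleftrightarrow> (norm z)\<^sup>2 + (norm w)\<^sup>2 = 1" for z w :: "complex^3"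
    by (simp add: norm_prod_def)
  then have "{(z, w). (\<Sum>i\<in>UNIV. z $ i * w $ i) = 0 \<and> (norm z)\<^sup>2 + (norm w)\<^sup>2 = 1} =
      (quadric_cone \<inter> sphere 0 1 :: ((complex^3) \<times> (complex^3)) set)"
    by (auto simp: quadric_cone_def zero_prod_def simp del: mem_sphere mem_sphere_0)
  then show ?thesis by (simp add: SU3_implosion_link_def)
qed

lemma base_point_in_link: "base_point \<in> topspace SU3_implosion_link" "norm base_point = 1"
  using base_point_in_sphere_cone sphere_cone_subset
  by (auto simp: link_eq base_point_def norm_prod_def)

lemma quadric_cone_scale: "r > 0 \<Longrightarrow> v \<in> quadric_cone \<Longrightarrow> r *\<^sub>R v \<in> quadric_cone"
  by (cases v) (auto simp: quadric_cone_def zero_prod_def simp flip: scaleR_sum_right)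

lemma sphere_cone_scale: "r > 0 \<Longrightarrow> v \<in> sphere_cone \<Longrightarrow> r *\<^sub>R v \<in> sphere_cone"
  by (cases v) (auto simp: sphere_cone_def)

lemma hom_iso_link: "hom_iso p SU3_implosion_link {base_point} (top_of_set quadric_cone) {base_point} id"
  unfolding link_eq
  by (rule hom_iso_unit_sphere[OF quadric_cone_scale])
    (use base_point_in_link in \<open>auto simp: link_eq quadric_cone_def zero_prod_def\<close>)

lemma homology_link:
  "p \<in> {4, 5, 9} \<Longrightarrow> hom_line p SU3_implosion_link {base_point}"
  "p \<notin> {4, 5, 9} \<Longrightarrow> hom_trivial p SU3_implosion_link {base_point}"
  using homology_quadric_cone hom_line_iso[OF hom_iso_link] hom_trivial_iso[OF hom_iso_link] by blast+

lemma moore_approximation_link: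
  "moore_approximation 5 SU3_implosion_link (top_of_set (sphere_cone \<inter> sphere 0 1)) id"
proof -
  let ?Z = "top_of_set (sphere_cone \<inter> sphere 0 1)"
  have bp: "base_point \<in> topspace ?Z" using base_point_in_sphere_cone base_point_in_link(2) by auto
  have cont: "continuous_map ?Z SU3_implosion_link id"
    using sphere_cone_subset by (auto simp: link_eq continuous_map_subtopology_eu intro: continuous_on_id)
  have Z: "hom_iso p ?Z {base_point} (top_of_set sphere_cone) {base_point} id" for p
    by (rule hom_iso_unit_sphere[OF sphere_cone_scale])
      (use base_point_in_sphere_cone base_point_in_link(2) in \<open>auto simp: sphere_cone_def zero_prod_def\<close>)
  have triv: "hom_trivial p ?Z {base_point}" if "p \<noteq> 4" for p
    using hom_trivial_iso[OF Z] hom_trivial_sphere_cone[OF that] by blast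
  have "hom_iso p ?Z {base_point} SU3_implosion_link {base_point} id" if "p < 5" for p
  proof (rule hom_iso_cancel_left[OF hom_iso_link])
    show "hom_iso p ?Z {base_point} (top_of_set quadric_cone) {base_point} (id \<circ> id)"
      using hom_iso_compose[OF Z hom_iso_sphere_cone_quadric_cone[OF that]] .
    show "map_of_pairs ?Z {base_point} SU3_implosion_link {base_point} id"
      using cont by (auto simp: map_of_pairs_def)
  qed
  then have "hom_iso p ?Z {} SU3_implosion_link {} id" if "p < 5" for p
    using that triv by (intro hom_iso_absolute[OF cont bp]) auto
  moreover have "hom_trivial p ?Z {}" if "p \<ge> 5" for p
    using that triv hom_trivial_iso[OF hom_iso_rel_point[OF bp, of p]] by simp
  ultimately show ?thesis
    unfolding moore_approximation_def
    using cont by (simp add: real_homology_zero_iff real_homology_induced_iso_iff[OF cont])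
qed

section \<open>Quotient spaces and disjoint unions\<close>

lemma topspace_quotient_topology: "topspace (quotient_topology X r) = topspace X // generated_equiv X r"
proof -
  have "openin (quotient_topology X r) (topspace X // generated_equiv X r)"
    by (simp add: openin_quotient_topology Union_quotient[OF equiv_generated_equiv])
  moreover have "topspace (quotient_topology X r) \<subseteq> topspace X // generated_equiv X r"
    using openin_topspace[of "quotient_topology X r"] unfolding openin_quotient_topology by blast
  ultimately show ?thesis using openin_subset by blast
qed

lemma quotient_point_in_iff:
  assumes "U \<subseteq> topspace X // generated_equiv X r" "x \<in> topspace X"
  shows "quotient_point X r x \<in> U \<longleftrightarrow> x \<in> \<Union>U"
proof
  assume "quotient_point X r x \<in> U"
  then show "x \<in> \<Union>U"
    using equiv_class_self[OF equiv_generated_equiv assms(2)] unfolding quotient_point_def by blast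
next
  assume "x \<in> \<Union>U"
  then obtain S where S: "S \<in> U" "x \<in> S" by blast
  then obtain y where y: "S = generated_equiv X r `` {y}" "y \<in> topspace X"
    using assms(1) by (auto simp: quotient_def)
  then have "generated_equiv X r `` {y} = generated_equiv X r `` {x}"
    using S by (intro equiv_class_eq[OF equiv_generated_equiv]) simp
  then show "quotient_point X r x \<in> U" using S y by (simp add: quotient_point_def)
qed

lemma quotient_map_quotient_point: "quotient_map X (quotient_topology X r) (quotient_point X r)"
  unfolding quotient_map_def topspace_quotient_topology
proof (intro conjI allI impI)
  show "quotient_point X r ` topspace X = topspace X // generated_equiv X r"
    by (auto simp: quotient_point_def quotient_def)
  fix U assume U: "U \<subseteq> topspace X // generated_equiv X r"
  have "\<Union>U \<subseteq> topspace X"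
    using U Union_quotient[OF equiv_generated_equiv, of X r] by blast
  then have "{x \<in> topspace X. quotient_point X r x \<in> U} = \<Union>U"
    using quotient_point_in_iff[OF U] by blast
  then show "openin X {x \<in> topspace X. quotient_point X r x \<in> U} \<longleftrightarrow> openin (quotient_topology X r) U"
    using U by (simp add: openin_quotient_topology)
qed

lemma quotient_point_eqI:
  assumes "(x, y) \<in> r" "x \<in> topspace X" "y \<in> topspace X"
  shows "quotient_point X r x = quotient_point X r y"
proof -
  have "(x, y) \<in> generated_equiv X r"
    using assms by (auto simp: generated_equiv_def Let_def)
  then show ?thesis
    unfolding quotient_point_def by (rule equiv_class_eq[OF equiv_generated_equiv])
qed

text \<open>The equivalence is the reflexive and transitive closure of the symmetrised relation, so
  \<open>g\<close> stays constant along a chain of generating pairs.\<close>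

lemma quotient_point_respects:
  assumes resp: "\<And>x y. (x, y) \<in> r \<Longrightarrow> x \<in> topspace X \<Longrightarrow> y \<in> topspace X \<Longrightarrow> g x = g y"
    and eq: "quotient_point X r x = quotient_point X r y" and xy: "x \<in> topspace X" "y \<in> topspace X"
  shows "g x = g y"
proof -
  let ?s = "r \<inter> (topspace X \<times> topspace X)"
  have "(x, y) \<in> generated_equiv X r"
    using eq xy unfolding quotient_point_def by (metis eq_equiv_class equiv_generated_equiv)
  then have "(x, y) \<in> (?s \<union> ?s\<inverse>)\<^sup>*"
    by (auto simp: generated_equiv_def Let_def)
  then show ?thesis
    by (induction rule: rtrancl_induct) (use resp in fastforce)+
qed

lemma topspace_disjoint_union:
  "topspace (disjoint_union_topology X Y) = Inl ` topspace X \<union> Inr ` topspace Y"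
proof (rule antisym)
  have "Inl -` topspace (disjoint_union_topology X Y) \<subseteq> topspace X"
    "Inr -` topspace (disjoint_union_topology X Y) \<subseteq> topspace Y"
    using openin_topspace[of "disjoint_union_topology X Y"] openin_subset
    unfolding openin_disjoint_union_topology by blast+
  then show "topspace (disjoint_union_topology X Y) \<subseteq> Inl ` topspace X \<union> Inr ` topspace Y"
  proof (intro subsetI)
    fix x assume "x \<in> topspace (disjoint_union_topology X Y)"
    with \<open>Inl -` _ \<subseteq> _\<close> \<open>Inr -` _ \<subseteq> _\<close> show "x \<in> Inl ` topspace X \<union> Inr ` topspace Y"
      by (cases x) auto
  qed
  have "Inl -` (Inl ` topspace X \<union> Inr ` topspace Y) = topspace X"
    "Inr -` (Inl ` topspace X \<union> Inr ` topspace Y) = topspace Y" by auto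
  then have "openin (disjoint_union_topology X Y) (Inl ` topspace X \<union> Inr ` topspace Y)"
    by (simp add: openin_disjoint_union_topology)
  then show "Inl ` topspace X \<union> Inr ` topspace Y \<subseteq> topspace (disjoint_union_topology X Y)"
    by (rule openin_subset)
qed

lemma continuous_map_Inl: "continuous_map X (disjoint_union_topology X Y) Inl"
  unfolding continuous_map_def
proof (intro conjI allI impI)
  show "Inl \<in> topspace X \<rightarrow> topspace (disjoint_union_topology X Y)"
    by (simp add: topspace_disjoint_union)
  fix U assume "openin (disjoint_union_topology X Y) U"
  then have U: "openin X (Inl -` U)" by (simp add: openin_disjoint_union_topology)
  have "{x \<in> topspace X. Inl x \<in> U} = Inl -` U"
    using openin_subset[OF U] by blast
  then show "openin X {x \<in> topspace X. Inl x \<in> U}" using U by simp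
qed

lemma continuous_map_Inr: "continuous_map Y (disjoint_union_topology X Y) Inr"
  unfolding continuous_map_def
proof (intro conjI allI impI)
  show "Inr \<in> topspace Y \<rightarrow> topspace (disjoint_union_topology X Y)"
    by (simp add: topspace_disjoint_union)
  fix U assume "openin (disjoint_union_topology X Y) U"
  then have U: "openin Y (Inr -` U)" by (simp add: openin_disjoint_union_topology)
  have "{x \<in> topspace Y. Inr x \<in> U} = Inr -` U"
    using openin_subset[OF U] by blast
  then show "openin Y {x \<in> topspace Y. Inr x \<in> U}" using U by simp
qed

lemma continuous_map_from_disjoint_union:
  "continuous_map (disjoint_union_topology X Y) T g \<longleftrightarrow>
     continuous_map X T (g \<circ> Inl) \<and> continuous_map Y T (g \<circ> Inr)"
proof
  show "continuous_map X T (g \<circ> Inl) \<and> continuous_map Y T (g \<circ> Inr)"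
    if "continuous_map (disjoint_union_topology X Y) T g"
    using continuous_map_compose[OF continuous_map_Inl that] continuous_map_compose[OF continuous_map_Inr that] ..
  assume g: "continuous_map X T (g \<circ> Inl) \<and> continuous_map Y T (g \<circ> Inr)"
  show "continuous_map (disjoint_union_topology X Y) T g"
    unfolding continuous_map_def
  proof (intro conjI allI impI)
    show "g \<in> topspace (disjoint_union_topology X Y) \<rightarrow> topspace T"
      using g by (auto simp: topspace_disjoint_union continuous_map_def Pi_iff)
    fix U assume U: "openin T U"
    have "Inl -` {x \<in> topspace (disjoint_union_topology X Y). g x \<in> U} = {x \<in> topspace X. (g \<circ> Inl) x \<in> U}"
      "Inr -` {x \<in> topspace (disjoint_union_topology X Y). g x \<in> U} = {x \<in> topspace Y. (g \<circ> Inr) x \<in> U}"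
      by (auto simp: topspace_disjoint_union)
    then show "openin (disjoint_union_topology X Y) {x \<in> topspace (disjoint_union_topology X Y). g x \<in> U}"
      using g U unfolding openin_disjoint_union_topology by (simp add: continuous_map_def)
  qed
qed

lemma quotient_map_disjoint_union:
  assumes "quotient_map Y Y' q"
  shows "quotient_map (disjoint_union_topology X Y) (disjoint_union_topology X Y') (map_sum id q)"
  unfolding quotient_map_def
proof (intro conjI allI impI)
  have q: "q ` topspace Y = topspace Y'" using assms by (simp add: quotient_map_def)
  show "map_sum id q ` topspace (disjoint_union_topology X Y) = topspace (disjoint_union_topology X Y')"
    by (auto simp: topspace_disjoint_union image_Un image_image q[symmetric])
  fix U assume U: "U \<subseteq> topspace (disjoint_union_topology X Y')"
  let ?V = "{x \<in> topspace (disjoint_union_topology X Y). map_sum id q x \<in> U}"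
  have "Inl -` ?V = Inl -` U" "Inr -` ?V = {y \<in> topspace Y. q y \<in> Inr -` U}"
    using U by (auto simp: topspace_disjoint_union)
  moreover have "Inr -` U \<subseteq> topspace Y'" using U by (auto simp: topspace_disjoint_union)
  then have "openin Y {y \<in> topspace Y. q y \<in> Inr -` U} \<longleftrightarrow> openin Y' (Inr -` U)"
    using assms unfolding quotient_map_def by blast
  ultimately show "openin (disjoint_union_topology X Y) ?V \<longleftrightarrow> openin (disjoint_union_topology X Y') U"
    unfolding openin_disjoint_union_topology by (simp only:)
qed

text \<open>Homotopies of the two pieces before gluing are assembled here; products of open sets
  inside one summand are again open in the product with the union.\<close>

lemma continuous_map_prod_disjoint_union:
  fixes X :: "'x topology" and Y :: "'y topology"
  assumes l: "continuous_map (prod_topology T X) S (\<lambda>(t, x). g (t, Inl x))"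
    and r: "continuous_map (prod_topology T Y) S (\<lambda>(t, y). g (t, Inr y))"
  shows "continuous_map (prod_topology T (disjoint_union_topology X Y)) S g"
  unfolding continuous_map_def
proof (intro conjI allI impI)
  show "g \<in> topspace (prod_topology T (disjoint_union_topology X Y)) \<rightarrow> topspace S"
    using l r by (fastforce simp: topspace_disjoint_union continuous_map_def Pi_iff)
  fix U assume U: "openin S U"
  let ?A = "{a \<in> topspace (prod_topology T X). (\<lambda>(t, x). g (t, Inl x)) a \<in> U}"
  let ?B = "{a \<in> topspace (prod_topology T Y). (\<lambda>(t, y). g (t, Inr y)) a \<in> U}"
  have A: "openin (prod_topology T X) ?A" and B: "openin (prod_topology T Y) ?B"
    using l r U unfolding continuous_map_def by blast+
  show "openin (prod_topology T (disjoint_union_topology X Y))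
      {a \<in> topspace (prod_topology T (disjoint_union_topology X Y)). g a \<in> U}" (is "openin _ ?C")
    unfolding openin_prod_topology_alt
  proof (intro allI impI)
    fix t w assume "(t, w) \<in> ?C"
    then consider x where "w = Inl x" "(t, x) \<in> ?A" | y where "w = Inr y" "(t, y) \<in> ?B"
      by (auto simp: topspace_disjoint_union)
    then show "\<exists>P Q. openin T P \<and> openin (disjoint_union_topology X Y) Q \<and> t \<in> P \<and> w \<in> Q \<and> P \<times> Q \<subseteq> ?C"
    proof cases
      case 1
      then obtain P Q where PQ: "openin T P" "openin X Q" "t \<in> P" "x \<in> Q" "P \<times> Q \<subseteq> ?A"
        using A unfolding openin_prod_topology_alt by meson
      have "Inl -` (Inl ` Q :: ('x + 'y) set) = Q" "Inr -` (Inl ` Q :: ('x + 'y) set) = {}" by auto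
      then have "openin (disjoint_union_topology X Y) (Inl ` Q)"
        using PQ by (simp add: openin_disjoint_union_topology)
      moreover have "P \<times> Inl ` Q \<subseteq> ?C" using PQ(5) by (auto simp: topspace_disjoint_union)
      ultimately show ?thesis using PQ 1 by blast
    next
      case 2
      then obtain P Q where PQ: "openin T P" "openin Y Q" "t \<in> P" "y \<in> Q" "P \<times> Q \<subseteq> ?B"
        using B unfolding openin_prod_topology_alt by meson
      have "Inr -` (Inr ` Q :: ('x + 'y) set) = Q" "Inl -` (Inr ` Q :: ('x + 'y) set) = {}" by auto
      then have "openin (disjoint_union_topology X Y) (Inr ` Q)"
        using PQ by (simp add: openin_disjoint_union_topology)
      moreover have "P \<times> Inr ` Q \<subseteq> ?C" using PQ(5) by (auto simp: topspace_disjoint_union)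
      ultimately show ?thesis using PQ 2 by blast
    qed
  qed
qed

section \<open>Homology of intersection spaces\<close>

locale cone_attachment =
  fixes L :: "'l topology" and Z :: "'z topology" and f :: "'z \<Rightarrow> 'l" and z0 :: 'z
  assumes cont_f: "continuous_map Z L f" and z0: "z0 \<in> topspace Z"
begin

definition "cylinder = prod_topology L (top_of_set {0..<1::real})"
definition "cone_cylinder = prod_topology Z (top_of_set {0..1::real})"
definition "cone_proj = quotient_point cone_cylinder closed_cone_rel"
definition "pieces = disjoint_union_topology cylinder cone_cylinder"
definition glue_rel :: "(('l \<times> real + ('z \<times> real) set) \<times> ('l \<times> real + ('z \<times> real) set)) set" where
  "glue_rel = {(Inr (closed_cone_point Z z 0), Inl (f z, 0)) |z. z \<in> topspace Z}"
definition "glued = disjoint_union_topology cylinder (closed_cone Z)"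
text \<open>Composite of the two quotient maps, for the tip of the cone and for the gluing, so that
  all later arguments start from two plain cylinders.\<close>

definition "proj = quotient_point glued glue_rel \<circ> map_sum id cone_proj"

abbreviation "I \<equiv> intersection_space L Z f"

lemma I_eq: "I = quotient_topology glued glue_rel"
  by (simp add: intersection_space_def glued_def cylinder_def glue_rel_def)

lemma closed_cone_eq: "closed_cone Z = quotient_topology cone_cylinder closed_cone_rel"
  by (simp add: closed_cone_def cone_cylinder_def)

lemma cone_point_eq: "closed_cone_point Z z t = cone_proj (z, t)"
  by (simp add: closed_cone_point_def cone_proj_def cone_cylinder_def)

lemma quotient_map_proj: "quotient_map pieces I proj"
  unfolding proj_def
proof (rule quotient_map_compose)
  show "quotient_map pieces glued (map_sum id cone_proj)"
    unfolding pieces_def glued_def closed_cone_eq cone_proj_def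
    by (intro quotient_map_disjoint_union quotient_map_quotient_point)
  show "quotient_map glued I (quotient_point glued glue_rel)"
    unfolding I_eq by (rule quotient_map_quotient_point)
qed

lemma topspace_pieces:
  "Inl (x, t) \<in> topspace pieces \<longleftrightarrow> x \<in> topspace L \<and> 0 \<le> t \<and> t < 1"
  "Inr (z, s) \<in> topspace pieces \<longleftrightarrow> z \<in> topspace Z \<and> 0 \<le> s \<and> s \<le> 1"
  by (auto simp: pieces_def topspace_disjoint_union cylinder_def cone_cylinder_def)

lemma f_in: "z \<in> topspace Z \<Longrightarrow> f z \<in> topspace L"
  using cont_f by (auto simp: continuous_map_def)

lemma cone_proj_in: "y \<in> topspace cone_cylinder \<Longrightarrow> cone_proj y \<in> topspace (closed_cone Z)"
  unfolding closed_cone_eq cone_proj_def using quotient_map_quotient_point[of cone_cylinder closed_cone_rel]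
  by (metis image_eqI quotient_imp_surjective_map)

lemma proj_glue: "z \<in> topspace Z \<Longrightarrow> proj (Inr (z, 0)) = proj (Inl (f z, 0))"
  unfolding proj_def comp_apply map_sum.simps id_apply
proof (rule quotient_point_eqI)
  assume z: "z \<in> topspace Z"
  then show "(Inr (cone_proj (z, 0)), Inl (f z, 0)) \<in> glue_rel" by (auto simp: glue_rel_def cone_point_eq)
  show "Inr (cone_proj (z, 0)) \<in> topspace glued"
    using cone_proj_in[of "(z, 0)"] z by (simp add: glued_def topspace_disjoint_union cone_cylinder_def)
  show "Inl (f z, 0) \<in> topspace glued"
    using f_in[OF z] by (simp add: glued_def topspace_disjoint_union cylinder_def)
qed

lemma proj_tip: "z \<in> topspace Z \<Longrightarrow> z' \<in> topspace Z \<Longrightarrow> proj (Inr (z, 1)) = proj (Inr (z', 1))"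
  unfolding proj_def comp_apply map_sum.simps cone_proj_def
  by (subst quotient_point_eqI[of "(z, 1)" "(z', 1)"]) (auto simp: closed_cone_rel_def cone_cylinder_def)

text \<open>Compatibility is passed through the two quotients in turn: first over the tip, then over
  the gluing.\<close>

lemma proj_respects:
  fixes F :: "'l \<times> real \<Rightarrow> 'b" and G :: "'z \<times> real \<Rightarrow> 'b"
  assumes tip: "\<And>z z'. z \<in> topspace Z \<Longrightarrow> z' \<in> topspace Z \<Longrightarrow> G (z, 1) = G (z', 1)"
    and glue: "\<And>z. z \<in> topspace Z \<Longrightarrow> G (z, 0) = F (f z, 0)"
    and w: "w \<in> topspace pieces" "w' \<in> topspace pieces" "proj w = proj w'"
  shows "case_sum F G w = case_sum F G w'"
proof -
  \<comment> \<open>\<open>H\<close> is \<open>G\<close> descended to the closed cone by choice of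
    representatives.\<close>
  define H where "H c = G (SOME y. y \<in> topspace cone_cylinder \<and> cone_proj y = c)" for c
  have H: "H (cone_proj y) = G y" if y: "y \<in> topspace cone_cylinder" for y
  proof -
    let ?y = "SOME y'. y' \<in> topspace cone_cylinder \<and> cone_proj y' = cone_proj y"
    have y': "?y \<in> topspace cone_cylinder \<and> cone_proj ?y = cone_proj y"
      by (rule someI) (use y in simp)
    show ?thesis
      unfolding H_def
      by (rule quotient_point_respects[of closed_cone_rel cone_cylinder])
        (use y y' tip in \<open>auto simp: cone_proj_def closed_cone_rel_def cone_cylinder_def\<close>)
  qed
  have eq: "case_sum F H (map_sum id cone_proj v) = case_sum F G v" if "v \<in> topspace pieces" for v
    using that H by (auto simp: pieces_def topspace_disjoint_union)
  have in_glued: "map_sum id cone_proj v \<in> topspace glued" if "v \<in> topspace pieces" for v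
    using that cone_proj_in by (auto simp: pieces_def glued_def topspace_disjoint_union)
  have "case_sum F H (map_sum id cone_proj w) = case_sum F H (map_sum id cone_proj w')"
  proof (rule quotient_point_respects[of glue_rel glued])
    show "quotient_point glued glue_rel (map_sum id cone_proj w) = quotient_point glued glue_rel (map_sum id cone_proj w')"
      using w(3) by (simp add: proj_def)
    fix a b assume "(a, b) \<in> glue_rel"
    then obtain z where "z \<in> topspace Z" "a = Inr (cone_proj (z, 0))" "b = Inl (f z, 0)"
      by (auto simp: glue_rel_def cone_point_eq)
    then show "case_sum F H a = case_sum F H b"
      using H[of "(z, 0)"] glue[of z] by (simp add: cone_cylinder_def)
  qed (use in_glued w in auto)
  then show ?thesis using eq w by simp
qed

text \<open>A signed height that fits together at the glued end: negative on the cylinder over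
  \<open>L\<close>, positive on the cone, and 1 exactly at the tip.\<close>

definition "level = case_sum (\<lambda>(x, t). - t) (\<lambda>(z, s). s :: real)"

lemma level_simps [simp]: "level (Inl (x, t)) = - t" "level (Inr (z, s)) = s"
  by (auto simp: level_def)

lemma level_respects:
  "w \<in> topspace pieces \<Longrightarrow> w' \<in> topspace pieces \<Longrightarrow> proj w = proj w' \<Longrightarrow> level w = level w'"
  unfolding level_def by (rule proj_respects) auto

lemma continuous_map_pieces:
  "continuous_map pieces T g \<longleftrightarrow>
     continuous_map cylinder T (\<lambda>y. g (Inl y)) \<and> continuous_map cone_cylinder T (\<lambda>y. g (Inr y))"
  by (simp add: pieces_def continuous_map_from_disjoint_union comp_def)

lemma continuous_map_real_snd:
  "continuous_map (prod_topology T (top_of_set S)) euclideanreal snd"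
  using continuous_map_snd[of T "top_of_set S"] continuous_map_into_fulltopology by blast

lemma continuous_level: "continuous_map pieces euclideanreal level"
  unfolding continuous_map_pieces cylinder_def cone_cylinder_def
  by (simp add: level_def case_prod_unfold continuous_map_real_snd continuous_map_minus)

definition "height c = level (SOME w. w \<in> topspace pieces \<and> proj w = c)"

lemma height_proj [simp]: "w \<in> topspace pieces \<Longrightarrow> height (proj w) = level w"
proof -
  assume w: "w \<in> topspace pieces"
  let ?w = "SOME w'. w' \<in> topspace pieces \<and> proj w' = proj w"
  have w': "?w \<in> topspace pieces \<and> proj ?w = proj w" by (rule someI) (use w in simp)
  show ?thesis unfolding height_def by (rule level_respects) (use w w' in auto)
qed

lemma continuous_height: "continuous_map I euclideanreal height"
  using continuous_compose_quotient_map_eq[OF quotient_map_proj, of euclideanreal height]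
    continuous_map_eq[OF continuous_level, of "height \<circ> proj"] by auto

text \<open>The open cone without its base, which contracts to the tip; its partner
  \<open>lower\<close> is everything except the tip, which retracts onto \<open>L\<close>.\<close>

definition "upper = {c \<in> topspace I. 0 < height c}"
definition "lower = {c \<in> topspace I. height c < 1}"

lemma openin_strata: "openin I upper" "openin I lower"
proof -
  show "openin I upper"
    using openin_continuous_map_preimage[OF continuous_height, of "{0<..}"] by (simp add: upper_def)
  show "openin I lower"
    using openin_continuous_map_preimage[OF continuous_height, of "{..<1}"] by (simp add: lower_def)
qed

lemma proj_in_I: "w \<in> topspace pieces \<Longrightarrow> proj w \<in> topspace I"
  using quotient_map_proj by (metis image_eqI quotient_imp_surjective_map)

lemma I_cases:
  assumes "c \<in> topspace I"
  obtains w where "w \<in> topspace pieces" "c = proj w"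
  using assms quotient_map_proj by (metis imageE quotient_imp_surjective_map)

lemma proj_in_upper: "w \<in> topspace pieces \<Longrightarrow> proj w \<in> upper \<longleftrightarrow> 0 < level w"
  and proj_in_lower: "w \<in> topspace pieces \<Longrightarrow> proj w \<in> lower \<longleftrightarrow> level w < 1"
  by (auto simp: upper_def lower_def proj_in_I)

definition "over V = subtopology pieces {w \<in> topspace pieces. proj w \<in> V}"

text \<open>Restricting a quotient map over an open set gives a quotient map again, which is why the
  pieces are cut by strict inequalities on the height.\<close>

lemma quotient_map_over:
  assumes "openin I V"
  shows "quotient_map (over V) (subtopology I V) proj"
  unfolding over_def by (rule quotient_map_restriction[OF quotient_map_proj]) (use assms in auto)

lemma topspace_over: "topspace (over V) = {w \<in> topspace pieces. proj w \<in> V}"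
  by (auto simp: over_def)

lemma descend_map:
  assumes V: "openin I V" and g: "continuous_map (over V) T g"
    and resp: "\<And>w w'. w \<in> topspace (over V) \<Longrightarrow> w' \<in> topspace (over V) \<Longrightarrow> proj w = proj w' \<Longrightarrow> g w = g w'"
  shows "\<exists>h. continuous_map (subtopology I V) T h \<and> (\<forall>w\<in>topspace (over V). h (proj w) = g w)"
  by (rule quotient_map_lift_exists[OF quotient_map_over[OF V] g]) (use resp in blast)+

text \<open>The interval is locally compact and Hausdorff, so its product with a quotient map is a
  quotient map. This is what allows homotopies on an intersection space about whose topology nothing
  else is known.\<close>

lemma descend_homotopy:
  assumes V: "openin I V" and k: "continuous_map (prod_topology (top_of_set {0..1::real}) pieces) pieces k"
    and into: "\<And>t w. t \<in> {0..1} \<Longrightarrow> w \<in> topspace (over V) \<Longrightarrow> k (t, w) \<in> topspace (over V)"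
    and resp: "\<And>t w w'. t \<in> {0..1} \<Longrightarrow> w \<in> topspace (over V) \<Longrightarrow> w' \<in> topspace (over V) \<Longrightarrow>
      proj w = proj w' \<Longrightarrow> proj (k (t, w)) = proj (k (t, w'))"
  shows "\<exists>h. continuous_map (prod_topology (top_of_set {0..1::real}) (subtopology I V)) (subtopology I V) h \<and>
    (\<forall>t\<in>{0..1}. \<forall>w\<in>topspace (over V). h (t, proj w) = proj (k (t, w)))"
proof -
  let ?J = "top_of_set {0..1::real}"
  have J: "locally_compact_space ?J" "Hausdorff_space ?J"
    by (auto simp: Hausdorff_space_subtopology compact_imp_locally_compact_space compact_space_subtopology)
  have q: "quotient_map (prod_topology ?J (over V)) (prod_topology ?J (subtopology I V)) (\<lambda>(t, w). (t, proj w))"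
    using quotient_map_prod_right[OF J(1) _ quotient_map_over[OF V]] J(2) by blast
  have "prod_topology ?J (over V) = subtopology (prod_topology ?J pieces) ({0..1} \<times> {w \<in> topspace pieces. proj w \<in> V})"
    by (simp add: over_def prod_topology_subtopology(2) subtopology_subtopology)
  then have "continuous_map (prod_topology ?J (over V)) pieces k"
    using continuous_map_from_subtopology[OF k] by simp
  then have "continuous_map (prod_topology ?J (over V)) I (proj \<circ> k)"
    using quotient_imp_continuous_map[OF quotient_map_proj] by (rule continuous_map_compose)
  moreover have "proj \<circ> k \<in> topspace (prod_topology ?J (over V)) \<rightarrow> V"
    using into by (auto simp: topspace_over)
  ultimately have c: "continuous_map (prod_topology ?J (over V)) (subtopology I V) (proj \<circ> k)"
    by (simp add: continuous_map_in_subtopology)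
  have resp': "(proj \<circ> k) x = (proj \<circ> k) y"
    if "x \<in> topspace (prod_topology ?J (over V))" "y \<in> topspace (prod_topology ?J (over V))"
      and "(case x of (t, w) \<Rightarrow> (t, proj w)) = (case y of (t, w) \<Rightarrow> (t, proj w))" for x y
    using that resp[of "fst x" "snd x" "snd y"] by (cases x; cases y) simp
  show ?thesis
  proof (rule quotient_map_lift_exists[OF q c resp'])
    fix h assume h: "continuous_map (prod_topology ?J (subtopology I V)) (subtopology I V) h"
      "\<And>x. x \<in> topspace (prod_topology ?J (over V)) \<Longrightarrow> h (case x of (t, w) \<Rightarrow> (t, proj w)) = (proj \<circ> k) x"
    have "h (t, proj w) = proj (k (t, w))" if "t \<in> {0..1}" "w \<in> topspace (over V)" for t w
      using h(2)[of "(t, w)"] that by simp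
    then show ?thesis using h(1) by blast
  qed
qed

text \<open>One family of homotopies for all regions: only the second coordinate moves, by
  \<open>a\<close> on the cone and by the factor \<open>m\<close> on the cylinder, so the glued end
  of the cylinder stays fixed.\<close>

definition slide :: "(real \<Rightarrow> real \<Rightarrow> real) \<Rightarrow> (real \<Rightarrow> real) \<Rightarrow> real \<times> ('l \<times> real + 'z \<times> real) \<Rightarrow> 'l \<times> real + 'z \<times> real" where
  "slide a m = (\<lambda>(u, w). case w of Inl (x, t) \<Rightarrow> Inl (x, m u * t) | Inr (z, s) \<Rightarrow> Inr (z, a u s))"

lemma slide_simps [simp]:
  "slide a m (u, Inl (x, t)) = Inl (x, m u * t)" "slide a m (u, Inr (z, s)) = Inr (z, a u s)"
  by (auto simp: slide_def)

lemma continuous_slide: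
  assumes a: "continuous_on ({0..1} \<times> {0..1}) (\<lambda>(u, s). a u s)"
    and a01: "\<And>u s. u \<in> {0..1} \<Longrightarrow> s \<in> {0..1} \<Longrightarrow> a u s \<in> {0..1}"
    and m: "continuous_on {0..1} m" and m01: "\<And>u. u \<in> {0..1} \<Longrightarrow> m u \<in> {0..1}"
  shows "continuous_map (prod_topology (top_of_set {0..1::real}) pieces) pieces (slide a m)"
  unfolding pieces_def
proof (rule continuous_map_prod_disjoint_union)
  let ?J = "top_of_set {0..1::real}"
  have fs: "continuous_map (prod_topology ?J (prod_topology T (top_of_set S))) (top_of_set ({0..1} \<times> S))
      (\<lambda>p. (fst p, snd (snd p)))" for T :: "'x topology" and S :: "real set"
  proof -
    have "continuous_map (prod_topology ?J (prod_topology T (top_of_set S))) (prod_topology ?J (top_of_set S))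
        (\<lambda>p. (fst p, snd (snd p)))"
      by (intro continuous_map_paired[THEN iffD2] conjI continuous_map_fst continuous_map_snd_of[unfolded o_def]
          continuous_map_of_snd[unfolded o_def, THEN iffD2] disjI2 continuous_map_snd)
    then show ?thesis by (simp add: prod_topology_subtopology_eu)
  qed
  have mid: "continuous_map (prod_topology ?J (prod_topology T (top_of_set S))) T (\<lambda>p. fst (snd p))"
    for T :: "'x topology" and S :: "real set"
    by (intro continuous_map_of_snd[unfolded o_def, THEN iffD2] disjI2 continuous_map_fst)
  have "continuous_map (top_of_set ({0..1} \<times> {0..<1})) (top_of_set {0..<1}) (\<lambda>(u, t). m u * t)"
    unfolding continuous_map_subtopology_eu
  proof
    have "continuous_on ({0..1} \<times> {0..<1::real}) (\<lambda>p. m (fst p))"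
      by (rule continuous_on_compose2[OF m]) (auto intro: continuous_intros)
    then show "continuous_on ({0..1} \<times> {0..<1}) (\<lambda>(u, t). m u * t)"
      unfolding case_prod_unfold by (intro continuous_intros)
    have "m u * t < 1" if "u \<in> {0..1}" "t \<in> {0..<1}" for u t
      using mult_mono[of "m u" 1 t t] m01[OF that(1)] that(2) by simp
    then show "(\<lambda>(u, t). m u * t) \<in> {0..1} \<times> {0..<1} \<rightarrow> {0..<1}"
      using m01 by auto
  qed
  from continuous_map_compose[OF fs this]
  have "continuous_map (prod_topology ?J cylinder) cylinder (\<lambda>p. (fst (snd p), m (fst p) * snd (snd p)))"
    unfolding cylinder_def by (simp add: o_def continuous_map_paired mid)
  from continuous_map_compose[OF this continuous_map_Inl[of cylinder cone_cylinder]]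
  show "continuous_map (prod_topology ?J cylinder) (disjoint_union_topology cylinder cone_cylinder)
      (\<lambda>(t, x). slide a m (t, Inl x))"
    by (simp add: o_def case_prod_unfold slide_def)
  have "continuous_map (top_of_set ({0..1} \<times> {0..1})) (top_of_set {0..1}) (\<lambda>(u, s). a u s)"
    unfolding continuous_map_subtopology_eu using a a01 by auto
  from continuous_map_compose[OF fs this]
  have "continuous_map (prod_topology ?J cone_cylinder) cone_cylinder (\<lambda>p. (fst (snd p), a (fst p) (snd (snd p))))"
    unfolding cone_cylinder_def by (simp add: o_def continuous_map_paired mid)
  from continuous_map_compose[OF this continuous_map_Inr[of cone_cylinder cylinder]]
  show "continuous_map (prod_topology ?J cone_cylinder) (disjoint_union_topology cylinder cone_cylinder)
      (\<lambda>(t, x). slide a m (t, Inr x))"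
    by (simp add: o_def case_prod_unfold slide_def)
qed

lemma over_cases:
  assumes "w \<in> topspace (over V)"
  obtains x t where "w = Inl (x, t)" "x \<in> topspace L" "0 \<le> t" "t < 1" "proj w \<in> V"
    | z s where "w = Inr (z, s)" "z \<in> topspace Z" "0 \<le> s" "s \<le> 1" "proj w \<in> V"
proof (cases w)
  case (Inl y)
  then show ?thesis using assms that(1) by (cases y) (auto simp: topspace_over topspace_pieces)
next
  case (Inr y)
  then show ?thesis using assms that(2) by (cases y) (auto simp: topspace_over topspace_pieces)
qed

text \<open>Pushing the cone parameter to 1 fixes the tip and preserves positive height.\<close>

lemma hom_trivial_upper: "hom_trivial p (subtopology I upper) {proj (Inr (z0, 1))}"
proof -
  let ?a = "\<lambda>u s. (1 - u) * s + u" and ?m = "\<lambda>u::real. 1"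
  have a01: "?a u s \<in> {0..1}" if "u \<in> {0..1}" "s \<in> {0..1}" for u s :: real
  proof -
    have "(1 - u) * s \<le> (1 - u) * 1" using that by (intro mult_left_mono) auto
    then show ?thesis using that by auto
  qed
  have cont: "continuous_map (prod_topology (top_of_set {0..1}) pieces) pieces (slide ?a ?m)"
    by (rule continuous_slide) (use a01 in \<open>auto simp: case_prod_unfold intro!: continuous_intros\<close>)
  have over: "w \<in> topspace (over upper) \<longleftrightarrow> w \<in> topspace pieces \<and> 0 < level w" for w
    by (auto simp: topspace_over proj_in_upper)
  have into: "slide ?a ?m (u, w) \<in> topspace (over upper)" if u: "u \<in> {0..1}" and w: "w \<in> topspace (over upper)" for u w
    using w
  proof (cases rule: over_cases)
    case (1 x t)
    then show ?thesis using w by (auto simp: over)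
  next
    case (2 z s)
    then have "s > 0" using w by (simp add: over)
    then have "?a u s > 0" using u by (cases "u = 0") (auto intro: add_nonneg_pos)
    then show ?thesis using 2 a01[OF u, of s] by (auto simp: over topspace_pieces)
  qed
  have resp: "proj (slide ?a ?m (u, w)) = proj (slide ?a ?m (u, w'))"
    if u: "u \<in> {0..1::real}" and w: "w \<in> topspace (over upper)" "w' \<in> topspace (over upper)"
      and eq: "proj w = proj w'" for u w w'
  proof -
    let ?F = "\<lambda>y. proj (Inr (z0, 1))"
    \<comment> \<open>Height 0 and the cylinder do not occur in \<open>upper\<close>; the constant
      default there makes the two functions agree along the gluing.\<close>
    let ?G = "\<lambda>(z, s). if s = 0 then proj (Inr (z0, 1)) else proj (Inr (z, ?a u s))"
    have "case_sum ?F ?G w = case_sum ?F ?G w'"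
    proof (rule proj_respects[OF _ _ _ _ eq])
      show "?G (z, 1) = ?G (z', 1)" if "z \<in> topspace Z" "z' \<in> topspace Z" for z z'
        using proj_tip[OF that] by simp
    qed (use w in \<open>auto simp: over\<close>)
    moreover have "case_sum ?F ?G v = proj (slide ?a ?m (u, v))" if v: "v \<in> topspace (over upper)" for v
      using v by (cases rule: over_cases) (use v in \<open>auto simp: over\<close>)
    ultimately show ?thesis using w by simp
  qed
  obtain h where h: "continuous_map (prod_topology (top_of_set {0..1}) (subtopology I upper)) (subtopology I upper) h"
    "\<forall>t\<in>{0..1}. \<forall>w\<in>topspace (over upper). h (t, proj w) = proj (slide ?a ?m (t, w))"
    using descend_homotopy[OF openin_strata(1) cont into resp] by blast
  have tip: "proj (Inr (z0, 1)) \<in> upper" using z0 by (simp add: proj_in_upper topspace_pieces)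
  have upper_cases: "\<exists>w\<in>topspace (over upper). c = proj w" if "c \<in> topspace (subtopology I upper)" for c
    using that I_cases[of c] by (auto simp: topspace_over)
  show ?thesis
  proof (rule hom_trivial_deformation)
    show "homotopic_with (\<lambda>k. k \<in> {proj (Inr (z0, 1))} \<rightarrow> {proj (Inr (z0, 1))}) (subtopology I upper)
        (subtopology I upper) id (\<lambda>c. h (1, c))"
    proof (rule homotopic_pairsI[OF h(1)])
      show "h (0, x) = id x" if x: "x \<in> topspace (subtopology I upper)" for x
      proof -
        obtain w where w: "w \<in> topspace (over upper)" "x = proj w" using upper_cases[OF x] by blast
        have "slide ?a ?m (0, w) = w" by (cases w) auto
        then show ?thesis using h(2)[rule_format, of 0 w] w by simp
      qed
      show "h (t, x) \<in> {proj (Inr (z0, 1))}" if "t \<in> {0..1}" "x \<in> {proj (Inr (z0, 1))}" for t x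
        using h(2)[rule_format, of t "Inr (z0, 1)"] that z0 by (simp add: over topspace_pieces)
    qed (use tip openin_subset[OF openin_strata(1)] in auto)
    show "(\<lambda>c. h (1, c)) \<in> topspace (subtopology I upper) \<rightarrow> {proj (Inr (z0, 1))}"
    proof
      fix c assume "c \<in> topspace (subtopology I upper)"
      then obtain w where w: "w \<in> topspace (over upper)" "c = proj w" using upper_cases by blast
      from w(1) have "proj (slide ?a ?m (1, w)) = proj (Inr (z0, 1))"
      proof (cases rule: over_cases)
        case (2 z s)
        then show ?thesis using proj_tip[of z z0] z0 by simp
      qed (use w in \<open>auto simp: over\<close>)
      then show "h (1, c) \<in> {proj (Inr (z0, 1))}" using h(2)[rule_format, of 1 w] w by simp
    qed
  qed
qed

text \<open>The retraction that sends a cone point over \<open>z\<close> to \<open>f z\<close>; it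
  is well defined because \<open>lower\<close> omits the tip.\<close>

definition "collapse = (SOME r. continuous_map (subtopology I lower) L r \<and>
  (\<forall>w\<in>topspace (over lower). r (proj w) = case_sum fst (\<lambda>(z, s). f z) w))"

lemma over_lower: "w \<in> topspace (over lower) \<longleftrightarrow> w \<in> topspace pieces \<and> level w < 1"
  by (auto simp: topspace_over proj_in_lower)

lemma continuous_case_sum_pieces:
  assumes "continuous_map cylinder T F" "continuous_map cone_cylinder T G"
  shows "continuous_map pieces T (case_sum F G)"
  using assms by (simp add: continuous_map_pieces)

lemma collapse:
  "continuous_map (subtopology I lower) L collapse"
  "w \<in> topspace (over lower) \<Longrightarrow> collapse (proj w) = case_sum fst (\<lambda>(z, s). f z) w"
proof -
  have "continuous_map pieces L (case_sum fst (\<lambda>(z, s). f z))"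
  proof (rule continuous_case_sum_pieces)
    show "continuous_map cylinder L fst" by (simp add: cylinder_def continuous_map_fst)
    have "continuous_map cone_cylinder L (f \<circ> fst)"
      unfolding cone_cylinder_def by (rule continuous_map_compose[OF continuous_map_fst cont_f])
    then show "continuous_map cone_cylinder L (\<lambda>(z, s). f z)" by (simp add: case_prod_unfold o_def)
  qed
  then have c: "continuous_map (over lower) L (case_sum fst (\<lambda>(z, s). f z))"
    unfolding over_def by (rule continuous_map_from_subtopology)
  have "case_sum fst (\<lambda>(z, s). f z) w = case_sum fst (\<lambda>(z, s). f z) w'"
    if w: "w \<in> topspace (over lower)" "w' \<in> topspace (over lower)" "proj w = proj w'" for w w'
  proof -
    \<comment> \<open>The value at \<open>s = 1\<close>, which does not occur in
      \<open>lower\<close>, is a default that satisfies the condition at the tip.\<close>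
    let ?G = "\<lambda>(z, s). if s = 1 then f z0 else f z"
    have "case_sum fst ?G w = case_sum fst ?G w'"
      by (rule proj_respects) (use w in \<open>auto simp: over_lower\<close>)
    moreover have "case_sum fst ?G v = case_sum fst (\<lambda>(z, s). f z) v" if v: "v \<in> topspace (over lower)" for v
      using v by (cases rule: over_cases) (use v in \<open>auto simp: over_lower\<close>)
    ultimately show ?thesis using w by simp
  qed
  from someI_ex[OF descend_map[OF openin_strata(2) c this]] show "continuous_map (subtopology I lower) L collapse"
    "w \<in> topspace (over lower) \<Longrightarrow> collapse (proj w) = case_sum fst (\<lambda>(z, s). f z) w"
    unfolding collapse_def[symmetric] by blast+
qed

text \<open>The inverse embeds \<open>L\<close> at height 0, and the homotopy scales all heights to
  0 on both sides of the gluing.\<close>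

lemma hom_iso_collapse: "hom_iso p (subtopology I lower) {} L {} collapse"
proof (rule hom_iso_homotopy_equivalence)
  let ?a = "\<lambda>u s. (1 - u) * s" and ?m = "\<lambda>u::real. 1 - u"
  let ?i = "\<lambda>x. proj (Inl (x, 0))"
  show "map_of_pairs (subtopology I lower) {} L {} collapse"
    using collapse(1) by (simp add: map_of_pairs_def)
  have "continuous_map L cylinder (\<lambda>x. (x, 0))"
    unfolding cylinder_def by (simp add: continuous_map_paired)
  from continuous_map_compose[OF continuous_map_compose[OF this continuous_map_Inl[of cylinder cone_cylinder]]
      quotient_imp_continuous_map[OF quotient_map_proj, unfolded pieces_def]]
  have "continuous_map L I ?i" by (simp add: o_def)
  moreover have "?i \<in> topspace L \<rightarrow> lower" by (auto simp: proj_in_lower topspace_pieces)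
  ultimately have i: "continuous_map L (subtopology I lower) ?i" by (simp add: continuous_map_in_subtopology)
  then show "map_of_pairs L {} (subtopology I lower) {} ?i" by (simp add: map_of_pairs_def)
  have ri: "collapse (?i x) = x" if "x \<in> topspace L" for x
    using collapse(2)[of "Inl (x, 0)"] that by (simp add: over_lower topspace_pieces)
  have "homotopic_with (\<lambda>_. True) L L id (collapse \<circ> ?i)"
    by (rule homotopic_with_equal) (use ri continuous_map_compose[OF i collapse(1)] in auto)
  then show "homotopic_with (\<lambda>h. h \<in> {} \<rightarrow> {}) L L id (collapse \<circ> ?i)" by simp
  have a01: "?a u s \<in> {0..1}" if "u \<in> {0..1}" "s \<in> {0..1}" for u s :: real
    using that by (auto intro: mult_le_one)
  have cont: "continuous_map (prod_topology (top_of_set {0..1}) pieces) pieces (slide ?a ?m)"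
    by (rule continuous_slide) (use a01 in \<open>auto simp: case_prod_unfold intro!: continuous_intros\<close>)
  have small: "(1 - u) * s < 1" if "u \<in> {0..1}" "s < 1" "0 \<le> s" for u s :: real
    using mult_right_mono[of "1 - u" 1 s] that by simp
  have into: "slide ?a ?m (u, w) \<in> topspace (over lower)" if u: "u \<in> {0..1}" and w: "w \<in> topspace (over lower)" for u w
    using w
  proof (cases rule: over_cases)
    case (1 x t)
    have "0 \<le> (1 - u) * t" using 1 u by (intro mult_nonneg_nonneg) auto
    then show ?thesis
      unfolding 1(1) slide_simps over_lower topspace_pieces level_simps
      using 1 small[OF u, of t] by linarith
  next
    case (2 z s)
    then have "s < 1" using w by (simp add: over_lower)
    then show ?thesis using 2 a01[OF u, of s] small[OF u, of s] by (auto simp: over_lower topspace_pieces)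
  qed
  have resp: "proj (slide ?a ?m (u, w)) = proj (slide ?a ?m (u, w'))"
    if u: "u \<in> {0..1::real}" and w: "w \<in> topspace (over lower)" "w' \<in> topspace (over lower)"
      and eq: "proj w = proj w'" for u w w'
  proof -
    let ?F = "\<lambda>(x, t). proj (Inl (x, ?m u * t))"
    let ?G = "\<lambda>(z, s). if s = 1 then proj (Inr (z0, 1)) else proj (Inr (z, ?a u s))"
    have "case_sum ?F ?G w = case_sum ?F ?G w'"
      by (rule proj_respects[OF _ _ _ _ eq]) (use w in \<open>auto simp: over_lower proj_glue\<close>)
    moreover have "case_sum ?F ?G v = proj (slide ?a ?m (u, v))" if v: "v \<in> topspace (over lower)" for v
      using v by (cases rule: over_cases) (use v in \<open>auto simp: over_lower\<close>)
    ultimately show ?thesis using w by simp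
  qed
  obtain h where h: "continuous_map (prod_topology (top_of_set {0..1}) (subtopology I lower)) (subtopology I lower) h"
    "\<forall>t\<in>{0..1}. \<forall>w\<in>topspace (over lower). h (t, proj w) = proj (slide ?a ?m (t, w))"
    using descend_homotopy[OF openin_strata(2) cont into resp] by blast
  have lower_cases: "\<exists>w\<in>topspace (over lower). c = proj w" if "c \<in> topspace (subtopology I lower)" for c
    using that I_cases[of c] by (auto simp: topspace_over)
  show "homotopic_with (\<lambda>h. h \<in> {} \<rightarrow> {}) (subtopology I lower) (subtopology I lower) id (?i \<circ> collapse)"
  proof (rule homotopic_pairsI[OF h(1)])
    show "h (0, x) = id x" if x: "x \<in> topspace (subtopology I lower)" for x
    proof -
      obtain w where w: "w \<in> topspace (over lower)" "x = proj w" using lower_cases[OF x] by blast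
      have "slide ?a ?m (0, w) = w" by (cases w) auto
      then show ?thesis using h(2)[rule_format, of 0 w] w by simp
    qed
    show "h (1, x) = (?i \<circ> collapse) x" if x: "x \<in> topspace (subtopology I lower)" for x
    proof -
      obtain w where w: "w \<in> topspace (over lower)" "x = proj w" using lower_cases[OF x] by blast
      from w(1) have "proj (slide ?a ?m (1, w)) = ?i (case_sum fst (\<lambda>(z, s). f z) w)"
        by (cases rule: over_cases) (auto simp: proj_glue)
      then show ?thesis using h(2)[rule_format, of 1 w] w collapse(2)[OF w(1)] by simp
    qed
  qed auto
qed

end

context cone_attachment
begin

definition "middle = upper \<inter> lower"

lemma openin_middle: "openin I middle"
  unfolding middle_def by (intro openin_Int openin_strata)

lemma over_middle: "w \<in> topspace (over middle) \<longleftrightarrow> w \<in> topspace pieces \<and> 0 < level w \<and> level w < 1"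
  by (auto simp: topspace_over middle_def proj_in_lower proj_in_upper)

lemma middle_cases:
  assumes "c \<in> topspace (subtopology I middle)"
  obtains z s where "z \<in> topspace Z" "0 < s" "s < 1" "c = proj (Inr (z, s))" "Inr (z, s) \<in> topspace (over middle)"
proof -
  obtain w where w: "w \<in> topspace (over middle)" "c = proj w"
    using assms I_cases[of c] by (auto simp: topspace_over)
  from w(1) show thesis
  proof (cases rule: over_cases)
    case (2 z s)
    then show ?thesis using w that[of z s] by (simp add: over_middle)
  qed (use w in \<open>auto simp: over_middle\<close>)
qed

text \<open>Between the tip and the glued end nothing is identified, so the region is an open
  cylinder over \<open>Z\<close> that retracts onto its slice at height 1/2.\<close>

lemma hom_iso_middle: "hom_iso p Z {} (subtopology I middle) {} (\<lambda>z. proj (Inr (z, 1 / 2)))"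
proof -
  let ?j = "\<lambda>z. proj (Inr (z, 1 / 2))"
  have "continuous_map Z cone_cylinder (\<lambda>z. (z, 1 / 2))"
    unfolding cone_cylinder_def by (simp add: continuous_map_paired)
  from continuous_map_compose[OF continuous_map_compose[OF this continuous_map_Inr[of cone_cylinder cylinder]]
      quotient_imp_continuous_map[OF quotient_map_proj, unfolded pieces_def]]
  have "continuous_map Z I ?j" by (simp add: o_def)
  moreover have "?j \<in> topspace Z \<rightarrow> middle"
    by (auto simp: middle_def proj_in_upper proj_in_lower topspace_pieces)
  ultimately have j: "continuous_map Z (subtopology I middle) ?j" by (simp add: continuous_map_in_subtopology)
  have "continuous_map pieces Z (case_sum (\<lambda>_. z0) fst)"
    by (rule continuous_case_sum_pieces) (auto simp: z0 cone_cylinder_def continuous_map_fst)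
  then have c: "continuous_map (over middle) Z (case_sum (\<lambda>_. z0) fst)"
    unfolding over_def by (rule continuous_map_from_subtopology)
  have resp: "case_sum (\<lambda>_. z0) fst w = case_sum (\<lambda>_. z0) fst w'"
    if w: "w \<in> topspace (over middle)" "w' \<in> topspace (over middle)" "proj w = proj w'" for w w'
  proof -
    let ?G = "\<lambda>(z, s). if s = 0 \<or> s = 1 then z0 else z"
    have "case_sum (\<lambda>_. z0) ?G w = case_sum (\<lambda>_. z0) ?G w'"
      by (rule proj_respects) (use w in \<open>auto simp: over_middle\<close>)
    moreover have "case_sum (\<lambda>_. z0) ?G v = case_sum (\<lambda>_. z0) fst v" if v: "v \<in> topspace (over middle)" for v
      using v by (cases rule: over_cases) (use v in \<open>auto simp: over_middle\<close>)
    ultimately show ?thesis using w by simp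
  qed
  obtain r where r: "continuous_map (subtopology I middle) Z r"
    "\<forall>w\<in>topspace (over middle). r (proj w) = case_sum (\<lambda>_. z0) fst w"
    using descend_map[OF openin_middle c resp] by blast
  have rj: "r (?j z) = z" if "z \<in> topspace Z" for z
    using r(2)[rule_format, of "Inr (z, 1 / 2)"] that by (simp add: over_middle topspace_pieces)
  let ?a = "\<lambda>u s. (1 - u) * s + u / 2" and ?m = "\<lambda>u::real. 1"
  have a01: "?a u s \<in> {0..1}" if "u \<in> {0..1}" "s \<in> {0..1}" for u s :: real
  proof -
    have "(1 - u) * s \<le> (1 - u) * 1" using that by (intro mult_left_mono) auto
    moreover have "0 \<le> (1 - u) * s" using that by simp
    ultimately show ?thesis using that by auto
  qed
  have cont: "continuous_map (prod_topology (top_of_set {0..1}) pieces) pieces (slide ?a ?m)"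
    by (rule continuous_slide) (use a01 in \<open>auto simp: case_prod_unfold intro!: continuous_intros\<close>)
  have inner: "0 < ?a u s \<and> ?a u s < 1" if "u \<in> {0..1}" "0 < s" "s < 1" for u s :: real
  proof (cases "u = 0")
    case False
    have "(1 - u) * s \<le> (1 - u) * 1" using that by (intro mult_left_mono) auto
    moreover have "0 \<le> (1 - u) * s" using that by simp
    ultimately show ?thesis using that False by auto
  qed (use that in simp)
  have into: "slide ?a ?m (u, w) \<in> topspace (over middle)" if u: "u \<in> {0..1}" and w: "w \<in> topspace (over middle)" for u w
    using w
  proof (cases rule: over_cases)
    case (1 x t)
    then show ?thesis using w by (auto simp: over_middle)
  next
    case (2 z s)
    then have s: "0 < s" "s < 1" using w by (simp_all add: over_middle)
    show ?thesis
      unfolding 2(1) slide_simps over_middle topspace_pieces level_simps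
      using 2 inner[OF u s] by linarith
  qed
  have resp': "proj (slide ?a ?m (u, w)) = proj (slide ?a ?m (u, w'))"
    if u: "u \<in> {0..1::real}" and w: "w \<in> topspace (over middle)" "w' \<in> topspace (over middle)"
      and eq: "proj w = proj w'" for u w w'
  proof -
    let ?G = "\<lambda>(z, s). if s = 0 \<or> s = 1 then proj (Inr (z0, 1)) else proj (Inr (z, ?a u s))"
    have "case_sum (\<lambda>_. proj (Inr (z0, 1))) ?G w = case_sum (\<lambda>_. proj (Inr (z0, 1))) ?G w'"
      by (rule proj_respects[OF _ _ _ _ eq]) (use w in \<open>auto simp: over_middle\<close>)
    moreover have "case_sum (\<lambda>_. proj (Inr (z0, 1))) ?G v = proj (slide ?a ?m (u, v))"
      if v: "v \<in> topspace (over middle)" for v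
      using v by (cases rule: over_cases) (use v in \<open>auto simp: over_middle\<close>)
    ultimately show ?thesis using w by simp
  qed
  obtain h where h: "continuous_map (prod_topology (top_of_set {0..1}) (subtopology I middle)) (subtopology I middle) h"
    "\<forall>t\<in>{0..1}. \<forall>w\<in>topspace (over middle). h (t, proj w) = proj (slide ?a ?m (t, w))"
    using descend_homotopy[OF openin_middle cont into resp'] by blast
  show ?thesis
  proof (rule hom_iso_homotopy_equivalence)
    show "map_of_pairs Z {} (subtopology I middle) {} ?j" using j by (simp add: map_of_pairs_def)
    show "map_of_pairs (subtopology I middle) {} Z {} r" using r by (simp add: map_of_pairs_def)
    have "homotopic_with (\<lambda>_. True) Z Z id (r \<circ> ?j)"
      by (rule homotopic_with_equal) (use rj continuous_map_compose[OF j r(1)] in auto)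
    then show "homotopic_with (\<lambda>h. h \<in> {} \<rightarrow> {}) Z Z id (r \<circ> ?j)" by simp
    show "homotopic_with (\<lambda>h. h \<in> {} \<rightarrow> {}) (subtopology I middle) (subtopology I middle) id (?j \<circ> r)"
    proof (rule homotopic_pairsI[OF h(1)])
      fix c assume "c \<in> topspace (subtopology I middle)"
      then obtain z s where zs: "z \<in> topspace Z" "c = proj (Inr (z, s))" "Inr (z, s) \<in> topspace (over middle)"
        by (rule middle_cases)
      show "h (0, c) = id c" using h(2)[rule_format, of 0 "Inr (z, s)"] zs by simp
      show "h (1, c) = (?j \<circ> r) c"
        using h(2)[rule_format, of 1 "Inr (z, s)"] r(2)[rule_format, of "Inr (z, s)"] zs by simp
    qed auto
  qed
qed

lemma subtopology_middle: "subtopology (subtopology I lower) middle = subtopology I middle"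
  by (simp add: subtopology_subtopology middle_def inf.absorb2 Int_commute)

lemma map_of_pairs_middle: "map_of_pairs (subtopology I middle) {} (subtopology I lower) {} id"
  by (auto simp: map_of_pairs_def middle_def continuous_map_in_subtopology continuous_map_from_subtopology)

text \<open>The slice at height 1/2 followed by \<open>collapse\<close> is \<open>f\<close>. Both
  outer maps are isomorphisms on homology, so the inclusion behaves as \<open>f\<close>
  does.\<close>

lemma hom_iso_middle_lower:
  assumes "hom_iso p Z {} L {} f"
  shows "hom_iso p (subtopology I middle) {} (subtopology I lower) {} id"
proof (rule hom_iso_cancel_left[OF hom_iso_collapse])
  have m: "map_of_pairs (subtopology I middle) {} L {} (collapse \<circ> id)"
    using map_of_pairs_compose[OF map_of_pairs_middle] hom_iso_collapse by (auto simp: hom_iso_def)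
  have "hom_iso p Z {} L {} ((collapse \<circ> id) \<circ> (\<lambda>z. proj (Inr (z, 1 / 2))))"
  proof (rule hom_iso_cong[OF assms])
    fix z assume "z \<in> topspace Z"
    then show "f z = ((collapse \<circ> id) \<circ> (\<lambda>z. proj (Inr (z, 1 / 2)))) z"
      using collapse(2)[of "Inr (z, 1 / 2)"] by (simp add: over_lower topspace_pieces)
  qed
  from hom_iso_cancel_right[OF hom_iso_middle this m]
  show "hom_iso p (subtopology I middle) {} L {} (collapse \<circ> id)" .
qed (rule map_of_pairs_middle)

lemma hom_iso_relative:
  "hom_iso p (subtopology I lower) middle I upper id"
proof -
  have "x \<in> lower \<or> x \<in> upper" if "x \<in> topspace I" for x
    using that by (auto simp: lower_def upper_def)
  then have "lower \<union> upper = topspace I"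
    using openin_strata openin_subset by blast
  from hom_iso_excision[OF openin_strata(2,1) this] show ?thesis
    by (simp add: middle_def Int_commute)
qed

definition "tip = proj (Inr (z0, 1))"

lemma tip_in: "tip \<in> topspace I" "tip \<in> upper"
  using z0 by (auto simp: tip_def proj_in_upper topspace_pieces proj_in_I)

lemma hom_iso_tip: "hom_iso p I {tip} I upper id"
proof (rule hom_iso_quot)
  show "{tip} \<subseteq> upper" using tip_in by simp
  show "hom_trivial p (subtopology I upper) {tip}"
    unfolding tip_def by (rule hom_trivial_upper)
  show "hom_inj q (subtopology I upper) {tip} I {tip} id" for q
    using hom_trivial_upper[of q] by (auto simp: tip_def hom_inj_def hom_trivial_def)
qed

text \<open>By contractibility of \<open>upper\<close> and excision, the homology relative to the
  tip is that of the pair \<open>lower\<close> and \<open>middle\<close>, that is, of the mapping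
  cone of \<open>f\<close>.\<close>

lemma hom_tip_iff:
  "hom_trivial p I {tip} \<longleftrightarrow> hom_trivial p (subtopology I lower) middle"
  "hom_line p I {tip} \<longleftrightarrow> hom_line p (subtopology I lower) middle"
  using hom_trivial_iso[OF hom_iso_tip] hom_trivial_iso[OF hom_iso_relative]
    hom_line_iso[OF hom_iso_tip] hom_line_iso[OF hom_iso_relative] by blast+

lemma homology_below:
  assumes "hom_iso p Z {} L {} f" "\<And>q. p = Suc q \<Longrightarrow> hom_iso q Z {} L {} f"
  shows "hom_trivial p I {tip}"
  unfolding hom_tip_iff
proof (rule hom_trivial_quot)
  show "hom_surj p (subtopology (subtopology I lower) middle) {} (subtopology I lower) {} id"
    unfolding subtopology_middle using hom_iso_middle_lower[OF assms(1)] by (simp add: hom_iso_def)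
  show "hom_inj q (subtopology (subtopology I lower) middle) {} (subtopology I lower) {} id" if "p = Suc q" for q
    unfolding subtopology_middle using hom_iso_middle_lower[OF assms(2)[OF that]] by (simp add: hom_iso_def)
qed simp

text \<open>The alternative for degree \<open>q\<close> is made for the cut-off itself: at
  \<open>p = 5\<close> the degree below is not zero in \<open>Z\<close>, but there \<open>f\<close>
  is an isomorphism.\<close>

lemma homology_above:
  assumes "hom_trivial p Z {}" "\<And>q. p = Suc q \<Longrightarrow> hom_trivial q Z {} \<or> hom_iso q Z {} L {} f"
  shows "hom_trivial p I {tip} \<longleftrightarrow> hom_trivial p L {}" "hom_line p I {tip} \<longleftrightarrow> hom_line p L {}"
proof -
  have "hom_iso p (subtopology I lower) {} (subtopology I lower) middle id"
  proof (rule hom_iso_quot)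
    show "hom_trivial p (subtopology (subtopology I lower) middle) {}"
      unfolding subtopology_middle using hom_trivial_iso[OF hom_iso_middle] assms(1) by blast
    show "hom_inj q (subtopology (subtopology I lower) middle) {} (subtopology I lower) {} id" if "p = Suc q" for q
      unfolding subtopology_middle
      using assms(2)[OF that] hom_iso_middle_lower hom_trivial_iso[OF hom_iso_middle, of q]
      by (auto simp: hom_iso_def hom_inj_def hom_trivial_def)
  qed simp
  then show "hom_trivial p I {tip} \<longleftrightarrow> hom_trivial p L {}" "hom_line p I {tip} \<longleftrightarrow> hom_line p L {}"
    unfolding hom_tip_iff
    using hom_trivial_iso hom_line_iso hom_trivial_iso[OF hom_iso_collapse] hom_line_iso[OF hom_iso_collapse] by blast+
qed

end

lemma reduced_homology_intersection_space_link:
  assumes "moore_approximation 5 SU3_implosion_link Z f"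
  shows "linearly_isomorphic (reduced_real_homology j (intersection_space SU3_implosion_link Z f))
     (vector_space_of (if j \<in> {5, 9} then UNIV else {0 :: real}))"
proof -
  let ?L = SU3_implosion_link
  have f: "continuous_map Z ?L f" using assms by (simp add: moore_approximation_def)
  have low: "hom_iso i Z {} ?L {} f" if "i < 5" for i
    using assms that by (simp add: moore_approximation_def real_homology_induced_iso_iff[OF f])
  have high: "hom_trivial i Z {}" if "i \<ge> 5" for i
    using assms that by (simp add: moore_approximation_def real_homology_zero_iff)
  \<comment> \<open>A point of \<open>Z\<close> is required to name the tip. An empty
    \<open>Z\<close> would have no homology in degree 0, contrary to the isomorphism with the
    nonempty link.\<close>
  have "topspace Z \<noteq> {}"
  proof
    assume "topspace Z = {}"
    then have "real_chains 0 Z = {0}"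
      by (auto simp: real_chains_def singular_simplex_empty intro: poly_mapping_eqI)
    then have "hom_trivial 0 Z {}"
      by (simp add: hom_trivial_def rel_real_cycles_0 rel_real_boundaries_intros)
    then have "hom_trivial 0 ?L {}" using hom_trivial_iso[OF low[of 0]] by simp
    then show False using not_hom_trivial_0[OF base_point_in_link(1)] by blast
  qed
  then obtain z0 where "z0 \<in> topspace Z" by blast
  then interpret cone_attachment ?L Z f z0
    using f by unfold_locales
  have L: "hom_line j ?L {}" if "j \<in> {5, 9}"
    using homology_link(1)[of j] hom_line_iso[OF hom_iso_rel_point[OF base_point_in_link(1), of j]] that by auto
  have L0: "hom_trivial j ?L {}" if "j \<ge> 5" "j \<notin> {5, 9}"
    using homology_link(2)[of j] hom_trivial_iso[OF hom_iso_rel_point[OF base_point_in_link(1), of j]] that by auto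
  show ?thesis
  proof (cases "j < 5")
    case True
    have "hom_trivial j I {tip}"
      by (rule homology_below) (use low True in auto)
    from reduced_real_homology_zero[OF tip_in(1) this] show ?thesis using True by simp
  next
    case False
    have "hom_trivial q Z {} \<or> hom_iso q Z {} ?L {} f" for q
      using low[of q] high[of q] by linarith
    then have eq: "hom_trivial j I {tip} \<longleftrightarrow> hom_trivial j ?L {}" "hom_line j I {tip} \<longleftrightarrow> hom_line j ?L {}"
      using homology_above[of j] high[of j] False by auto
    show ?thesis
    proof (cases "j \<in> {5, 9}")
      case True
      have "hom_line j I {tip}" using eq(2) L[OF True] by blast
      from reduced_real_homology_line[OF tip_in(1) this] show ?thesis using True False by simp
    next
      case j: False
      have "hom_trivial j I {tip}" using eq(1) L0 j False by simp
      from reduced_real_homology_zero[OF tip_in(1) this] show ?thesis using j by simp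
    qed
  qed
qed

section \<open>Commutators in the special unitary group\<close>

lemma ctranspose_nth [simp]: "ctranspose A $ i $ j = cnj (A $ j $ i)"
  by (simp add: ctranspose_def)

lemma matrix_mult_nth3: "((A :: complex^3^'n) ** (B :: complex^'m^3)) $ i $ j =
    A $ i $ 1 * B $ 1 $ j + A $ i $ 2 * B $ 2 $ j + A $ i $ 3 * B $ 3 $ j"
  by (simp add: matrix_matrix_mult_def sum_3)

lemma matrix3_eq_iff: "(A :: complex^3^3) = B \<longleftrightarrow>
    A $ 1 $ 1 = B $ 1 $ 1 \<and> A $ 1 $ 2 = B $ 1 $ 2 \<and> A $ 1 $ 3 = B $ 1 $ 3 \<and>
    A $ 2 $ 1 = B $ 2 $ 1 \<and> A $ 2 $ 2 = B $ 2 $ 2 \<and> A $ 2 $ 3 = B $ 2 $ 3 \<and>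
    A $ 3 $ 1 = B $ 3 $ 1 \<and> A $ 3 $ 2 = B $ 3 $ 2 \<and> A $ 3 $ 3 = B $ 3 $ 3"
  by (simp add: vec3_eq_iff)

lemma mat_1_nth: "mat 1 $ i $ j = (if i = j then 1 else 0)"
  by (simp add: mat_def)

lemma ctranspose_mult: "ctranspose ((A :: complex^3^3) ** (B :: complex^3^3)) = ctranspose B ** ctranspose A"
  by (simp add: matrix3_eq_iff matrix_mult_nth3 mult.commute)

lemma ctranspose_ctranspose [simp]: "ctranspose (ctranspose A) = A"
  by (simp add: vec_eq_iff)

lemma det_ctranspose: "det (ctranspose (A :: complex^3^3)) = cnj (det A)"
  by (simp add: det_3 algebra_simps)

lemma SU3_simps [simp]:
  "carrier SU3 = {A. A ** ctranspose A = mat 1 \<and> det A = 1}"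
  "A \<otimes>\<^bsub>SU3\<^esub> B = A ** B" "\<one>\<^bsub>SU3\<^esub> = mat 1"
  by (simp_all add: SU3_def)

lemma SU3_ctranspose:
  assumes "A \<in> carrier SU3"
  shows "A ** ctranspose A = mat 1" "ctranspose A ** A = mat 1" "det A = 1" "ctranspose A \<in> carrier SU3"
  using assms matrix_left_right_inverse[of A "ctranspose A"] by (auto simp: det_ctranspose)

lemma SU3_cancel:
  assumes "A \<in> carrier SU3"
  shows "ctranspose A ** (A ** B) = B" "A ** (ctranspose A ** B) = B"
    and "(C ** A) ** ctranspose A = C" "(C ** ctranspose A) ** A = C"
proof -
  note A = SU3_ctranspose(1,2)[OF assms]
  show "ctranspose A ** (A ** B) = B" "A ** (ctranspose A ** B) = B"
    by (simp_all only: matrix_mul_assoc A matrix_mul_lid)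
  show "(C ** A) ** ctranspose A = C" "(C ** ctranspose A) ** A = C"
    by (simp_all only: matrix_mul_assoc[symmetric] A matrix_mul_rid)
qed

lemma SU3_mult:
  assumes "A \<in> carrier SU3" "B \<in> carrier SU3"
  shows "A ** B \<in> carrier SU3"
proof -
  have "(A ** B) ** ctranspose (A ** B) = mat 1"
    using SU3_ctranspose(1)[OF assms(1)]
    by (simp only: ctranspose_mult matrix_mul_assoc SU3_cancel(3)[OF assms(2)])
  then show ?thesis using assms by (simp add: det_mul)
qed

lemma group_SU3: "group SU3"
proof (rule groupI)
  show "\<one>\<^bsub>SU3\<^esub> \<in> carrier SU3"
    by (simp add: matrix3_eq_iff matrix_mult_nth3 mat_1_nth)
  show "x \<otimes>\<^bsub>SU3\<^esub> y \<in> carrier SU3" if "x \<in> carrier SU3" "y \<in> carrier SU3" for x y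
    using SU3_mult[OF that] by simp
  show "\<exists>y\<in>carrier SU3. y \<otimes>\<^bsub>SU3\<^esub> x = \<one>\<^bsub>SU3\<^esub>" if "x \<in> carrier SU3" for x
    by (rule bexI[OF _ SU3_ctranspose(4)[OF that]]) (simp only: SU3_simps SU3_ctranspose(2)[OF that])
qed (simp_all add: matrix_mul_assoc)

lemma inv_SU3:
  assumes A: "A \<in> carrier SU3"
  shows "inv\<^bsub>SU3\<^esub> A = ctranspose A"
proof (rule group.inv_equality[OF group_SU3 _ A SU3_ctranspose(4)[OF A]])
  show "ctranspose A \<otimes>\<^bsub>SU3\<^esub> A = \<one>\<^bsub>SU3\<^esub>"
    by (simp only: SU3_simps SU3_ctranspose(2)[OF A])
qed

lemma commutator_in_derived:
  assumes "A \<in> H" "B \<in> H" "H \<subseteq> carrier SU3"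
  shows "A ** B ** ctranspose A ** ctranspose B \<in> derived SU3 H"
proof -
  have "A ** B ** ctranspose A ** ctranspose B \<in> derived_set SU3 H"
    using assms inv_SU3[of A] inv_SU3[of B] by (force simp del: SU3_simps(1))
  then show ?thesis unfolding derived_def by (rule generate.incl)
qed

lemma derived_mult: "A \<in> derived SU3 H \<Longrightarrow> B \<in> derived SU3 H \<Longrightarrow> A ** B \<in> derived SU3 H"
  unfolding derived_def using generate.eng[of A SU3 _ B] by simp

text \<open>The unit quaternions are encoded as pairs \<open>(p, q)\<close> with \<open>|p|\<^sup>2 + |q|\<^sup>2 = 1\<close>.\<close>

definition unit_pair :: "complex \<Rightarrow> complex \<Rightarrow> bool" where
  "unit_pair p q \<longleftrightarrow> p * cnj p + q * cnj q = 1"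

text \<open>\<open>emb_mult\<close> is multiplication of quaternions \<open>p + q j\<close>. The
  commutator argument is made once and used for two block embeddings.\<close>

locale SU2_embedding =
  fixes emb :: "complex \<Rightarrow> complex \<Rightarrow> complex^3^3"
  assumes emb_mult: "emb p q ** emb r s = emb (p * r - q * cnj s) (p * s + q * cnj r)"
    and emb_ctranspose: "ctranspose (emb p q) = emb (cnj p) (- q)"
    and emb_1: "emb 1 0 = mat 1"
    and emb_det: "unit_pair p q \<Longrightarrow> det (emb p q) = 1"
begin

lemma emb_in_SU3: "unit_pair p q \<Longrightarrow> emb p q \<in> carrier SU3"
  using emb_det[of p q] by (simp add: emb_ctranspose emb_mult unit_pair_def mult.commute emb_1)

text \<open>Diagonal elements and real rotations are single commutators, and Euler angles write
  every unit quaternion as a product diagonal, rotation, diagonal.\<close>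

lemma emb_in_derived:
  assumes H: "H \<subseteq> carrier SU3" and emb: "\<And>p q. unit_pair p q \<Longrightarrow> emb p q \<in> H" and pq: "unit_pair p q"
  shows "emb p q \<in> derived SU3 H"
proof -
  have D: "emb (cis a) 0 \<in> derived SU3 H" for a
  proof -
    \<comment> \<open>Conjugation by \<open>emb 0 1\<close> inverts the diagonal elements, so the
      commutator with the half-angle element is its square.\<close>
    have "emb (cis (a / 2)) 0 ** emb 0 1 ** ctranspose (emb (cis (a / 2)) 0) ** ctranspose (emb 0 1) = emb (cis a) 0"
      by (simp add: emb_mult emb_ctranspose cis_cnj cis_mult)
    moreover have "emb (cis (a / 2)) 0 \<in> H" "emb 0 1 \<in> H"
      by (auto intro!: emb simp: unit_pair_def cis_cnj cis_mult)
    ultimately show ?thesis using commutator_in_derived[OF _ _ H] by metis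
  qed
  have R: "emb (of_real (cos b)) (of_real (sin b)) \<in> derived SU3 H" for b
  proof -
    let ?c = "complex_of_real (cos (b / 2))" and ?s = "complex_of_real (sin (b / 2))"
    have cs: "of_real (cos b) = ?c * ?c - ?s * ?s" "of_real (sin b) = 2 * ?s * ?c"
      using cos_double[of "b / 2"] sin_double[of "b / 2"] by (simp_all add: power2_eq_square)
    have one: "?c * ?c + ?s * ?s = 1"
      using sin_cos_squared_add[of "b / 2"] by (simp add: power2_eq_square flip: of_real_mult of_real_add)
    \<comment> \<open>Conjugation by the quaternion i inverts real rotations, so again the
      commutator is the square of the half-angle element.\<close>
    have "emb ?c ?s ** emb \<i> 0 ** ctranspose (emb ?c ?s) ** ctranspose (emb \<i> 0) =
        emb (of_real (cos b)) (of_real (sin b))"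
      unfolding cs by (simp add: emb_mult emb_ctranspose algebra_simps)
    moreover have "emb ?c ?s \<in> H" "emb \<i> 0 \<in> H"
      using one by (auto intro!: emb simp: unit_pair_def)
    ultimately show ?thesis using commutator_in_derived[OF _ _ H] by metis
  qed
  have "complex_of_real ((cmod p)\<^sup>2 + (cmod q)\<^sup>2) = 1"
    using pq by (simp only: of_real_add complex_norm_square unit_pair_def)
  then have "(cmod p)\<^sup>2 + (cmod q)\<^sup>2 = 1" using of_real_eq_1_iff by blast
  then obtain b where b: "cmod p = cos b" "cmod q = sin b" by (metis sincos_total_2pi)
  \<comment> \<open>The left and right diagonal factors multiply \<open>p\<close> by
    \<open>cis (a + c)\<close> and \<open>q\<close> by \<open>cis (a - c)\<close>, hence half sum
    and half difference of the arguments.\<close>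
  define a c where "a = (Arg p + Arg q) / 2" and "c = (Arg p - Arg q) / 2"
  have "p = cis (a + c) * of_real (cos b)" "q = cis (a - c) * of_real (sin b)"
    using rcis_cmod_Arg[of p] rcis_cmod_Arg[of q]
    by (simp_all add: rcis_def b a_def c_def mult.commute add_divide_distrib diff_divide_distrib)
  then have "p = cis a * cis c * of_real (cos b)" "q = cis a * cis (- c) * of_real (sin b)"
    by (simp_all add: cis_mult)
  then have "emb p q = emb (cis a) 0 ** emb (of_real (cos b)) (of_real (sin b)) ** emb (cis c) 0"
    by (simp add: emb_mult cis_cnj mult_ac)
  then show ?thesis using D R derived_mult by metis
qed

end

section \<open>The two block embeddings of SU(2) and the perfectness of SU(3)\<close>

definition emb23 :: "complex \<Rightarrow> complex \<Rightarrow> complex^3^3" where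
  "emb23 p q = (\<chi> i j. if i = 1 then if j = 1 then 1 else 0
     else if i = 2 then if j = 1 then 0 else if j = 2 then p else q
     else if j = 1 then 0 else if j = 2 then - cnj q else cnj p)"

definition emb12 :: "complex \<Rightarrow> complex \<Rightarrow> complex^3^3" where
  "emb12 p q = (\<chi> i j. if i = 3 then if j = 3 then 1 else 0
     else if i = 1 then if j = 3 then 0 else if j = 1 then p else q
     else if j = 3 then 0 else if j = 1 then - cnj q else cnj p)"

lemma emb23_nth [simp]:
  "emb23 p q $ 1 $ 1 = 1" "emb23 p q $ 1 $ 2 = 0" "emb23 p q $ 1 $ 3 = 0"
  "emb23 p q $ 2 $ 1 = 0" "emb23 p q $ 2 $ 2 = p" "emb23 p q $ 2 $ 3 = q"
  "emb23 p q $ 3 $ 1 = 0" "emb23 p q $ 3 $ 2 = - cnj q" "emb23 p q $ 3 $ 3 = cnj p"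
  by (simp_all add: emb23_def)

lemma emb12_nth [simp]:
  "emb12 p q $ 1 $ 1 = p" "emb12 p q $ 1 $ 2 = q" "emb12 p q $ 1 $ 3 = 0"
  "emb12 p q $ 2 $ 1 = - cnj q" "emb12 p q $ 2 $ 2 = cnj p" "emb12 p q $ 2 $ 3 = 0"
  "emb12 p q $ 3 $ 1 = 0" "emb12 p q $ 3 $ 2 = 0" "emb12 p q $ 3 $ 3 = 1"
  by (simp_all add: emb12_def)

interpretation emb23: SU2_embedding emb23
  by unfold_locales (simp_all add: matrix3_eq_iff matrix_mult_nth3 mat_1_nth det_3 unit_pair_def algebra_simps)

interpretation emb12: SU2_embedding emb12
  by unfold_locales (simp_all add: matrix3_eq_iff matrix_mult_nth3 mat_1_nth det_3 unit_pair_def algebra_simps)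

lemma SU3_row_products:
  assumes "A \<in> carrier SU3"
  shows "A $ i $ 1 * cnj (A $ j $ 1) + A $ i $ 2 * cnj (A $ j $ 2) + A $ i $ 3 * cnj (A $ j $ 3) = (if i = j then 1 else 0)"
  using arg_cong[OF SU3_ctranspose(1)[OF assms], of "\<lambda>M. M $ i $ j"] by (simp add: matrix_mult_nth3 mat_1_nth)

lemma SU3_column_products:
  assumes "A \<in> carrier SU3"
  shows "cnj (A $ 1 $ i) * A $ 1 $ j + cnj (A $ 2 $ i) * A $ 2 $ j + cnj (A $ 3 $ i) * A $ 3 $ j = (if i = j then 1 else 0)"
  using arg_cong[OF SU3_ctranspose(2)[OF assms], of "\<lambda>M. M $ i $ j"] by (simp add: matrix_mult_nth3 mat_1_nth)

lemma SU3_row_sq: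
  assumes "A \<in> carrier SU3"
  shows "(cmod (A $ i $ 1))\<^sup>2 + (cmod (A $ i $ 2))\<^sup>2 + (cmod (A $ i $ 3))\<^sup>2 = 1"
    "(cmod (A $ 1 $ i))\<^sup>2 + (cmod (A $ 2 $ i))\<^sup>2 + (cmod (A $ 3 $ i))\<^sup>2 = 1"
proof -
  have "complex_of_real ((cmod (A $ i $ 1))\<^sup>2 + (cmod (A $ i $ 2))\<^sup>2 + (cmod (A $ i $ 3))\<^sup>2) = 1"
    using SU3_row_products[OF assms, of i i] by (simp only: of_real_add complex_norm_square) simp
  then show "(cmod (A $ i $ 1))\<^sup>2 + (cmod (A $ i $ 2))\<^sup>2 + (cmod (A $ i $ 3))\<^sup>2 = 1" using of_real_eq_1_iff by blast
  have "complex_of_real ((cmod (A $ 1 $ i))\<^sup>2 + (cmod (A $ 2 $ i))\<^sup>2 + (cmod (A $ 3 $ i))\<^sup>2) = 1"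
    using SU3_column_products[OF assms, of i i] by (simp only: of_real_add complex_norm_square mult.commute) simp
  then show "(cmod (A $ 1 $ i))\<^sup>2 + (cmod (A $ 2 $ i))\<^sup>2 + (cmod (A $ 3 $ i))\<^sup>2 = 1" using of_real_eq_1_iff by blast
qed

lemma sum_squares_eq_1_imp:
  assumes "(cmod a)\<^sup>2 + (cmod b)\<^sup>2 + (cmod c)\<^sup>2 = 1" "cmod a = 1"
  shows "b = 0" "c = 0"
  using assms by (auto simp: sum_power2_eq_zero_iff)

text \<open>Rows and columns have norm 1, so an entry of modulus 1 leaves nothing for the
  others.\<close>

lemma SU3_fix_first:
  assumes "A \<in> carrier SU3" "A $ 1 $ 1 = 1"
  shows "A $ 1 $ 2 = 0" "A $ 1 $ 3 = 0" "A $ 2 $ 1 = 0" "A $ 3 $ 1 = 0"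
  using sum_squares_eq_1_imp[OF SU3_row_sq(1)[OF assms(1), of 1]] sum_squares_eq_1_imp[OF SU3_row_sq(2)[OF assms(1), of 1]]
    assms(2) by auto

lemma SU3_fix_third:
  assumes "A \<in> carrier SU3" "A $ 3 $ 3 = 1"
  shows "A $ 3 $ 1 = 0" "A $ 3 $ 2 = 0" "A $ 1 $ 3 = 0" "A $ 2 $ 3 = 0"
  using sum_squares_eq_1_imp[of "A $ 3 $ 3" "A $ 3 $ 1" "A $ 3 $ 2"] SU3_row_sq(1)[OF assms(1), of 3]
    sum_squares_eq_1_imp[of "A $ 3 $ 3" "A $ 1 $ 3" "A $ 2 $ 3"] SU3_row_sq(2)[OF assms(1), of 3]
    assms(2) by (auto simp: algebra_simps)

lemma SU2_entries:
  assumes pq: "p * cnj p + q * cnj q = 1" and orth: "p * cnj r + q * cnj s = 0" and det: "p * s - q * r = 1"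
  shows "s = cnj p" "r = - cnj q"
proof -
  have orth': "cnj p * r + cnj q * s = 0" using arg_cong[OF orth, of cnj] by simp
  have "s = s * (p * cnj p + q * cnj q)" using pq by simp
  also have "\<dots> = cnj p * (p * s - q * r) + q * (cnj p * r + cnj q * s)" by (simp add: algebra_simps)
  finally show "s = cnj p" using det orth' by simp
  have "r = r * (p * cnj p + q * cnj q)" using pq by simp
  also have "\<dots> = - cnj q * (p * s - q * r) + p * (cnj p * r + cnj q * s)" by (simp add: algebra_simps)
  finally show "r = - cnj q" using det orth' by simp
qed

lemma SU3_fix_first_eq:
  assumes A: "A \<in> carrier SU3" "A $ 1 $ 1 = 1"
  shows "A = emb23 (A $ 2 $ 2) (A $ 2 $ 3) \<and> unit_pair (A $ 2 $ 2) (A $ 2 $ 3)"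
proof -
  note z = SU3_fix_first[OF A]
  have pq: "A $ 2 $ 2 * cnj (A $ 2 $ 2) + A $ 2 $ 3 * cnj (A $ 2 $ 3) = 1"
    using SU3_row_products[OF A(1), of 2 2] z by simp
  have o: "A $ 2 $ 2 * cnj (A $ 3 $ 2) + A $ 2 $ 3 * cnj (A $ 3 $ 3) = 0"
    using SU3_row_products[OF A(1), of 2 3] z by simp
  have d: "A $ 2 $ 2 * A $ 3 $ 3 - A $ 2 $ 3 * A $ 3 $ 2 = 1"
    using SU3_ctranspose(3)[OF A(1)] z A(2) by (simp add: det_3)
  show ?thesis
    using SU2_entries[OF pq o d] z A(2) pq by (simp add: matrix3_eq_iff unit_pair_def)
qed

lemma SU3_fix_third_eq:
  assumes A: "A \<in> carrier SU3" "A $ 3 $ 3 = 1"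
  shows "A = emb12 (A $ 1 $ 1) (A $ 1 $ 2) \<and> unit_pair (A $ 1 $ 1) (A $ 1 $ 2)"
proof -
  note z = SU3_fix_third[OF A]
  have pq: "A $ 1 $ 1 * cnj (A $ 1 $ 1) + A $ 1 $ 2 * cnj (A $ 1 $ 2) = 1"
    using SU3_row_products[OF A(1), of 1 1] z by simp
  have o: "A $ 1 $ 1 * cnj (A $ 2 $ 1) + A $ 1 $ 2 * cnj (A $ 2 $ 2) = 0"
    using SU3_row_products[OF A(1), of 1 2] z by simp
  have d: "A $ 1 $ 1 * A $ 2 $ 2 - A $ 1 $ 2 * A $ 2 $ 1 = 1"
    using SU3_ctranspose(3)[OF A(1)] z A(2) by (simp add: det_3)
  show ?thesis
    using SU2_entries[OF pq o d] z A(2) pq by (simp add: matrix3_eq_iff unit_pair_def)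
qed

text \<open>A complex Givens rotation: the normalised conjugate of the vector \<open>(v, w)\<close>
  rotates it onto a nonnegative real multiple of the first axis.\<close>

lemma unit_pair_eliminate:
  obtains p q r where "unit_pair p q" "p * v + q * w = complex_of_real r" "r \<ge> 0" "- cnj q * v + cnj p * w = 0"
proof (cases "v = 0 \<and> w = 0")
  case True
  then show ?thesis using that[of 1 0 0] by (simp add: unit_pair_def)
next
  case False
  define n where "n = sqrt ((cmod v)\<^sup>2 + (cmod w)\<^sup>2)"
  have n: "n > 0" using False by (auto simp: n_def sum_power2_gt_zero_iff)
  have nn: "complex_of_real n * complex_of_real n = v * cnj v + w * cnj w"
  proof -
    have "n * n = (cmod v)\<^sup>2 + (cmod w)\<^sup>2" by (simp add: n_def)
    then show ?thesis by (simp only: complex_norm_square[symmetric] of_real_mult[symmetric] of_real_add[symmetric])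
  qed
  have n0: "complex_of_real n \<noteq> 0" using n by simp
  show ?thesis
  proof (rule that[of "cnj v / n" "cnj w / n" n])
    have "cnj v / n * cnj (cnj v / n) + cnj w / n * cnj (cnj w / n) = (v * cnj v + w * cnj w) / (n * n)"
      by (simp add: add_divide_distrib mult.commute)
    then show "unit_pair (cnj v / n) (cnj w / n)"
      unfolding unit_pair_def using n0 by (simp add: nn[symmetric])
    have "cnj v / n * v + cnj w / n * w = (v * cnj v + w * cnj w) / n"
      by (simp add: add_divide_distrib mult.commute)
    then show "cnj v / n * v + cnj w / n * w = n"
      using n0 by (simp add: nn[symmetric])
    show "- cnj (cnj w / n) * v + cnj (cnj v / n) * w = 0" by simp
  qed (use n in simp)
qed

text \<open>Two Givens rotations clear the first column below its top entry. What remains lies in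
  the lower SU(2) block, so every element is a product of embedded SU(2) elements, each of which is
  in the commutator subgroup.\<close>

lemma SU3_perfect: "A \<in> carrier SU3 \<Longrightarrow> A \<in> derived SU3 (carrier SU3)"
proof -
  assume A: "A \<in> carrier SU3"
  obtain p q r where pq: "unit_pair p q" "p * A $ 2 $ 1 + q * A $ 3 $ 1 = complex_of_real r"
    "- cnj q * A $ 2 $ 1 + cnj p * A $ 3 $ 1 = 0"
    by (rule unit_pair_eliminate[of "A $ 2 $ 1" "A $ 3 $ 1"])
  let ?B = "emb23 p q ** A"
  have B: "?B \<in> carrier SU3" "?B $ 3 $ 1 = 0"
    using SU3_mult[OF emb23.emb_in_SU3[OF pq(1)] A] pq(3) by (simp_all add: matrix_mult_nth3 del: SU3_simps(1))
  obtain s t r where st: "unit_pair s t" "s * ?B $ 1 $ 1 + t * ?B $ 2 $ 1 = complex_of_real r" "r \<ge> 0"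
    "- cnj t * ?B $ 1 $ 1 + cnj s * ?B $ 2 $ 1 = 0"
    by (rule unit_pair_eliminate[of "?B $ 1 $ 1" "?B $ 2 $ 1"])
  let ?C = "emb12 s t ** ?B"
  have C: "?C \<in> carrier SU3" by (rule SU3_mult[OF emb12.emb_in_SU3[OF st(1)] B(1)])
  have c1: "?C $ 2 $ 1 = 0" "?C $ 3 $ 1 = 0" "?C $ 1 $ 1 = complex_of_real r"
    using st(2,4) B(2) by (simp_all add: matrix_mult_nth3[of "emb12 s t" ?B])
  \<comment> \<open>The first column is now \<open>(r, 0, 0)\<close> and has norm 1; since
    \<open>r\<close> is nonnegative, it is 1.\<close>
  then have "r\<^sup>2 = 1" using SU3_row_sq(2)[OF C, of 1] by simp
  then have "?C $ 1 $ 1 = 1" using c1(3) st(3) by (simp add: power2_eq_1_iff)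
  then have C_eq: "?C = emb23 (?C $ 2 $ 2) (?C $ 2 $ 3)" "unit_pair (?C $ 2 $ 2) (?C $ 2 $ 3)"
    using SU3_fix_first_eq[OF C] by blast+
  let ?D = "derived SU3 (carrier SU3)"
  have e: "emb23 a b \<in> ?D" "emb12 a b \<in> ?D" if "unit_pair a b" for a b
    using that emb23.emb_in_derived[of "carrier SU3"] emb12.emb_in_derived[of "carrier SU3"]
      emb23.emb_in_SU3 emb12.emb_in_SU3 by blast+
  have inv: "unit_pair (cnj a) (- b)" if "unit_pair a b" for a b
    using that by (simp add: unit_pair_def mult.commute)
  have "A = ctranspose (emb23 p q) ** (ctranspose (emb12 s t) ** ?C)"
    using SU3_cancel(1)[OF emb23.emb_in_SU3[OF pq(1)], of A] SU3_cancel(1)[OF emb12.emb_in_SU3[OF st(1)], of ?B] by simp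
  moreover have "?C \<in> ?D" using C_eq e(1) by metis
  ultimately show ?thesis
    using derived_mult e inv pq(1) st(1)
    unfolding emb23.emb_ctranspose emb12.emb_ctranspose by metis
qed

section \<open>The universal imploded cross-section as a cone\<close>

text \<open>Proper maps to a metrizable space are closed, and closed continuous surjections are
  quotient maps. Preimages of balls suffice for properness, since compact sets are bounded.\<close>

lemma quotient_map_properI:
  fixes q :: "'a::metric_space \<Rightarrow> 'b::real_normed_vector"
  assumes q: "continuous_on S q" "q ` S = T"
    and proper: "\<And>r. \<exists>C. compact C \<and> C \<subseteq> S \<and> {x \<in> S. norm (q x) \<le> r} \<subseteq> C"
  shows "quotient_map (top_of_set S) (top_of_set T) q"
proof (rule continuous_closed_imp_quotient_map)
  have cont: "continuous_map (top_of_set S) (top_of_set T) q"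
    using q by (auto simp: continuous_map_subtopology_eu)
  then show "continuous_map (top_of_set S) (top_of_set T) q" .
  have "proper_map (top_of_set S) (top_of_set T) q"
  proof (rule compact_imp_proper_map)
    show "k_space (top_of_set T)"
      by (intro metrizable_imp_k_space metrizable_space_subtopology metrizable_space_euclidean)
    show "kc_space (top_of_set T)"
      by (intro Hausdorff_imp_kc_space Hausdorff_space_subtopology Hausdorff_space_euclidean)
    fix K assume "compactin (top_of_set T) K"
    then have K: "compact K" "K \<subseteq> T" by (auto simp: compactin_subtopology)
    then obtain r where r: "\<And>y. y \<in> K \<Longrightarrow> norm y \<le> r" using compact_imp_bounded bounded_iff by metis
    obtain C where C: "compact C" "C \<subseteq> S" "{x \<in> S. norm (q x) \<le> r} \<subseteq> C" using proper by blast
    have "{x \<in> S. q x \<in> K} = C \<inter> q -` K" using C r by auto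
    moreover have "compact (C \<inter> q -` K)"
      using continuous_closedin_preimage[OF continuous_on_subset[OF q(1) C(2)] compact_imp_closed[OF K(1)]]
        closedin_compact[OF C(1)] by blast
    ultimately show "compactin (top_of_set S) {x \<in> topspace (top_of_set S). q x \<in> K}"
      using C(2) by (auto simp: compactin_subtopology)
  qed (use cont q in auto)
  then show "closed_map (top_of_set S) (top_of_set T) q" by (rule proper_imp_closed_map)
qed (use q in auto)

lemma quotient_topology_homeomorphic:
  assumes q: "quotient_map X Y q"
    and iff: "\<And>x y. x \<in> topspace X \<Longrightarrow> y \<in> topspace X \<Longrightarrow>
      quotient_point X r x = quotient_point X r y \<longleftrightarrow> q x = q y"
  shows "quotient_topology X r homeomorphic_space Y"
proof -
  let ?p = "quotient_point X r" and ?Q = "quotient_topology X r"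
  have p: "quotient_map X ?Q ?p" by (rule quotient_map_quotient_point)
  have "\<exists>g. continuous_map ?Q Y g \<and> (\<forall>x\<in>topspace X. g (?p x) = q x)"
    by (rule quotient_map_lift_exists[OF p quotient_imp_continuous_map[OF q]]) (use iff in blast)+
  then obtain g where g: "continuous_map ?Q Y g" "\<forall>x\<in>topspace X. g (?p x) = q x" by blast
  have "\<exists>h. continuous_map Y ?Q h \<and> (\<forall>x\<in>topspace X. h (q x) = ?p x)"
    by (rule quotient_map_lift_exists[OF q quotient_imp_continuous_map[OF p]]) (use iff in blast)+
  then obtain h where h: "continuous_map Y ?Q h" "\<forall>x\<in>topspace X. h (q x) = ?p x" by blast
  have "homeomorphic_maps ?Q Y g h"
    unfolding homeomorphic_maps_def
  proof (intro conjI ballI g(1) h(1))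
    fix c assume "c \<in> topspace ?Q"
    then obtain x where "x \<in> topspace X" "c = ?p x" using quotient_imp_surjective_map[OF p] by blast
    then show "h (g c) = c" using g h by simp
  next
    fix y assume "y \<in> topspace Y"
    then obtain x where "x \<in> topspace X" "y = q x" using quotient_imp_surjective_map[OF q] by blast
    then show "g (h y) = y" using g h by simp
  qed
  then show ?thesis using homeomorphic_maps_imp_homeomorphic_space by blast
qed

section \<open>The open cone on the link is the quadric with its vertex\<close>

definition quadric :: "((complex^3) \<times> (complex^3)) set" where
  "quadric = {(z, w). pairing z w = 0}"

lemma quadric_alt: "quadric = insert 0 quadric_cone"
  by (auto simp: quadric_def quadric_cone_iff pairing_def zero_prod_def)

lemma closed_quadric: "closed quadric"
proof -
  have "quadric = {x. pairing (fst x) (snd x) = 0}" by (auto simp: quadric_def)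
  moreover have "closed {x :: (complex^3) \<times> (complex^3). pairing (fst x) (snd x) = 0}"
    by (intro closed_Collect_eq continuous_intros)
  ultimately show ?thesis by simp
qed

lemma compact_link: "compact (quadric_cone \<inter> sphere 0 1)"
proof -
  have "quadric_cone \<inter> sphere 0 1 = quadric \<inter> sphere 0 1"
    by (auto simp: quadric_alt)
  then show ?thesis using closed_quadric by (simp add: closed_Int_compact)
qed

lemma open_cone_homeomorphic_quadric: "open_cone SU3_implosion_link homeomorphic_space top_of_set quadric"
proof -
  let ?L = "quadric_cone \<inter> sphere 0 1 :: ((complex^3) \<times> (complex^3)) set" and ?S = "{0<..1::real}"
  \<comment> \<open>The cone point sits at parameter 1, and \<open>- ln\<close> carries the
    parameters from 1 down to 0 to radii from 0 to infinity.\<close>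
  let ?q = "\<lambda>(u, y). (- ln u) *\<^sub>R (y :: (complex^3) \<times> (complex^3))"
  let ?r = "{((1, y), (1, y')) |y y'. True} :: ((real \<times> (complex^3) \<times> (complex^3)) \<times> (real \<times> (complex^3) \<times> (complex^3))) set"
  have top: "prod_topology (top_of_set ?S) SU3_implosion_link = top_of_set (?S \<times> ?L)"
    by (simp add: link_eq prod_topology_subtopology_eu)
  have scale: "c *\<^sub>R v \<in> quadric" if "v \<in> quadric" for c v
    using that by (cases v) (auto simp: quadric_def pairing_def algebra_simps simp flip: scaleR_add_right)
  have q: "quotient_map (top_of_set (?S \<times> ?L)) (top_of_set quadric) ?q"
  proof (rule quotient_map_properI)
    show "continuous_on (?S \<times> ?L) ?q"
      unfolding case_prod_unfold by (intro continuous_intros) auto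
    show "?q ` (?S \<times> ?L) = quadric"
    proof (intro equalityI subsetI)
      fix v assume v: "v \<in> quadric"
      show "v \<in> ?q ` (?S \<times> ?L)"
      proof (cases "v = 0")
        case True
        then show ?thesis
          using base_point_in_link by (intro image_eqI[of _ _ "(1, base_point)"]) (auto simp: link_eq)
      next
        case False
        then have "v /\<^sub>R norm v \<in> ?L"
          using v quadric_cone_scale[of "1 / norm v" v] by (auto simp: quadric_alt divide_inverse)
        then show ?thesis
          using False by (intro image_eqI[of _ _ "(exp (- norm v), v /\<^sub>R norm v)"]) auto
      qed
    next
      fix v assume "v \<in> ?q ` (?S \<times> ?L)"
      then obtain p where "p \<in> ?S \<times> ?L" "v = ?q p" by blast
      then have "snd p \<in> quadric" "v = (- ln (fst p)) *\<^sub>R snd p"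
        by (auto simp: quadric_alt)
      then show "v \<in> quadric" using scale[of "snd p" "- ln (fst p)"] by simp
    qed
    show "\<exists>C. compact C \<and> C \<subseteq> ?S \<times> ?L \<and> {x \<in> ?S \<times> ?L. norm (?q x) \<le> r} \<subseteq> C" for r
    proof (intro exI conjI)
      show "compact ({exp (- r)..1} \<times> ?L)" by (intro compact_Times compact_link compact_Icc)
      show "{exp (- r)..1} \<times> ?L \<subseteq> ?S \<times> ?L" by (auto intro: less_le_trans[OF exp_gt_zero])
      have "exp (- r) \<le> u" if "0 < u" "\<bar>ln u\<bar> \<le> r" for u
        using that exp_le_cancel_iff[of "- r" "ln u"] by (simp add: abs_le_iff)
      moreover have "norm (?q x) = \<bar>ln (fst x)\<bar>" if "x \<in> ?S \<times> ?L" for x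
        unfolding case_prod_unfold norm_scaleR using that by auto
      ultimately have "exp (- r) \<le> fst x" if "x \<in> ?S \<times> ?L" "norm (?q x) \<le> r" for x
        using that by (metis greaterThanAtMost_iff mem_Times_iff)
      then show "{x \<in> ?S \<times> ?L. norm (?q x) \<le> r} \<subseteq> {exp (- r)..1} \<times> ?L"
        by fastforce
    qed
  qed
  show ?thesis
    unfolding open_cone_def top
  proof (rule quotient_topology_homeomorphic[OF q])
    fix x y assume xy: "x \<in> topspace (top_of_set (?S \<times> ?L))" "y \<in> topspace (top_of_set (?S \<times> ?L))"
    show "quotient_point (top_of_set (?S \<times> ?L)) ?r x = quotient_point (top_of_set (?S \<times> ?L)) ?r y \<longleftrightarrow> ?q x = ?q y"
    proof
      assume "quotient_point (top_of_set (?S \<times> ?L)) ?r x = quotient_point (top_of_set (?S \<times> ?L)) ?r y"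
      from quotient_point_respects[OF _ this xy, of ?q] show "?q x = ?q y" by auto
    next
      obtain u v u' v' where eq: "x = (u, v)" "y = (u', v')" by (cases x; cases y) blast
      assume qq: "?q x = ?q y"
      have u: "0 < u" "u \<le> 1" "0 < u'" "u' \<le> 1" "norm v = 1" "norm v' = 1" using xy eq by auto
      have "norm (?q x) = norm (?q y)" using qq by simp
      then have "ln u = ln u'" using u by (simp add: eq)
      then have uu: "u = u'" using u by simp
      show "quotient_point (top_of_set (?S \<times> ?L)) ?r x = quotient_point (top_of_set (?S \<times> ?L)) ?r y"
      proof (cases "u = 1")
        case True
        then show ?thesis using xy uu eq by (intro quotient_point_eqI) auto
      next
        case False
        then have "v = v'" using qq u uu by (simp add: eq)
        then show ?thesis using uu eq by simp
      qed
    qed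
  qed
qed

section \<open>The map from the implosion domain to the quadric\<close>

definition diag :: "real^3 \<Rightarrow> complex^3^3" where
  "diag a = (\<chi> i j. if i = j then \<i> * complex_of_real (a $ i) else 0)"

definition chamber :: "(real^3) set" where
  "chamber = {a. a $ 1 \<ge> a $ 2 \<and> a $ 2 \<ge> a $ 3 \<and> a $ 1 + a $ 2 + a $ 3 = 0}"

lemma diag_nth: "diag a $ i $ j = (if i = j then \<i> * complex_of_real (a $ i) else 0)"
  by (simp add: diag_def)

lemma su3_chamber_eq: "su3_chamber = diag ` chamber"
  by (auto simp: su3_chamber_def diag_def chamber_def)

definition implosion_domain :: "((complex^3^3) \<times> (complex^3^3)) set" where
  "implosion_domain = (carrier SU3 \<times> su3) \<inter> cotangent_SU3_moment -` su3_chamber"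

lemma moment_eq: "cotangent_SU3_moment (k, A) = k ** A ** ctranspose k"
  by (simp add: cotangent_SU3_moment_def su3_coadjoint_def)

text \<open>In the left trivialisation the moment is the conjugate of \<open>A\<close> by
  \<open>k\<close>, so \<open>A\<close> is recovered from \<open>k\<close> and the moment; this
  parametrises the domain by group elements and chamber points.\<close>

lemma conjugate_in_implosion_domain:
  assumes k: "k \<in> carrier SU3" and a: "a \<in> chamber"
  shows "(k, ctranspose k ** diag a ** k) \<in> implosion_domain"
    "cotangent_SU3_moment (k, ctranspose k ** diag a ** k) = diag a"
proof -
  show m: "cotangent_SU3_moment (k, ctranspose k ** diag a ** k) = diag a"
    by (simp only: moment_eq matrix_mul_assoc[symmetric] SU3_cancel[OF k]) 
      (simp only: SU3_ctranspose(1)[OF k] matrix_mul_rid)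
  have "trace (ctranspose k ** diag a ** k) = trace (k ** (ctranspose k ** diag a))"
    by (rule trace_mul_sym)
  also have "\<dots> = trace (diag a)" by (simp only: SU3_cancel[OF k])
  also have "\<dots> = \<i> * complex_of_real (a $ 1 + a $ 2 + a $ 3)"
    by (simp add: trace_def sum_3 diag_nth algebra_simps)
  also have "a $ 1 + a $ 2 + a $ 3 = 0" using a by (simp add: chamber_def)
  finally have tr: "trace (ctranspose k ** diag a ** k) = 0" by simp
  have neg: "P ** (- D) ** Q = - (P ** D ** Q)" for P D Q :: "complex^3^3"
    by (simp add: matrix3_eq_iff matrix_mult_nth3 algebra_simps)
  have "ctranspose (diag a) = - diag a"
    by (simp add: vec_eq_iff diag_nth)
  then have "ctranspose (ctranspose k ** diag a ** k) = - (ctranspose k ** diag a ** k)"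
    using neg by (simp add: ctranspose_mult matrix_mul_assoc)
  then show "(k, ctranspose k ** diag a ** k) \<in> implosion_domain"
    using k tr m a by (auto simp: implosion_domain_def su3_def su3_chamber_eq)
qed

lemma implosion_domain_cases:
  assumes "m \<in> implosion_domain"
  obtains k a where "k \<in> carrier SU3" "a \<in> chamber" "m = (k, ctranspose k ** diag a ** k)"
    "cotangent_SU3_moment m = diag a"
proof -
  obtain k A where m: "m = (k, A)" by (cases m)
  have k: "k \<in> carrier SU3" using assms by (auto simp: implosion_domain_def m)
  obtain a where a: "a \<in> chamber" "cotangent_SU3_moment m = diag a"
    using assms by (auto simp: implosion_domain_def su3_chamber_eq)
  have "ctranspose k ** diag a ** k = A"
    unfolding a(2)[symmetric] m moment_eq by (simp only: matrix_mul_assoc[symmetric] SU3_cancel[OF k])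
      (simp only: SU3_ctranspose(2)[OF k] matrix_mul_rid)
  then show thesis using that k a m by blast
qed

text \<open>The imaginary parts on the diagonal of the moment recover the chamber coordinates.
  Written without choosing them, the map is defined and continuous for all pairs of matrices, as
  \<open>sqrt\<close> is continuous on all reals.\<close>

definition implosion_map :: "(complex^3^3) \<times> (complex^3^3) \<Rightarrow> (complex^3) \<times> (complex^3)" where
  "implosion_map m = (let v = (\<lambda>i. Im (cotangent_SU3_moment m $ i $ i)) in
     (sqrt (v 1 - v 2) *\<^sub>R fst m $ 1, sqrt (v 2 - v 3) *\<^sub>R (\<chi> j. cnj (fst m $ 3 $ j))))"

lemma implosion_map_eq:
  "cotangent_SU3_moment (k, A) = diag a \<Longrightarrow> implosion_map (k, A) =
     (sqrt (a $ 1 - a $ 2) *\<^sub>R k $ 1, sqrt (a $ 2 - a $ 3) *\<^sub>R (\<chi> j. cnj (k $ 3 $ j)))"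
  by (simp add: implosion_map_def diag_nth Let_def)

lemma continuous_implosion_map: "continuous_on S implosion_map"
  unfolding implosion_map_def Let_def cotangent_SU3_moment_def su3_coadjoint_def matrix_mult_nth3 ctranspose_nth
  by (intro continuous_intros)

lemma norm_SU3_row:
  assumes "k \<in> carrier SU3"
  shows "norm (k $ i) = 1" "norm (\<chi> j. cnj (k $ i $ j)) = 1"
proof -
  have "(norm (k $ i))\<^sup>2 = 1\<^sup>2" "(norm (\<chi> j. cnj (k $ i $ j)))\<^sup>2 = 1\<^sup>2"
    using SU3_row_sq(1)[OF assms, of i] by (simp_all add: norm_complex_vec3)
  then show "norm (k $ i) = 1" "norm (\<chi> j. cnj (k $ i $ j)) = 1"
    by (simp_all only: power2_eq_iff_nonneg norm_ge_zero zero_le_one)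
qed

lemma closed_SU3: "closed (carrier SU3)"
proof -
  have "carrier SU3 = (\<Inter>i. \<Inter>j. {A. (A ** ctranspose A) $ i $ j = mat 1 $ i $ j}) \<inter> {A. det A = 1}"
    by (auto simp: vec_eq_iff)
  moreover have "closed {A :: complex^3^3. (A ** ctranspose A) $ i $ j = mat 1 $ i $ j}" for i j
    unfolding matrix_mult_nth3 ctranspose_nth by (intro closed_Collect_eq continuous_intros)
  moreover have "closed {A :: complex^3^3. det A = 1}"
    unfolding det_3 by (intro closed_Collect_eq continuous_intros)
  ultimately show ?thesis by (simp only:) (intro closed_Int closed_INT ballI)
qed

lemma compact_SU3: "compact (carrier SU3)"
proof -
  have "norm A \<le> 3" if "A \<in> carrier SU3" for A
  proof -
    have "norm A \<le> (\<Sum>i\<in>UNIV. norm (A $ i))"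
      unfolding norm_vec_def by (rule L2_set_le_sum) simp
    then show ?thesis using norm_SU3_row(1)[OF that] by (simp add: sum_3)
  qed
  then have "bounded (carrier SU3)" by (auto simp: bounded_iff)
  then show ?thesis using closed_SU3 compact_eq_bounded_closed by blast
qed

lemma pairing_scaleR: "pairing (c *\<^sub>R v) (d *\<^sub>R w) = of_real (c * d) * pairing v w"
  by (simp add: pairing_def algebra_simps) (simp add: scaleR_conv_of_real)

lemma unit_orthogonal_exists: "\<exists>u. norm u = 1 \<and> pairing v u = 0"
proof -
  have "\<exists>u. u \<noteq> 0 \<and> pairing v u = 0"
  proof (cases "v $ 1 = 0 \<and> v $ 2 = 0")
    case True
    then show ?thesis by (intro exI[of _ "vector [1, 0, 0]"]) (simp add: pairing_def vec3_eq_iff vector_3)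
  next
    case False
    then show ?thesis
      by (intro exI[of _ "vector [v $ 2, - v $ 1, 0]"]) (auto simp: pairing_def vec3_eq_iff vector_3)
  qed
  then obtain u where u: "u \<noteq> 0" "pairing v u = 0" by blast
  have "norm ((1 / norm u) *\<^sub>R u) = 1" "pairing v ((1 / norm u) *\<^sub>R u) = 0"
    using u pairing_scaleR[of 1 v "1 / norm u" u] by simp_all
  then show ?thesis by blast
qed

text \<open>When one component vanishes its direction is free, and any unit vector annihilated by
  the other one serves.\<close>

lemma quadric_polar:
  assumes "pairing z w = 0"
  shows "\<exists>r u. norm r = 1 \<and> norm u = 1 \<and> pairing r u = 0 \<and> z = norm z *\<^sub>R r \<and> w = norm w *\<^sub>R u"
proof -
  define sgn' where "sgn' = (\<lambda>v :: complex^3. (1 / norm v) *\<^sub>R v)"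
  have n: "norm (sgn' v) = 1" "v = norm v *\<^sub>R sgn' v" if "v \<noteq> 0" for v
    using that by (simp_all add: sgn'_def)
  have p: "pairing (sgn' z) (sgn' w) = 0"
    using assms unfolding sgn'_def pairing_scaleR by simp
  consider "z \<noteq> 0" "w \<noteq> 0" | "z = 0" "w \<noteq> 0" | "w = 0" "z \<noteq> 0" | "z = 0" "w = 0" by blast
  then show ?thesis
  proof cases
    case 1
    then show ?thesis using n p by blast
  next
    case 2
    obtain r where r: "norm r = 1" "pairing (sgn' w) r = 0" using unit_orthogonal_exists by blast
    have "norm r = 1 \<and> norm (sgn' w) = 1 \<and> pairing r (sgn' w) = 0 \<and> z = norm z *\<^sub>R r \<and> w = norm w *\<^sub>R sgn' w"
      using r n[OF 2(2)] 2(1) pairing_commute[of r] by simp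
    then show ?thesis by blast
  next
    case 3
    obtain u where u: "norm u = 1" "pairing (sgn' z) u = 0" using unit_orthogonal_exists by blast
    have "norm (sgn' z) = 1 \<and> norm u = 1 \<and> pairing (sgn' z) u = 0 \<and> z = norm z *\<^sub>R sgn' z \<and> w = norm w *\<^sub>R u"
      using u n[OF 3(2)] 3(1) by simp
    then show ?thesis by blast
  next
    case 4
    obtain u where u: "norm u = 1" "pairing e1 u = 0" using unit_orthogonal_exists by blast
    have "norm e1 = 1 \<and> norm u = 1 \<and> pairing e1 u = 0 \<and> z = norm z *\<^sub>R e1 \<and> w = norm w *\<^sub>R u"
      using u 4 by simp
    then show ?thesis by blast
  qed
qed

text \<open>The second row is the conjugate of the cross product of the third and the first one;
  orthonormality and the determinant then amount to Lagrange's identity.\<close>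

lemma SU3_with_rows:
  assumes "norm r = 1" "norm u = 1" "pairing r u = 0"
  shows "\<exists>k\<in>carrier SU3. k $ 1 = r \<and> k $ 3 = (\<chi> j. cnj (u $ j))"
proof -
  let ?x = "vector [u $ 2 * cnj (r $ 3) - u $ 3 * cnj (r $ 2), u $ 3 * cnj (r $ 1) - u $ 1 * cnj (r $ 3),
    u $ 1 * cnj (r $ 2) - u $ 2 * cnj (r $ 1)] :: complex^3"
  let ?k = "vector [r, ?x, \<chi> j. cnj (u $ j)] :: complex^3^3"
  have sq: "v $ 1 * cnj (v $ 1) + v $ 2 * cnj (v $ 2) + v $ 3 * cnj (v $ 3) = 1" if "norm v = 1" for v :: "complex^3"
  proof -
    have "complex_of_real ((cmod (v $ 1))\<^sup>2 + (cmod (v $ 2))\<^sup>2 + (cmod (v $ 3))\<^sup>2) = 1"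
      using norm_complex_vec3[of v] that by simp
    then show ?thesis by (simp only: of_real_add complex_norm_square)
  qed
  note r = sq[OF assms(1)] and u = sq[OF assms(2)]
  have p: "r $ 1 * u $ 1 + r $ 2 * u $ 2 + r $ 3 * u $ 3 = 0" using assms(3) by (simp add: pairing_def)
  have p': "cnj (r $ 1) * cnj (u $ 1) + cnj (r $ 2) * cnj (u $ 2) + cnj (r $ 3) * cnj (u $ 3) = 0"
    using arg_cong[OF p, of cnj] by simp
  have "?x $ 1 * cnj (?x $ 1) + ?x $ 2 * cnj (?x $ 2) + ?x $ 3 * cnj (?x $ 3) =
      (u $ 1 * cnj (u $ 1) + u $ 2 * cnj (u $ 2) + u $ 3 * cnj (u $ 3)) *
      (r $ 1 * cnj (r $ 1) + r $ 2 * cnj (r $ 2) + r $ 3 * cnj (r $ 3)) -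
      (r $ 1 * u $ 1 + r $ 2 * u $ 2 + r $ 3 * u $ 3) *
      (cnj (r $ 1) * cnj (u $ 1) + cnj (r $ 2) * cnj (u $ 2) + cnj (r $ 3) * cnj (u $ 3))"
    by (simp add: vector_3 algebra_simps)
  then have x: "?x $ 1 * cnj (?x $ 1) + ?x $ 2 * cnj (?x $ 2) + ?x $ 3 * cnj (?x $ 3) = 1"
    unfolding r u p by simp
  have "?k ** ctranspose ?k = mat 1"
    using r u x p p' unfolding matrix3_eq_iff matrix_mult_nth3 ctranspose_nth mat_1_nth vector_3
    by (auto simp: algebra_simps)
  moreover have "det ?k = ?x $ 1 * cnj (?x $ 1) + ?x $ 2 * cnj (?x $ 2) + ?x $ 3 * cnj (?x $ 3)"
    by (simp add: det_3 vector_3 algebra_simps)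
  ultimately have "?k \<in> carrier SU3" using x by simp
  moreover have "?k $ 1 = r" "?k $ 3 = (\<chi> j. cnj (u $ j))" by (simp_all add: vector_3)
  ultimately show ?thesis by blast
qed

lemma image_implosion_map: "implosion_map ` implosion_domain = quadric"
proof (intro equalityI subsetI)
  fix x assume "x \<in> implosion_map ` implosion_domain"
  then obtain m where m: "m \<in> implosion_domain" "x = implosion_map m" by blast
  obtain k a where k: "k \<in> carrier SU3" "m = (k, ctranspose k ** diag a ** k)" "cotangent_SU3_moment m = diag a"
    using implosion_domain_cases[OF m(1)] by metis
  \<comment> \<open>The rows are orthogonal for the Hermitian product; conjugating the third row
    turns this into the bilinear equation of the quadric.\<close>
  have "pairing (k $ 1) (\<chi> j. cnj (k $ 3 $ j)) = 0"
    using SU3_row_products[OF k(1), of 1 3] by (simp add: pairing_def)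
  then show "x \<in> quadric"
    using implosion_map_eq k(2,3) m(2) by (simp add: quadric_def pairing_scaleR)
next
  fix x assume "x \<in> quadric"
  then obtain z w where x: "x = (z, w)" "pairing z w = 0" by (auto simp: quadric_def)
  obtain r u where ru: "norm r = 1" "norm u = 1" "pairing r u = 0" "z = norm z *\<^sub>R r" "w = norm w *\<^sub>R u"
    using quadric_polar[OF x(2)] by blast
  obtain k where k: "k \<in> carrier SU3" "k $ 1 = r" "k $ 3 = (\<chi> j. cnj (u $ j))"
    using SU3_with_rows[OF ru(1-3)] by blast
  define s t where "s = (norm z)\<^sup>2" and "t = (norm w)\<^sup>2"
  \<comment> \<open>The unique solution with zero sum of \<open>a $ 1 - a $ 2 = s\<close> and
    \<open>a $ 2 - a $ 3 = t\<close>.\<close>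
  define a :: "real^3" where "a = vector [(2 * s + t) / 3, (t - s) / 3, - (s + 2 * t) / 3]"
  have st: "s \<ge> 0" "t \<ge> 0" by (simp_all add: s_def t_def)
  have a: "a $ 1 - a $ 2 = s" "a $ 2 - a $ 3 = t" "a $ 1 + a $ 2 + a $ 3 = 0"
    by (simp_all add: a_def vector_3 field_simps)
  have "a \<in> chamber" using a st by (simp add: chamber_def)
  note m = conjugate_in_implosion_domain[OF k(1) this]
  have "implosion_map (k, ctranspose k ** diag a ** k) = (norm z *\<^sub>R r, norm w *\<^sub>R u)"
    unfolding implosion_map_eq[OF m(2)] a k by (simp add: s_def t_def vec_eq_iff)
  then show "x \<in> implosion_map ` implosion_domain" using m(1) ru(4,5) x(1) by force
qed

lemma norm_implosion_map:
  assumes "k \<in> carrier SU3" "a \<in> chamber" "cotangent_SU3_moment (k, A) = diag a"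
  shows "norm (fst (implosion_map (k, A))) = sqrt (a $ 1 - a $ 2)"
    "norm (snd (implosion_map (k, A))) = sqrt (a $ 2 - a $ 3)"
  using assms(2) unfolding implosion_map_eq[OF assms(3)] by (simp_all add: norm_SU3_row[OF assms(1)] chamber_def)

lemma chamber_eqI:
  assumes "a \<in> chamber" "b \<in> chamber" "a $ 1 - a $ 2 = b $ 1 - b $ 2" "a $ 2 - a $ 3 = b $ 2 - b $ 3"
  shows "a = b"
proof -
  have "a $ 1 = b $ 1" "a $ 2 = b $ 2" "a $ 3 = b $ 3"
    using assms unfolding chamber_def mem_Collect_eq by linarith+
  then show ?thesis by (simp add: vec3_eq_iff)
qed

text \<open>Properness: the group is compact, and a bound on the image bounds the chamber
  coordinate, so the relevant points lie in the continuous image of a compact set.\<close>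

lemma quotient_map_implosion_map:
  "quotient_map (top_of_set implosion_domain) (top_of_set quadric) implosion_map"
proof (rule quotient_map_properI[OF continuous_implosion_map image_implosion_map])
  fix r :: real
  \<comment> \<open>Each of the two differences is at most \<open>r\<^sup>2\<close>, so with zero
    sum every coordinate is at most \<open>3 * r\<^sup>2\<close> in absolute value, a generous
    bound; the norm is at most the sum of the three.\<close>
  let ?D = "{a \<in> chamber. norm a \<le> 3 * r\<^sup>2 + 3 * r\<^sup>2 + 3 * r\<^sup>2}"
  let ?f = "\<lambda>p. (fst p, ctranspose (fst p) ** diag (snd p) ** fst p)"
  have cont: "continuous_on (carrier SU3 \<times> ?D) ?f"
  proof (intro continuous_on_Pair continuous_on_fst continuous_on_id)
    have "continuous_on (carrier SU3 \<times> ?D) (\<lambda>p. diag (snd p) $ i $ j)" for i j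
      unfolding diag_nth by (cases "i = j") (simp_all add: continuous_intros)
    then have "continuous_on (carrier SU3 \<times> ?D) (\<lambda>p. \<chi> i j. diag (snd p) $ i $ j)"
      by (intro continuous_on_vec_lambda)
    then have "continuous_on (carrier SU3 \<times> ?D) (\<lambda>p. diag (snd p))" by simp
    then have "continuous_on (carrier SU3 \<times> ?D) (\<lambda>p. (ctranspose (fst p) ** diag (snd p) ** fst p) $ i $ j)" for i j
      unfolding matrix_mult_nth3 ctranspose_nth by (intro continuous_intros)
    then have "continuous_on (carrier SU3 \<times> ?D) (\<lambda>p. \<chi> i j. (ctranspose (fst p) ** diag (snd p) ** fst p) $ i $ j)"
      by (intro continuous_on_vec_lambda)
    then show "continuous_on (carrier SU3 \<times> ?D) (\<lambda>p. ctranspose (fst p) ** diag (snd p) ** fst p)" by simp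
  qed
  have D: "compact ?D"
  proof -
    have "?D = {a. a $ 2 \<le> a $ 1} \<inter> {a. a $ 3 \<le> a $ 2} \<inter> {a. a $ 1 + a $ 2 + a $ 3 = 0} \<inter>
        cball 0 (3 * r\<^sup>2 + 3 * r\<^sup>2 + 3 * r\<^sup>2)"
      by (auto simp: chamber_def)
    moreover have "closed ({a :: real^3. a $ 2 \<le> a $ 1} \<inter> {a. a $ 3 \<le> a $ 2} \<inter> {a. a $ 1 + a $ 2 + a $ 3 = 0})"
      by (intro closed_Int closed_Collect_le closed_Collect_eq continuous_intros)
    ultimately show ?thesis by (simp only: closed_Int_compact compact_cball)
  qed
  show "\<exists>C. compact C \<and> C \<subseteq> implosion_domain \<and> {x \<in> implosion_domain. norm (implosion_map x) \<le> r} \<subseteq> C"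
  proof (intro exI conjI)
    show "compact (?f ` (carrier SU3 \<times> ?D))"
      using compact_continuous_image[OF cont compact_Times[OF compact_SU3 D]] .
    show "?f ` (carrier SU3 \<times> ?D) \<subseteq> implosion_domain"
      using conjugate_in_implosion_domain(1) by (auto simp del: SU3_simps(1))
    show "{x \<in> implosion_domain. norm (implosion_map x) \<le> r} \<subseteq> ?f ` (carrier SU3 \<times> ?D)"
    proof
      fix m assume "m \<in> {x \<in> implosion_domain. norm (implosion_map x) \<le> r}"
      then have m: "m \<in> implosion_domain" "norm (implosion_map m) \<le> r" by auto
      obtain k a where k: "k \<in> carrier SU3" "a \<in> chamber" "m = (k, ctranspose k ** diag a ** k)"
        "cotangent_SU3_moment m = diag a"
        using implosion_domain_cases[OF m(1)] by metis
      have "norm (fst (implosion_map m)) \<le> r" "norm (snd (implosion_map m)) \<le> r"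
        using m(2) norm_fst_le[of "fst (implosion_map m)" "snd (implosion_map m)"]
          norm_snd_le[of "snd (implosion_map m)" "fst (implosion_map m)"] by simp_all
      then have "sqrt (a $ 1 - a $ 2) \<le> r" "sqrt (a $ 2 - a $ 3) \<le> r"
        using norm_implosion_map[OF k(1,2)] k(3,4) by simp_all
      then have "a $ 1 - a $ 2 \<le> r\<^sup>2" "a $ 2 - a $ 3 \<le> r\<^sup>2"
        by (auto intro: sqrt_le_D)
      then have "\<bar>a $ 1\<bar> \<le> 3 * r\<^sup>2" "\<bar>a $ 2\<bar> \<le> 3 * r\<^sup>2" "\<bar>a $ 3\<bar> \<le> 3 * r\<^sup>2"
        using k(2) unfolding chamber_def mem_Collect_eq by linarith+
      moreover have "norm a \<le> \<bar>a $ 1\<bar> + \<bar>a $ 2\<bar> + \<bar>a $ 3\<bar>"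
        using norm_le_l1_cart[of a] by (simp add: sum_3)
      ultimately have "norm a \<le> 3 * r\<^sup>2 + 3 * r\<^sup>2 + 3 * r\<^sup>2" by linarith
      then show "m \<in> ?f ` (carrier SU3 \<times> ?D)"
        using k(1-3) by (intro image_eqI[of _ _ "(k, a)"]) (simp_all del: SU3_simps(1))
    qed
  qed
qed

section \<open>Stabilizers, their commutator subgroups and the fibres of the map\<close>

abbreviation stabilizer :: "real^3 \<Rightarrow> (complex^3^3) set" where
  "stabilizer a \<equiv> coadjoint_stabilizer SU3 su3_coadjoint (diag a)"

lemma stabilizer_iff: "g \<in> stabilizer a \<longleftrightarrow> g \<in> carrier SU3 \<and> g ** diag a = diag a ** g"
proof -
  have "g ** diag a ** ctranspose g = diag a \<longleftrightarrow> g ** diag a = diag a ** g" if g: "g \<in> carrier SU3"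
    using SU3_cancel(3,4)[OF g] by metis
  then show ?thesis by (auto simp: coadjoint_stabilizer_def su3_coadjoint_def simp del: SU3_simps(1))
qed

lemma stabilizer_entry:
  assumes "g \<in> stabilizer a" "a $ i \<noteq> a $ j"
  shows "g $ i $ j = 0"
proof -
  have "(g ** diag a) $ i $ j = g $ i $ j * (\<i> * complex_of_real (a $ j))"
    "(diag a ** g) $ i $ j = \<i> * complex_of_real (a $ i) * g $ i $ j"
    using exhaust_3[of i] exhaust_3[of j] by (auto simp: matrix_mult_nth3 diag_nth)
  then show ?thesis using assms by (auto simp: stabilizer_iff)
qed

lemma stabilizer_mult: "g \<in> stabilizer a \<Longrightarrow> h \<in> stabilizer a \<Longrightarrow> g ** h \<in> stabilizer a"
  unfolding stabilizer_iff using SU3_mult by (metis matrix_mul_assoc)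

lemma stabilizer_ctranspose: "g \<in> stabilizer a \<Longrightarrow> ctranspose g \<in> stabilizer a"
  unfolding stabilizer_iff using SU3_ctranspose(4) SU3_cancel(1,3) by (metis matrix_mul_assoc)

lemma stabilizer_diagonal_mult:
  assumes "g \<in> stabilizer a" "\<forall>j. j \<noteq> i \<longrightarrow> a $ i \<noteq> a $ j"
  shows "(g ** h) $ i $ i = g $ i $ i * h $ i $ i"
proof -
  have "g $ i $ j = 0" if "j \<noteq> i" for j using stabilizer_entry[OF assms(1)] assms(2) that by blast
  then show ?thesis using exhaust_3[of i] by (auto simp: matrix_mult_nth3)
qed

text \<open>Where \<open>a $ i\<close> differs from the other entries,
  \<open>g \<mapsto> g $ i $ i\<close> is a character of the stabilizer with values of modulus 1,
  hence trivial on commutators. \<open>?N\<close> is the common kernel of these characters.\<close>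

lemma derived_stabilizer:
  assumes "g \<in> derived SU3 (stabilizer a)"
  shows "g \<in> stabilizer a" "\<forall>j. j \<noteq> i \<longrightarrow> a $ i \<noteq> a $ j \<Longrightarrow> g $ i $ i = 1"
proof -
  let ?N = "{g \<in> stabilizer a. \<forall>i. (\<forall>j. j \<noteq> i \<longrightarrow> a $ i \<noteq> a $ j) \<longrightarrow> g $ i $ i = 1}"
  have sub: "g \<in> carrier SU3" if "g \<in> stabilizer a" for g using that by (simp only: stabilizer_iff)
  have one: "mat 1 \<in> ?N"
    using group.is_monoid[OF group_SU3, THEN monoid.one_closed] by (simp add: stabilizer_iff mat_1_nth del: SU3_simps(1))
  have "subgroup ?N SU3"
  proof (rule group.subgroupI[OF group_SU3])
    show "?N \<subseteq> carrier SU3" using sub by blast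
    show "?N \<noteq> {}" using one by blast
    show "inv\<^bsub>SU3\<^esub> g \<in> ?N" if "g \<in> ?N" for g
      using that inv_SU3[OF sub] stabilizer_ctranspose by (simp del: SU3_simps(1))
    show "g \<otimes>\<^bsub>SU3\<^esub> h \<in> ?N" if "g \<in> ?N" "h \<in> ?N" for g h
      using that by (simp add: stabilizer_mult stabilizer_diagonal_mult[where a = a] del: SU3_simps(1))
  qed
  moreover have "derived_set SU3 (stabilizer a) \<subseteq> ?N"
  proof
    fix x assume "x \<in> derived_set SU3 (stabilizer a)"
    then obtain g h where gh: "g \<in> stabilizer a" "h \<in> stabilizer a"
      and "x = g \<otimes>\<^bsub>SU3\<^esub> h \<otimes>\<^bsub>SU3\<^esub> inv\<^bsub>SU3\<^esub> g \<otimes>\<^bsub>SU3\<^esub> inv\<^bsub>SU3\<^esub> h" by blast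
    then have x: "x = g ** h ** ctranspose g ** ctranspose h"
      using inv_SU3 sub by (simp del: SU3_simps(1))
    have "x $ i $ i = 1" if i: "\<forall>j. j \<noteq> i \<longrightarrow> a $ i \<noteq> a $ j" for i
    proof -
      have unit: "g $ i $ i * cnj (g $ i $ i) = 1" if g: "g \<in> stabilizer a" for g
        using stabilizer_diagonal_mult[OF g i, of "ctranspose g"] SU3_ctranspose(1)[OF sub[OF g]]
        by (simp add: mat_1_nth)
      have "x $ i $ i = (g $ i $ i * cnj (g $ i $ i)) * (h $ i $ i * cnj (h $ i $ i))"
        unfolding x using gh i
        by (simp add: stabilizer_diagonal_mult[where a = a] stabilizer_mult stabilizer_ctranspose)
      then show ?thesis using unit gh by simp
    qed
    then show "x \<in> ?N" using gh x stabilizer_mult stabilizer_ctranspose by simp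
  qed
  ultimately have "derived SU3 (stabilizer a) \<subseteq> ?N"
    unfolding derived_def by (intro group.generate_subgroup_incl[OF group_SU3])
  then show "g \<in> stabilizer a" "\<forall>j. j \<noteq> i \<longrightarrow> a $ i \<noteq> a $ j \<Longrightarrow> g $ i $ i = 1"
    using assms by blast+
qed

text \<open>For each of the two rows either the coefficient vanishes, or the corresponding chamber
  coordinate is a simple eigenvalue and \<open>g\<close> leaves that row of \<open>k\<close>
  unchanged.\<close>

lemma implosion_map_action:
  assumes x: "(k, A) \<in> implosion_domain" and g: "g \<in> derived SU3 (coadjoint_stabilizer SU3 su3_coadjoint (cotangent_SU3_moment (k, A)))"
  shows "implosion_map (g ** k, A) = implosion_map (k, A)"
proof -
  obtain a where a: "a \<in> chamber" "cotangent_SU3_moment (k, A) = diag a"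
    using implosion_domain_cases[OF x] by metis
  note g = g[unfolded a(2)]
  have stab: "g \<in> carrier SU3" "g ** diag a = diag a ** g" using derived_stabilizer(1)[OF g] stabilizer_iff by blast+
  have "cotangent_SU3_moment (g ** k, A) = g ** (k ** A ** ctranspose k) ** ctranspose g"
    by (simp add: moment_eq ctranspose_mult matrix_mul_assoc)
  also have "\<dots> = diag a"
    using a(2) stab SU3_cancel(3)[OF stab(1)] by (simp add: moment_eq del: SU3_simps(1))
  finally have m: "cotangent_SU3_moment (g ** k, A) = diag a" .
  have 1: "(g ** k) $ 1 = k $ 1" if "a $ 1 > a $ 2"
  proof -
    have "\<forall>j. j \<noteq> 1 \<longrightarrow> a $ 1 \<noteq> a $ j" using a(1) that by (auto simp: chamber_def forall_3)
    then have "g $ 1 $ 1 = 1" using derived_stabilizer(2)[OF g] by blast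
    then show ?thesis using SU3_fix_first[OF stab(1)] by (simp add: vec3_eq_iff matrix_mult_nth3)
  qed
  have 3: "(g ** k) $ 3 = k $ 3" if "a $ 2 > a $ 3"
  proof -
    have "\<forall>j. j \<noteq> 3 \<longrightarrow> a $ 3 \<noteq> a $ j" using a(1) that by (auto simp: chamber_def forall_3)
    then have "g $ 3 $ 3 = 1" using derived_stabilizer(2)[OF g] by blast
    then show ?thesis using SU3_fix_third[OF stab(1)] by (simp add: vec3_eq_iff matrix_mult_nth3)
  qed
  show ?thesis
    unfolding implosion_map_eq[OF m] implosion_map_eq[OF a(2)] using 1 3 a(1) by (auto simp: chamber_def)
qed

text \<open>Equality of the nonzero rows says that \<open>g\<close> has a 1 in the matching corner.
  The four faces of the chamber are then treated separately: its vertex, its two walls and its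
  interior.\<close>

lemma implosion_map_fibre:
  assumes x: "(k, A) \<in> implosion_domain" and y: "(l, B) \<in> implosion_domain"
    and eq: "implosion_map (k, A) = implosion_map (l, B)"
  shows "\<exists>g \<in> derived SU3 (coadjoint_stabilizer SU3 su3_coadjoint (cotangent_SU3_moment (k, A))).
    l = g ** k \<and> B = A"
proof -
  obtain a where a: "a \<in> chamber" "cotangent_SU3_moment (k, A) = diag a" "k \<in> carrier SU3" "A = ctranspose k ** diag a ** k"
    using implosion_domain_cases[OF x] by (metis prod.inject)
  obtain b where b: "b \<in> chamber" "cotangent_SU3_moment (l, B) = diag b" "l \<in> carrier SU3" "B = ctranspose l ** diag b ** l"
    using implosion_domain_cases[OF y] by (metis prod.inject)
  \<comment> \<open>The norms of the two components are the square roots of the differences of the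
    chamber coordinates, which together with the zero sum determine the point.\<close>
  have "b = a"
    using norm_implosion_map[OF a(3,1,2)] norm_implosion_map[OF b(3,1,2)] eq by (intro chamber_eqI a b) simp_all
  note b = b[unfolded this]
  define g where "g = l ** ctranspose k"
  have g: "g \<in> carrier SU3" unfolding g_def by (intro SU3_mult SU3_ctranspose a b)
  have gk: "l = g ** k" unfolding g_def by (simp only: SU3_cancel(4)[OF a(3)])
  have rows: "sqrt (a $ 1 - a $ 2) *\<^sub>R k $ 1 = sqrt (a $ 1 - a $ 2) *\<^sub>R l $ 1"
    "sqrt (a $ 2 - a $ 3) *\<^sub>R (\<chi> j. cnj (k $ 3 $ j)) = sqrt (a $ 2 - a $ 3) *\<^sub>R (\<chi> j. cnj (l $ 3 $ j))"
    using eq unfolding implosion_map_eq[OF a(2)] implosion_map_eq[OF b(2)] by blast+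
  have 1: "g $ 1 $ 1 = 1" if "a $ 1 \<noteq> a $ 2"
    using rows(1) that SU3_row_products[OF a(3), of 1 1] by (simp add: g_def matrix_mult_nth3)
  have 3: "g $ 3 $ 3 = 1" if "a $ 2 \<noteq> a $ 3"
  proof -
    have "k $ 3 = l $ 3" using rows(2) that by (simp add: vec_eq_iff)
    then show ?thesis using SU3_row_products[OF a(3), of 3 3] by (simp add: g_def matrix_mult_nth3)
  qed
  have sub: "stabilizer a \<subseteq> carrier SU3" by (auto simp: stabilizer_iff simp del: SU3_simps(1))
  have gd: "g \<in> derived SU3 (stabilizer a)"
  proof (cases "a $ 1 = a $ 2")
    case True
    show ?thesis
    proof (cases "a $ 2 = a $ 3")
      case True
      \<comment> \<open>At the vertex the whole group is the stabilizer, and it equals its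
        commutator subgroup.\<close>
      then have "a $ 1 = 0" "a $ 2 = 0" "a $ 3 = 0"
        using \<open>a $ 1 = a $ 2\<close> a(1) unfolding chamber_def mem_Collect_eq by linarith+
      then have "stabilizer a = carrier SU3"
        by (auto simp: stabilizer_iff matrix3_eq_iff matrix_mult_nth3 diag_nth simp del: SU3_simps(1))
      then show ?thesis using SU3_perfect[OF g] by simp
    next
      case False
      \<comment> \<open>On this wall the stabilizer contains the SU(2) of the first two coordinates,
        and the corner entry 1 places \<open>g\<close> in that SU(2).\<close>
      have "emb12 p q \<in> stabilizer a" if "unit_pair p q" for p q
        using emb12.emb_in_SU3[OF that] \<open>a $ 1 = a $ 2\<close>
        by (simp add: stabilizer_iff matrix3_eq_iff matrix_mult_nth3 diag_nth del: SU3_simps(1))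
      then show ?thesis using SU3_fix_third_eq[OF g 3[OF False]] emb12.emb_in_derived[OF sub] by metis
    qed
  next
    case False
    note g1 = SU3_fix_first_eq[OF g 1[OF False]]
    show ?thesis
    proof (cases "a $ 2 = a $ 3")
      case True
      have "emb23 p q \<in> stabilizer a" if "unit_pair p q" for p q
        using emb23.emb_in_SU3[OF that] True
        by (simp add: stabilizer_iff matrix3_eq_iff matrix_mult_nth3 diag_nth del: SU3_simps(1))
      then show ?thesis using g1 emb23.emb_in_derived[OF sub] by metis
    next
      case False
      \<comment> \<open>In the interior both corner entries are 1, which makes \<open>g\<close>
        diagonal; the determinant gives the middle entry.\<close>
      have "g = mat 1"
        using SU3_fix_third[OF g 3[OF False]] 3[OF False] 1[OF \<open>a $ 1 \<noteq> a $ 2\<close>] SU3_fix_first[OF g 1[OF \<open>a $ 1 \<noteq> a $ 2\<close>]]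
          SU3_ctranspose(3)[OF g] by (simp add: matrix3_eq_iff mat_1_nth det_3)
      then show ?thesis unfolding derived_def using generate.one[of SU3] by simp
    qed
  qed
  \<comment> \<open>Since \<open>g\<close> commutes with \<open>diag a\<close>, it cancels from the
    conjugate that defines \<open>B\<close>.\<close>
  then have "g ** diag a = diag a ** g" using derived_stabilizer(1) stabilizer_iff by blast
  then have "ctranspose g ** diag a ** g = diag a"
    using SU3_cancel(1)[OF g] by (metis matrix_mul_assoc)
  then have "B = A"
    unfolding a(4) b(4) gk ctranspose_mult by (metis matrix_mul_assoc)
  then show ?thesis using gd gk a(2) by auto
qed

text \<open>Implosion and open cone are both quotients with the fibres of an explicit map onto the
  quadric, through which they are compared.\<close>

lemma universal_implosion_homeomorphic_open_cone:
  "SU3_universal_implosion homeomorphic_space open_cone SU3_implosion_link"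
proof -
  let ?X = "top_of_set implosion_domain"
  let ?r = "{(m, cotangent_SU3_action k m) |m k. k \<in> derived SU3 (coadjoint_stabilizer SU3 su3_coadjoint (cotangent_SU3_moment m))}"
  have eq: "SU3_universal_implosion = quotient_topology ?X ?r"
    by (simp only: SU3_universal_implosion_def imploded_cross_section_def cotangent_SU3_def subtopology_subtopology
      implosion_domain_def)
  have "quotient_topology ?X ?r homeomorphic_space top_of_set quadric"
  proof (rule quotient_topology_homeomorphic[OF quotient_map_implosion_map])
    fix x y assume "x \<in> topspace ?X" "y \<in> topspace ?X"
    then have xy: "x \<in> implosion_domain" "y \<in> implosion_domain" by simp_all
    show "quotient_point ?X ?r x = quotient_point ?X ?r y \<longleftrightarrow> implosion_map x = implosion_map y"
    proof
      have "implosion_map x = implosion_map y" if "(x, y) \<in> ?r" "x \<in> topspace ?X" for x y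
        using that implosion_map_action[of "fst x" "snd x"] by (auto simp: cotangent_SU3_action_def)
      then show "quotient_point ?X ?r x = quotient_point ?X ?r y \<Longrightarrow> implosion_map x = implosion_map y"
        using quotient_point_respects[of ?r ?X implosion_map x y] xy by simp
    next
      assume "implosion_map x = implosion_map y"
      then obtain g where "g \<in> derived SU3 (coadjoint_stabilizer SU3 su3_coadjoint (cotangent_SU3_moment x))"
        "y = cotangent_SU3_action g x"
        using implosion_map_fibre[of "fst x" "snd x" "fst y" "snd y"] xy
        by (auto simp: cotangent_SU3_action_def prod_eq_iff)
      then have "(x, y) \<in> ?r" by blast
      then show "quotient_point ?X ?r x = quotient_point ?X ?r y"
        using xy by (intro quotient_point_eqI) simp_all
    qed
  qed
  then show ?thesis
    unfolding eq
    by (rule homeomorphic_space_trans[OF _ iffD1[OF homeomorphic_space_sym open_cone_homeomorphic_quadric]])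
qed

text \<open>The first conjunct, witnessed by the four-sphere in the link, shows that intersection
  spaces in this sense exist; the second covers Moore approximations with domain of an arbitrary
  type.\<close>

theorem corollary5p15:
  shows "(\<exists>I :: (((complex^3) \<times> (complex^3)) \<times> real + (((complex^3) \<times> (complex^3)) \<times> real) set) set topology.
            is_intersection_space lower_middle_perversity 9 SU3_implosion_link
              SU3_universal_implosion I) \<and>
         (\<forall>I :: (((complex^3) \<times> (complex^3)) \<times> real + ('z \<times> real) set) set topology.
            is_intersection_space lower_middle_perversity 9 SU3_implosion_link
              SU3_universal_implosion I \<longrightarrow>
            (\<forall>j. linearly_isomorphic (reduced_real_homology j I)
                   (vector_space_of (if j \<in> {5, 9} then UNIV else {0 :: real}))))"
proof -
  \<comment> \<open>The perversity is evaluated at 10, the dimension of the cone, where it is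
    4.\<close>
  have five: "9 - lower_middle_perversity (9 + 1) = 5" by (simp add: lower_middle_perversity_def)
  show ?thesis
    unfolding is_intersection_space_def five
  proof (intro conjI allI impI)
    show "\<exists>I. SU3_universal_implosion homeomorphic_space open_cone SU3_implosion_link \<and>
        (\<exists>(Z :: ((complex^3) \<times> (complex^3)) topology) f.
          moore_approximation 5 SU3_implosion_link Z f \<and> I = intersection_space SU3_implosion_link Z f)"
      using universal_implosion_homeomorphic_open_cone moore_approximation_link by blast
  next
    fix I :: "(((complex^3) \<times> (complex^3)) \<times> real + ('z \<times> real) set) set topology" and j
    assume "SU3_universal_implosion homeomorphic_space open_cone SU3_implosion_link \<and>
        (\<exists>(Z :: 'z topology) f.
          moore_approximation 5 SU3_implosion_link Z f \<and> I = intersection_space SU3_implosion_link Z f)"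
    then obtain Z :: "'z topology" and f where "moore_approximation 5 SU3_implosion_link Z f"
      and I: "I = intersection_space SU3_implosion_link Z f" by blast
    then show "linearly_isomorphic (reduced_real_homology j I) (vector_space_of (if j \<in> {5, 9} then UNIV else {0 :: real}))"
      unfolding I by (intro reduced_homology_intersection_space_link)
  qed
qed

end
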